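(* Let $w=(w(t))_{t\ge0}$ be a circular Brownian motion in a $W^*$-probability space $(\mathscr{A},\varphi)$, and let $b$ be the free multiplicative Brownian motion, the unique solution of $db(t)=b(t)\,dw(t)$, $b(0)=1$. If $(\Pi_k)_{k\in\mathbb{N}}$ is a sequence of partitions of $[0,T]$ with $|\Pi_k|\to0$ as $k\to\infty$, then $(b_{\Pi_k})_{k\in\mathbb{N}}$ converges in finite-dimensional $*$-distributions to $b|_{[0,T]}$.
   Context: A $W^*$-probability space $(\mathscr{A},\varphi)$ is a von Neumann algebra with a faithful normal tracial state. A free Brownian motion $x$ is a norm-continuous process of selfadjoint elements with $x(0)=0$ such that, for $t>s\ge0$, $x(t)-x(s)$ is semicircular with mean $0$ and variance $t-s$ and is freely independent from the von Neumann algebra generated by $\{x(r):r\le s\}$. A circular Brownian motion is $w(t)=\frac1{\sqrt2}(x(t)+iy(t))$ with $x,y$ freely independent free Brownian motions. The free SDE is understood in the sense of Biane–Speicher: $b(t)=1+\int_0^t b(s)\,dw(s)$. For a partition $\Pi=\{0=t_0<t_1<\cdots<t_n=T\}$, $|\Pi|=\max_j(t_j-t_{j-1})$ and $b_\Pi(t)=\prod_{j=1}^n(1+w(t_j\wedge t)-w(t_{j-1}\wedge t))$ for $0\le t\le T$, factors ordered from left to right by increasing $j$. Processes $a_k=(a_k(t))_{0\le t\le T}$ in $\mathscr{A}$ converge in finite-dimensional $*$-distributions to $a$ if, for all $s_1,\dots,s_m\in[0,T]$, all $n$, all $i_1,\dots,i_n\in\{1,\dots,m\}$ and $\varepsilon_1,\dots,\varepsilon_n\in\{1,*\}$,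 $\varphi[a_k(s_{i_1})^{\varepsilon_1}\cdots a_k(s_{i_n})^{\varepsilon_n}]\to\varphi[a(s_{i_1})^{\varepsilon_1}\cdots a(s_{i_n})^{\varepsilon_n}]$. *)

theory Defs
  imports "HOL-Analysis.Analysis"
begin

section \<open>Operators on a complex Hilbert space\<close>

text \<open>The inner product is linear in the first argument and its real part is the
  real inner product of the underlying real Hilbert space, so that norm and topology are inherited.\<close>

class complex_hilbert_space = real_inner + complete_space +
  fixes scaleC :: "complex \<Rightarrow> 'a \<Rightarrow> 'a" (infixr "*\<^sub>C" 75)
    and cinner :: "'a \<Rightarrow> 'a \<Rightarrow> complex"
  assumes scaleC_add_right: "c *\<^sub>C (x + y) = c *\<^sub>C x + c *\<^sub>C y"
    and scaleC_add_left: "(c + d) *\<^sub>C x = c *\<^sub>C x + d *\<^sub>C x"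
    and scaleC_scaleC: "c *\<^sub>C d *\<^sub>C x = (c * d) *\<^sub>C x"
    and scaleR_eq_scaleC: "r *\<^sub>R x = complex_of_real r *\<^sub>C x"
    and cinner_commute: "cinner x y = cnj (cinner y x)"
    and cinner_add_left: "cinner (x + y) z = cinner x z + cinner y z"
    and cinner_scaleC_left: "cinner (c *\<^sub>C x) y = c * cinner x y"
    and inner_eq_Re_cinner: "inner x y = Re (cinner x y)"

text \<open>Elements of \<^typ>\<open>'h \<Rightarrow>\<^sub>L 'h\<close> are bounded real-linear operators; the complex-linear ones are
  those satisfying the following predicate.\<close>

definition complex_linear :: "('h::complex_hilbert_space \<Rightarrow>\<^sub>L 'h) \<Rightarrow> bool" where
  "complex_linear X \<longleftrightarrow> (\<forall>c v. X (c *\<^sub>C v) = c *\<^sub>C X v)"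

definition scale_op :: "complex \<Rightarrow> ('h::complex_hilbert_space \<Rightarrow>\<^sub>L 'h) \<Rightarrow> ('h \<Rightarrow>\<^sub>L 'h)" where
  "scale_op c X = Blinfun (\<lambda>v. c *\<^sub>C X v)"

text \<open>For complex-linear bounded operators the adjoint exists by the Riesz representation theorem.\<close>

definition adj :: "('h::complex_hilbert_space \<Rightarrow>\<^sub>L 'h) \<Rightarrow> ('h \<Rightarrow>\<^sub>L 'h)" where
  "adj X = (THE Y. \<forall>u v. cinner (X u) v = cinner u (blinfun_apply Y v))"

definition op_prod :: "('h::complex_hilbert_space \<Rightarrow>\<^sub>L 'h) list \<Rightarrow> ('h \<Rightarrow>\<^sub>L 'h)" where
  "op_prod Xs = foldr (o\<^sub>L) Xs id_blinfun"

lemma norm_scaleC: "norm (c *\<^sub>C x) = cmod c * norm (x :: 'h::complex_hilbert_space)"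
proof -
  have Im0: "Im (cinner x x) = 0"
    using arg_cong[OF cinner_commute[of x x], of Im] by simp
  have "cinner (c *\<^sub>C x) (c *\<^sub>C x) = c * cnj (c * cnj (cinner x x))"
    by (metis cinner_commute cinner_scaleC_left)
  also have "\<dots> = of_real ((cmod c)\<^sup>2) * cinner x x"
    unfolding complex_norm_square by (simp only: complex_cnj_mult complex_cnj_cnj mult_ac)
  finally have "(norm (c *\<^sub>C x))\<^sup>2 = (cmod c * norm x)\<^sup>2"
    by (simp add: power2_norm_eq_inner inner_eq_Re_cinner Im0 power_mult_distrib)
  then show ?thesis by (simp add: power2_eq_iff_nonneg)
qed

lemma scale_op_apply [simp]: "scale_op c X v = c *\<^sub>C X v"
proof -
  have "bounded_linear (\<lambda>v. c *\<^sub>C v :: 'a)"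
    by (rule bounded_linear_intro[where K = "cmod c"])
      (simp_all add: scaleC_add_right scaleR_eq_scaleC scaleC_scaleC norm_scaleC mult.commute)
  then have "bounded_linear (\<lambda>v. c *\<^sub>C X v)"
    by (rule bounded_linear_compose) (rule blinfun.bounded_linear_right)
  then show ?thesis by (simp add: scale_op_def bounded_linear_Blinfun_apply)
qed

lemma adj_unique:
  assumes "\<And>u v. cinner (blinfun_apply X u) v = cinner u (blinfun_apply Y v)"
  shows "adj X = Y"
  unfolding adj_def
proof (rule the_equality)
  fix Z assume Z: "\<forall>u v. cinner (X u) v = cinner u (blinfun_apply Z v)"
  show "Z = Y"
  proof (rule blinfun_eqI)
    fix v
    have "inner u (Z v) = inner u (Y v)" for u
      using Z assms by (metis inner_eq_Re_cinner)
    then show "Z v = Y v" using vector_eq_ldot by blast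
  qed
qed (use assms in auto)


section \<open>Von Neumann algebras and noncommutative probability spaces\<close>

definition unital_star_algebra :: "('h::complex_hilbert_space \<Rightarrow>\<^sub>L 'h) set \<Rightarrow> bool" where
  "unital_star_algebra M \<longleftrightarrow>
     (\<forall>X\<in>M. complex_linear X) \<and> id_blinfun \<in> M \<and>
     (\<forall>X\<in>M. \<forall>Y\<in>M. X + Y \<in> M \<and> X o\<^sub>L Y \<in> M) \<and>
     (\<forall>X\<in>M. \<forall>c. scale_op c X \<in> M) \<and> (\<forall>X\<in>M. adj X \<in> M)"

definition commutant :: "('h::complex_hilbert_space \<Rightarrow>\<^sub>L 'h) set \<Rightarrow> ('h \<Rightarrow>\<^sub>L 'h) set" where
  "commutant M = {X. complex_linear X \<and> (\<forall>Y\<in>M. X o\<^sub>L Y = Y o\<^sub>L X)}"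

definition von_neumann_algebra :: "('h::complex_hilbert_space \<Rightarrow>\<^sub>L 'h) set \<Rightarrow> bool" where
  "von_neumann_algebra M \<longleftrightarrow> unital_star_algebra M \<and> commutant (commutant M) = M"

definition star_alg_gen :: "('h::complex_hilbert_space \<Rightarrow>\<^sub>L 'h) set \<Rightarrow> ('h \<Rightarrow>\<^sub>L 'h) set" where
  "star_alg_gen S = unital_star_algebra hull S"

definition vN_gen :: "('h::complex_hilbert_space \<Rightarrow>\<^sub>L 'h) set \<Rightarrow> ('h \<Rightarrow>\<^sub>L 'h) set" where
  "vN_gen S = von_neumann_algebra hull S"

text \<open>The \<open>\<sigma>\<close>-weak topology, generated by the functionals
  \<open>X \<mapsto> \<Sum>n. \<langle>X \<xi>\<^sub>n, \<eta>\<^sub>n\<rangle>\<close> with square-summable sequences \<open>\<xi>\<close>, \<open>\<eta>\<close> of vectors.\<close>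

definition sigma_weak_topology :: "('h::complex_hilbert_space \<Rightarrow>\<^sub>L 'h) topology" where
  "sigma_weak_topology = topology_generated_by
     {{X. (\<Sum>n. cinner (blinfun_apply X (\<xi> n)) (\<eta> n)) \<in> U} | \<xi> \<eta> U.
        summable (\<lambda>n::nat. (norm (\<xi> n))\<^sup>2) \<and> summable (\<lambda>n. (norm (\<eta> n))\<^sup>2) \<and> open U}"

text \<open>A normal functional is a \<open>\<sigma>\<close>-weakly continuous one. Only the values of \<open>\<phi>\<close> on \<open>A\<close> matter.\<close>

locale wstar_probability_space =
  fixes A :: "('h::complex_hilbert_space \<Rightarrow>\<^sub>L 'h) set"
    and \<phi> :: "('h \<Rightarrow>\<^sub>L 'h) \<Rightarrow> complex"
  assumes von_neumann: "von_neumann_algebra A"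
    and add: "X \<in> A \<Longrightarrow> Y \<in> A \<Longrightarrow> \<phi> (X + Y) = \<phi> X + \<phi> Y"
    and scale: "X \<in> A \<Longrightarrow> \<phi> (scale_op c X) = c * \<phi> X"
    and positive: "X \<in> A \<Longrightarrow> \<phi> (adj X o\<^sub>L X) \<in> \<real>\<^sub>\<ge>\<^sub>0"
    and unital: "\<phi> id_blinfun = 1"
    and faithful: "X \<in> A \<Longrightarrow> \<phi> (adj X o\<^sub>L X) = 0 \<Longrightarrow> X = 0"
    and normal: "continuous_map (subtopology sigma_weak_topology A) euclidean \<phi>"
    and tracial: "X \<in> A \<Longrightarrow> Y \<in> A \<Longrightarrow> \<phi> (X o\<^sub>L Y) = \<phi> (Y o\<^sub>L X)"


section \<open>Free independence and free Brownian motions\<close>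

text \<open>Two sets of operators are free if the unital \<open>*\<close>-algebras they generate are: alternating
  products of centred elements are centred.\<close>

definition freely_independent ::
    "(('h::complex_hilbert_space \<Rightarrow>\<^sub>L 'h) \<Rightarrow> complex) \<Rightarrow> ('h \<Rightarrow>\<^sub>L 'h) set \<Rightarrow> ('h \<Rightarrow>\<^sub>L 'h) set \<Rightarrow> bool" where
  "freely_independent \<phi> S S' \<longleftrightarrow>
     (\<forall>ps :: (bool \<times> ('h \<Rightarrow>\<^sub>L 'h)) list.
        ps \<noteq> [] \<longrightarrow> successively (\<lambda>p q. fst p \<noteq> fst q) ps \<longrightarrow>
        (\<forall>(i, X) \<in> set ps. X \<in> star_alg_gen (if i then S else S') \<and> \<phi> X = 0) \<longrightarrow>
        \<phi> (op_prod (map snd ps)) = 0)"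

definition semicircle_measure :: "real \<Rightarrow> real \<Rightarrow> real measure" where
  "semicircle_measure m v = density lborel
     (\<lambda>x. ennreal (sqrt (max 0 (4 * v - (x - m)\<^sup>2)) / (2 * pi * v)))"

text \<open>The distribution of a selfadjoint element is determined by its moments, because the
  semicircle law has compact support.\<close>

definition semicircular ::
    "(('h::complex_hilbert_space \<Rightarrow>\<^sub>L 'h) \<Rightarrow> complex) \<Rightarrow> real \<Rightarrow> real \<Rightarrow> ('h \<Rightarrow>\<^sub>L 'h) \<Rightarrow> bool" where
  "semicircular \<phi> m v X \<longleftrightarrow> adj X = X \<and>
     (\<forall>n. \<phi> (op_prod (replicate n X)) = complex_of_real (\<integral>x. x ^ n \<partial>semicircle_measure m v))"

text \<open>Processes indexed by \<open>[0, \<infinity>)\<close> are functions on the reals; values at negative times are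
  irrelevant.\<close>

definition free_brownian_motion ::
    "('h::complex_hilbert_space \<Rightarrow>\<^sub>L 'h) set \<Rightarrow> (('h \<Rightarrow>\<^sub>L 'h) \<Rightarrow> complex) \<Rightarrow> (real \<Rightarrow> ('h \<Rightarrow>\<^sub>L 'h)) \<Rightarrow> bool" where
  "free_brownian_motion A \<phi> x \<longleftrightarrow>
     (\<forall>t\<ge>0. x t \<in> A \<and> adj (x t) = x t) \<and> continuous_on {0..} x \<and> x 0 = 0 \<and>
     (\<forall>s t. 0 \<le> s \<and> s < t \<longrightarrow>
        semicircular \<phi> 0 (t - s) (x t - x s) \<and>
        freely_independent \<phi> {x t - x s} (vN_gen (x ` {0..s})))"

definition circular_brownian_motion ::
    "('h::complex_hilbert_space \<Rightarrow>\<^sub>L 'h) set \<Rightarrow> (('h \<Rightarrow>\<^sub>L 'h) \<Rightarrow> complex) \<Rightarrow> (real \<Rightarrow> ('h \<Rightarrow>\<^sub>L 'h)) \<Rightarrow> bool" where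
  "circular_brownian_motion A \<phi> w \<longleftrightarrow>
     (\<exists>x y. free_brownian_motion A \<phi> x \<and> free_brownian_motion A \<phi> y \<and>
        freely_independent \<phi> (x ` {0..}) (y ` {0..}) \<and>
        (\<forall>t\<ge>0. w t = scale_op (1 / complex_of_real (sqrt 2)) (x t + scale_op \<i> (y t))))"


section \<open>Partitions and the free stochastic integral\<close>

text \<open>A partition \<open>0 = t\<^sub>0 < \<dots> < t\<^sub>n = T\<close> is the list of its points, \<open>P ! j = t\<^sub>j\<close>. For
  \<open>T = 0\<close> the only partition is \<open>[0]\<close>.\<close>

definition partition_of :: "real \<Rightarrow> real list \<Rightarrow> bool" where
  "partition_of T P \<longleftrightarrow> P \<noteq> [] \<and> hd P = 0 \<and> last P = T \<and> sorted_wrt (<) P"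

definition mesh :: "real list \<Rightarrow> real" where
  "mesh P = Max {P ! Suc j - P ! j | j. Suc j < length P}"

definition filtration :: "(real \<Rightarrow> ('h::complex_hilbert_space \<Rightarrow>\<^sub>L 'h)) \<Rightarrow> real \<Rightarrow> ('h \<Rightarrow>\<^sub>L 'h) set" where
  "filtration w t = vN_gen (w ` {0..t})"

definition step_process ::
    "real list \<Rightarrow> (nat \<Rightarrow> ('h::complex_hilbert_space \<Rightarrow>\<^sub>L 'h)) \<Rightarrow> real \<Rightarrow> ('h \<Rightarrow>\<^sub>L 'h)" where
  "step_process P c s =
     (\<Sum>j<length P - 1. indicator {P ! j..<P ! Suc j} s *\<^sub>R c j)"

definition step_integral ::
    "(real \<Rightarrow> ('h::complex_hilbert_space \<Rightarrow>\<^sub>L 'h)) \<Rightarrow> real list \<Rightarrow> (nat \<Rightarrow> ('h \<Rightarrow>\<^sub>L 'h)) \<Rightarrow> ('h \<Rightarrow>\<^sub>L 'h)" where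
  "step_integral w P c = (\<Sum>j<length P - 1. c j o\<^sub>L (w (P ! Suc j) - w (P ! j)))"

text \<open>The free stochastic integral \<open>\<integral>\<^sub>0\<^sup>t u(s) dw(s) = I\<close> of Biane and Speicher for the biprocess
  \<open>u \<otimes> 1\<close>, whose norm at time \<open>s\<close> is \<open>\<parallel>u(s)\<parallel>\<close>: \<open>u\<close> is approximated by simple adapted
  processes in the norm \<open>(\<integral>\<^sub>0\<^sup>t \<parallel>u(s)\<parallel>\<^sup>2 ds)\<^sup>1\<^sup>/\<^sup>2\<close>, and the integrals of the approximants converge
  in operator norm. By the free Burkholder-Davis-Gundy inequality the limit does not depend on the
  approximating sequence. Integrating against the increments of \<open>w = (x + iy)/\<surd>2\<close> is the same as
  combining the integrals against \<open>x\<close> and \<open>y\<close>.\<close>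

definition has_free_integral ::
    "(real \<Rightarrow> ('h::complex_hilbert_space \<Rightarrow>\<^sub>L 'h)) \<Rightarrow> (real \<Rightarrow> ('h \<Rightarrow>\<^sub>L 'h)) \<Rightarrow> real \<Rightarrow> ('h \<Rightarrow>\<^sub>L 'h) \<Rightarrow> bool" where
  "has_free_integral w u t I \<longleftrightarrow>
     (\<exists>P c. (\<forall>k::nat. partition_of t (P k) \<and>
               (\<forall>j. Suc j < length (P k) \<longrightarrow> c k j \<in> filtration w (P k ! j)) \<and>
               (\<lambda>s. (norm (step_process (P k) (c k) s - u s))\<^sup>2) integrable_on {0..t}) \<and>
        (\<lambda>k. integral {0..t} (\<lambda>s. (norm (step_process (P k) (c k) s - u s))\<^sup>2)) \<longlonglongrightarrow> 0 \<and>
        (\<lambda>k. step_integral w (P k) (c k)) \<longlonglongrightarrow> I)"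

text \<open>Solutions of \<open>db(t) = b(t) dw(t)\<close>, \<open>b(0) = 1\<close>; the initial condition is the equation at \<open>t = 0\<close>, since
  the integral over \<open>[0, 0]\<close> is \<open>0\<close>.\<close>

definition free_multiplicative_brownian_motion ::
    "(real \<Rightarrow> ('h::complex_hilbert_space \<Rightarrow>\<^sub>L 'h)) \<Rightarrow> (real \<Rightarrow> ('h \<Rightarrow>\<^sub>L 'h)) \<Rightarrow> bool" where
  "free_multiplicative_brownian_motion w b \<longleftrightarrow>
     continuous_on {0..} b \<and> (\<forall>t\<ge>0. b t \<in> filtration w t) \<and>
     (\<forall>t\<ge>0. \<exists>I. has_free_integral w b t I \<and> b t = id_blinfun + I)"

definition b_partition ::
    "(real \<Rightarrow> ('h::complex_hilbert_space \<Rightarrow>\<^sub>L 'h)) \<Rightarrow> real list \<Rightarrow> real \<Rightarrow> ('h \<Rightarrow>\<^sub>L 'h)" where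
  "b_partition w P t =
     op_prod (map (\<lambda>j. id_blinfun + w (min (P ! Suc j) t) - w (min (P ! j) t)) [0..<length P - 1])"


section \<open>Convergence in finite-dimensional *-distributions\<close>

text \<open>A word is a list of pairs \<open>(i, \<epsilon>)\<close>; the flag \<open>\<epsilon>\<close> says whether the adjoint is taken.\<close>

definition star_word ::
    "(real \<Rightarrow> ('h::complex_hilbert_space \<Rightarrow>\<^sub>L 'h)) \<Rightarrow> real list \<Rightarrow> (nat \<times> bool) list \<Rightarrow> ('h \<Rightarrow>\<^sub>L 'h)" where
  "star_word a ss ws = op_prod (map (\<lambda>(i, \<epsilon>). if \<epsilon> then adj (a (ss ! i)) else a (ss ! i)) ws)"

definition converges_fd_star ::
    "(('h::complex_hilbert_space \<Rightarrow>\<^sub>L 'h) \<Rightarrow> complex) \<Rightarrow> real \<Rightarrow>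
     (nat \<Rightarrow> real \<Rightarrow> ('h \<Rightarrow>\<^sub>L 'h)) \<Rightarrow> (real \<Rightarrow> ('h \<Rightarrow>\<^sub>L 'h)) \<Rightarrow> bool" where
  "converges_fd_star \<phi> T as a \<longleftrightarrow>
     (\<forall>ss ws. set ss \<subseteq> {0..T} \<longrightarrow> (\<forall>(i, \<epsilon>) \<in> set ws. i < length ss) \<longrightarrow>
        (\<lambda>k. \<phi> (star_word (as k) ss ws)) \<longlonglongrightarrow> \<phi> (star_word a ss ws))"

end

theory Submission
  imports Defs
begin

text \<open>Write \<open>\<Delta>\<^sub>j\<close> for the increments of \<open>w\<close> and \<open>\<parallel>X\<parallel>\<^sub>p\<close> for the norm of \<open>L\<^sup>p(\<phi>)\<close>. Freeness enters only through
  \<open>\<phi>(\<Delta>\<^sub>j a) = 0\<close> for \<open>a\<close> in the past, which passes from the \<open>*\<close>-algebra generated by the past to the von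
  Neumann algebra by normality of \<open>\<phi>\<close> and von Neumann's density theorem. The semicircle law enters only
  through \<open>\<parallel>a \<Delta>\<^sub>j\<parallel>\<^sub>p \<le> (8 (t\<^sub>j - t\<^bsub>j-1\<^esub>))\<^bsup>1/2\<^esup> \<parallel>a\<parallel>\<^sub>p\<close>. Together they bound the \<open>L\<^sup>2\<close> norm of a stochastic
  integral by that of its integrand, and a discrete Gronwall argument yields \<open>b\<^sub>\<Pi>(t) \<rightarrow> b(t)\<close> in \<open>L\<^sup>2\<close>.
  Since \<open>L\<^sup>2\<close> convergence alone does not control joint moments, one also needs \<open>b\<^sub>\<Pi>(t)\<close> bounded in every
  \<open>L\<^sup>p\<close> uniformly in \<open>\<Pi>\<close>. It suffices to take \<open>p = 2\<^bsup>m+1\<^esup>\<close>, where Hoelder's inequality follows from the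
  Cauchy-Schwarz inequality, and expanding \<open>\<parallel>B (1 + \<Delta>\<^sub>j)\<parallel>\<^sub>p\<^sup>p\<close> gives a factor \<open>1 + O(t\<^sub>j - t\<^bsub>j-1\<^esub>)\<close> per step.
  Convergence of the moments then follows by replacing one factor at a time.\<close>

section \<open>Adjoints\<close>

text \<open>Normality is tested on whole square-summable sequences of vectors, so the density
  theorem must approximate an operator on countably many vectors at once; hence the detour through
  the Hilbert space of such sequences. For dyadic \<open>p\<close> the \<open>p\<close>-th power of
  the norm is the state of a word in \<open>X\<close> and \<open>adj X\<close>, so all estimates are
  estimates on words, without functional calculus. The price is that Hoelder for a product raises
  the level \<open>m\<close> by one, which is harmless because moments are bounded at every level.
  The product along a partition is itself a step integral, of the process frozen at left endpoints;
  the error is thus a difference of step integrals on two unrelated grids, one of them supplied by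
  the definition of the integral, and is compared on a common refinement. The constant 8 is the
  square of \<open>4 / sqrt 2\<close>: over a cell of length \<open>h\<close> each of the two
  semicircular parts contributes \<open>2 * sqrt h\<close>. The Gronwall constant 32 is this 8 times
  the 4 that comes from splitting the square of a sum twice.\<close>

lemma parallelogram_law:
  fixes a b :: "'a::real_inner"
  shows "(norm (a - b))\<^sup>2 = 2 * (norm a)\<^sup>2 + 2 * (norm b)\<^sup>2 - (norm (a + b))\<^sup>2"
  by (simp add: power2_norm_eq_inner algebra_simps inner_commute)

text \<open>Midpoints of \<open>K\<close> stay in \<open>K\<close>, so the parallelogram law makes a
  minimising sequence for the distance Cauchy. Only the real structure is assumed, so that the lemma
  serves both the Riesz representation and the density theorem.\<close>

lemma closed_subspace_orthogonal_projection:
  fixes K :: "'a::{real_inner,complete_space} set"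
  assumes "closed K" and "subspace K"
  obtains y where "y \<in> K" and "\<And>z. z \<in> K \<Longrightarrow> inner (x - y) z = 0"
proof -
  define D where "D = (\<lambda>y. (norm (x - y))\<^sup>2) ` K"
  define d where "d = Inf D"
  have D_ne: "D \<noteq> {}" using subspace_0[OF assms(2)] by (auto simp: D_def)
  have D_bdd: "bdd_below D" by (rule bdd_belowI[of _ 0]) (auto simp: D_def)
  have d_le: "d \<le> (norm (x - y))\<^sup>2" if "y \<in> K" for y
    unfolding d_def by (rule cInf_lower) (use that D_bdd in \<open>auto simp: D_def\<close>)
  have "\<exists>y\<in>K. (norm (x - y))\<^sup>2 < d + inverse (real (Suc n))" for n
    using cInf_lessD[OF D_ne, of "d + inverse (real (Suc n))"] by (auto simp: d_def D_def)
  then obtain y where yK: "\<And>n. y n \<in> K"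
    and y: "\<And>n. (norm (x - y n))\<^sup>2 < d + inverse (real (Suc n))" by metis
  have diff: "(norm (y m - y n))\<^sup>2 \<le> 2 * inverse (real (Suc m)) + 2 * inverse (real (Suc n))" for m n
  proof -
    have "(1/2) *\<^sub>R (y m + y n) \<in> K"
      using assms(2) yK by (simp add: subspace_add subspace_scale)
    then have "d \<le> (norm (x - (1/2) *\<^sub>R (y m + y n)))\<^sup>2" by (rule d_le)
    also have "\<dots> = (norm ((1/2) *\<^sub>R ((x - y n) + (x - y m))))\<^sup>2"
      by (simp add: algebra_simps flip: scaleR_add_left)
    finally have "4 * d \<le> (norm ((x - y n) + (x - y m)))\<^sup>2" by (simp add: power_divide)
    moreover have "(norm (y m - y n))\<^sup>2 =
        2 * (norm (x - y n))\<^sup>2 + 2 * (norm (x - y m))\<^sup>2 - (norm ((x - y n) + (x - y m)))\<^sup>2"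
      using parallelogram_law[of "x - y n" "x - y m"] by simp
    ultimately show ?thesis using y[of m] y[of n] by simp
  qed
  have "Cauchy y"
  proof (rule metric_CauchyI)
    fix e :: real assume "0 < e"
    then obtain M where M: "inverse (real (Suc M)) < e\<^sup>2 / 4"
      using reals_Archimedean[of "e\<^sup>2 / 4"] by auto
    have "dist (y m) (y n) < e" if "M \<le> m" "M \<le> n" for m n
    proof -
      have "inverse (real (Suc m)) \<le> inverse (real (Suc M))" "inverse (real (Suc n)) \<le> inverse (real (Suc M))"
        using that by (simp_all add: le_imp_inverse_le)
      then have "(norm (y m - y n))\<^sup>2 < e\<^sup>2" using diff[of m n] M by linarith
      then show ?thesis using \<open>0 < e\<close> by (simp add: dist_norm power2_less_imp_less)
    qed
    then show "\<exists>M. \<forall>m\<ge>M. \<forall>n\<ge>M. dist (y m) (y n) < e" by blast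
  qed
  then obtain y0 where y0: "y \<longlonglongrightarrow> y0" using Cauchy_convergent_iff convergent_def by blast
  have y0K: "y0 \<in> K" using closed_sequentially[OF assms(1) _ y0] yK by blast
  have "(\<lambda>n. (norm (x - y n))\<^sup>2) \<longlonglongrightarrow> (norm (x - y0))\<^sup>2"
    by (intro tendsto_intros y0)
  moreover have "(\<lambda>n. d + inverse (real (Suc n))) \<longlonglongrightarrow> d + 0"
    by (intro tendsto_intros LIMSEQ_inverse_real_of_nat)
  ultimately have min: "(norm (x - y0))\<^sup>2 \<le> d"
    using y by (intro LIMSEQ_le) (auto intro: less_imp_le)
  have "inner (x - y0) z = 0" if z: "z \<in> K" for z
  proof (cases "z = 0")
    case False
    \<comment> \<open>This \<open>t\<close> minimises the quadratic polynomial
      \<open>(norm (x - y0 - t z))^2\<close>; a nonzero inner product would beat the minimal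
      distance.\<close>
    define t where "t = inner (x - y0) z / (norm z)\<^sup>2"
    have "y0 + t *\<^sub>R z \<in> K" using assms(2) y0K z by (simp add: subspace_add subspace_scale)
    then have "(norm (x - y0))\<^sup>2 \<le> (norm (x - y0 - t *\<^sub>R z))\<^sup>2"
      using order_trans[OF min d_le] by (metis diff_diff_add)
    also have "\<dots> = (norm (x - y0))\<^sup>2 - 2 * t * inner (x - y0) z + t\<^sup>2 * (norm z)\<^sup>2"
      unfolding power2_norm_eq_inner by (simp add: inner_diff_left inner_diff_right inner_commute power2_eq_square)
    also have "\<dots> = (norm (x - y0))\<^sup>2 - (inner (x - y0) z)\<^sup>2 / (norm z)\<^sup>2"
      using False by (simp add: t_def power2_eq_square field_simps)
    finally have "(inner (x - y0) z)\<^sup>2 / (norm z)\<^sup>2 \<le> 0" by simp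
    then show ?thesis using False by (simp add: divide_le_0_iff)
  qed simp
  then show ?thesis using that y0K by blast
qed

lemma riesz_representation:
  fixes f :: "'a::{real_inner,complete_space} \<Rightarrow> real"
  assumes "bounded_linear f"
  obtains v where "\<And>u. f u = inner u v"
proof (cases "\<forall>u. f u = 0")
  case True
  then show ?thesis using that[of 0] by simp
next
  case False
  interpret f: bounded_linear f by fact
  obtain x where x: "f x \<noteq> 0" using False by blast
  define K where "K = {u. f u = 0}"
  have "closed K" unfolding K_def
    by (intro closed_Collect_eq f.continuous_on continuous_on_id continuous_on_const)
  moreover have "subspace K" by (auto simp: subspace_def K_def f.add f.scale f.zero)
  ultimately obtain y where y: "y \<in> K" and orth: "\<And>z. z \<in> K \<Longrightarrow> inner (x - y) z = 0"
    by (rule closed_subspace_orthogonal_projection[where x = x]) blast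
  \<comment> \<open>\<open>e\<close> is orthogonal to the kernel; the representing vector is a
    multiple of it, with the scaling fixed by the value \<open>f e\<close>.\<close>
  define e where "e = x - y"
  have fe: "f e \<noteq> 0" using x y by (simp add: e_def K_def f.diff)
  then have e: "inner e e \<noteq> 0" by (auto simp: f.zero)
  have "f u = inner u ((f e / inner e e) *\<^sub>R e)" for u
  proof -
    have "u - (f u / f e) *\<^sub>R e \<in> K" using fe by (simp add: K_def f.diff f.scale)
    then have "inner e (u - (f u / f e) *\<^sub>R e) = 0" using orth by (simp add: e_def)
    then have "inner u e = f u / f e * inner e e" by (simp add: inner_diff_right inner_commute)
    then show ?thesis using fe e by simp
  qed
  then show ?thesis by (rule that)
qed

section \<open>The complex inner product and the calculus of adjoints\<close>

lemma cinner_add_right: "cinner (x :: 'h::complex_hilbert_space) (y + z) = cinner x y + cinner x z"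
  by (metis cinner_add_left cinner_commute complex_cnj_add)

lemma cinner_scaleC_right: "cinner (x :: 'h::complex_hilbert_space) (c *\<^sub>C y) = cnj c * cinner x y"
  by (metis cinner_scaleC_left cinner_commute complex_cnj_mult)

lemma scaleC_one [simp]: "1 *\<^sub>C (x :: 'h::complex_hilbert_space) = x"
  using scaleR_eq_scaleC[of 1 x] by simp

lemma scaleC_minus1: "(-1) *\<^sub>C (x :: 'h::complex_hilbert_space) = - x"
  using scaleR_eq_scaleC[of "-1" x] by simp

lemma scaleC_zero_left [simp]: "0 *\<^sub>C (x :: 'h::complex_hilbert_space) = 0"
  using scaleR_eq_scaleC[of 0 x] by simp

lemma cinner_zero_left [simp]: "cinner 0 (x :: 'h::complex_hilbert_space) = 0"
  using cinner_add_left[of 0 0 x] by simp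

lemma cinner_zero_right [simp]: "cinner (x :: 'h::complex_hilbert_space) 0 = 0"
  using cinner_add_right[of x 0 0] by simp

lemma cinner_minus_left: "cinner (- (x :: 'h::complex_hilbert_space)) y = - cinner x y"
  using cinner_scaleC_left[of "-1" x y] by (simp add: scaleC_minus1)

lemma cinner_diff_left: "cinner ((x :: 'h::complex_hilbert_space) - y) z = cinner x z - cinner y z"
  using cinner_add_left[of x "- y" z] by (simp add: cinner_minus_left)

text \<open>Recovers the complex inner product from the real one; it upgrades the real adjoint in
  \<open>adj_exists\<close> to a complex one.\<close>

lemma cinner_eq_inner: "cinner (x :: 'h::complex_hilbert_space) y = Complex (inner x y) (inner x (\<i> *\<^sub>C y))"
  by (simp add: inner_eq_Re_cinner cinner_scaleC_right complex_eq_iff)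

text \<open>Multiplying \<open>x\<close> by the conjugate of the inner product makes the product
  real, and the real Cauchy-Schwarz inequality applies.\<close>

lemma norm_cinner_le: "cmod (cinner x y) \<le> norm x * norm (y :: 'h::complex_hilbert_space)"
proof -
  define z where "z = cinner x y"
  have "(cmod z)\<^sup>2 = Re (cinner (cnj z *\<^sub>C x) y)"
    by (simp add: cinner_scaleC_left z_def mult.commute flip: complex_norm_square)
  also have "\<dots> = inner (cnj z *\<^sub>C x) y" by (simp add: inner_eq_Re_cinner)
  also have "\<dots> \<le> cmod z * norm x * norm y"
    using norm_cauchy_schwarz[of "cnj z *\<^sub>C x" y] by (simp add: norm_scaleC)
  finally have "cmod z * cmod z \<le> cmod z * (norm x * norm y)" by (simp add: power2_eq_square mult.assoc)
  then show ?thesis unfolding z_def[symmetric]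
    by (cases "z = 0") (auto simp: mult_le_cancel_left)
qed

lemma complex_linear_compose:
  "complex_linear X \<Longrightarrow> complex_linear Y \<Longrightarrow> complex_linear (X o\<^sub>L Y)"
  by (simp add: complex_linear_def)

text \<open>Riesz gives the adjoint for the real inner product. It commutes with \<open>\<i>\<close>
  because \<open>X\<close> does, and so it is also the adjoint for the complex one.\<close>

lemma adj_exists:
  fixes X :: "'h::complex_hilbert_space \<Rightarrow>\<^sub>L 'h"
  assumes "complex_linear X"
  obtains Y where "\<And>u v. cinner (X u) v = cinner u (blinfun_apply Y v)"
proof -
  have "\<exists>y. \<forall>u. inner (X u) v = inner u y" for v
  proof -
    have "bounded_linear (\<lambda>u. inner (X u) v)"
      by (rule bounded_linear_compose[OF bounded_linear_inner_left]) (rule blinfun.bounded_linear_right)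
    from riesz_representation[OF this] show ?thesis by metis
  qed
  then obtain g where g: "\<And>u v. inner (X u) v = inner u (g v)" by metis
  have eqI: "a = b" if "\<And>u. inner u a = inner u b" for a b :: 'h
    using that vector_eq_ldot by blast
  have "norm (g v) \<le> norm v * norm X" for v
  proof -
    have "norm (g v) * norm (g v) = inner (X (g v)) v"
      by (simp add: g flip: power2_norm_eq_inner power2_eq_square)
    also have "\<dots> \<le> norm (X (g v)) * norm v" by (rule norm_cauchy_schwarz)
    also have "\<dots> \<le> norm X * norm (g v) * norm v"
      by (rule mult_right_mono) (auto simp: norm_blinfun)
    finally show ?thesis by (cases "g v = 0") (auto simp: mult_ac)
  qed
  then have "bounded_linear g"
    by (intro bounded_linear_intro[where K = "norm X"] eqI)
      (auto simp: g[symmetric] inner_add_right)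
  then have app: "blinfun_apply (Blinfun g) = g" by (rule bounded_linear_Blinfun_apply)
  have "g (\<i> *\<^sub>C v) = \<i> *\<^sub>C g v" for v
  proof (rule eqI)
    fix u
    \<comment> \<open>Multiplication by \<open>\<i>\<close> is skew-symmetric for the real inner
      product.\<close>
    have *: "inner p (\<i> *\<^sub>C q) = inner ((- \<i>) *\<^sub>C p) q" for p q :: 'h
      by (simp add: inner_eq_Re_cinner cinner_scaleC_left cinner_scaleC_right)
    show "inner u (g (\<i> *\<^sub>C v)) = inner u (\<i> *\<^sub>C g v)"
      using assms by (simp add: * complex_linear_def flip: g)
  qed
  then have "cinner (X u) v = cinner u (Blinfun g v)" for u v
    by (simp add: app cinner_eq_inner g)
  then show ?thesis by (rule that)
qed

lemma cinner_adj_right: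
  assumes "complex_linear X"
  shows "cinner u (adj X v) = cinner (X u) v"
  using adj_exists[OF assms] adj_unique by metis

lemma cinner_adj_left:
  assumes "complex_linear X"
  shows "cinner (adj X u) v = cinner u (X v)"
  by (metis assms cinner_adj_right cinner_commute)

lemma complex_linear_adj:
  assumes "complex_linear (X :: 'h::complex_hilbert_space \<Rightarrow>\<^sub>L 'h)"
  shows "complex_linear (adj X)"
  unfolding complex_linear_def
proof (intro allI)
  fix c v
  have "inner u (adj X (c *\<^sub>C v)) = inner u (c *\<^sub>C adj X v)" for u
    by (simp add: inner_eq_Re_cinner cinner_adj_right assms cinner_scaleC_right)
  then show "adj X (c *\<^sub>C v) = c *\<^sub>C adj X v" using vector_eq_ldot by blast
qed

lemma complex_linear_scale [simp]: "complex_linear X \<Longrightarrow> complex_linear (scale_op c X)"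
  by (simp add: complex_linear_def scaleC_scaleC mult.commute)

lemma complex_linear_id [simp]: "complex_linear id_blinfun"
  by (simp add: complex_linear_def)

lemma complex_linear_add: "complex_linear X \<Longrightarrow> complex_linear Y \<Longrightarrow> complex_linear (X + Y)"
  by (simp add: complex_linear_def blinfun.add_left scaleC_add_right)

lemma adj_adj: "complex_linear X \<Longrightarrow> adj (adj X) = X"
  by (rule adj_unique) (simp add: cinner_adj_left)

lemma adj_compose:
  "complex_linear X \<Longrightarrow> complex_linear Y \<Longrightarrow> adj (X o\<^sub>L Y) = adj Y o\<^sub>L adj X"
  by (rule adj_unique) (simp add: cinner_adj_right)

lemma adj_add: "complex_linear X \<Longrightarrow> complex_linear Y \<Longrightarrow> adj (X + Y) = adj X + adj Y"
  by (rule adj_unique) (simp add: cinner_adj_right blinfun.add_left cinner_add_left cinner_add_right)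

lemma adj_scale: "complex_linear X \<Longrightarrow> adj (scale_op c X) = scale_op (cnj c) (adj X)"
  by (rule adj_unique) (simp add: cinner_adj_right cinner_scaleC_left cinner_scaleC_right)

lemma adj_id [simp]: "adj id_blinfun = id_blinfun"
  by (rule adj_unique) simp

lemma norm_adj_le:
  assumes "complex_linear X"
  shows "norm (adj X) \<le> norm X"
proof (rule norm_blinfun_bound)
  fix v
  have "norm (adj X v) * norm (adj X v) = inner (X (adj X v)) v"
    using power2_norm_eq_inner[of "adj X v"]
    by (simp add: inner_eq_Re_cinner assms power2_eq_square flip: cinner_adj_right)
  also have "\<dots> \<le> norm (X (adj X v)) * norm v" by (rule norm_cauchy_schwarz)
  also have "\<dots> \<le> norm X * norm (adj X v) * norm v"
    by (rule mult_right_mono) (auto simp: norm_blinfun)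
  finally show "norm (adj X v) \<le> norm X * norm v"
    by (cases "adj X v = 0") (auto simp: mult_ac)
qed simp

lemma compose_scale_left: "scale_op c X o\<^sub>L Y = scale_op c (X o\<^sub>L Y)"
  by (rule blinfun_eqI) simp

lemma compose_scale_right: "complex_linear X \<Longrightarrow> X o\<^sub>L scale_op c Y = scale_op c (X o\<^sub>L Y)"
  by (rule blinfun_eqI) (simp add: complex_linear_def)

lemma compose_assoc: "(X o\<^sub>L Y) o\<^sub>L Z = X o\<^sub>L (Y o\<^sub>L Z)"
  by (rule blinfun_eqI) simp

lemma compose_add_left: "(X + Y) o\<^sub>L Z = (X o\<^sub>L Z) + (Y o\<^sub>L Z)"
  by (rule blinfun_eqI) (simp add: blinfun.add_left)

lemma compose_add_right: "X o\<^sub>L (Y + Z) = (X o\<^sub>L Y) + (X o\<^sub>L Z)"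
  by (rule blinfun_eqI) (simp add: blinfun.add_left blinfun.add_right)

lemma compose_diff_left: "(X - Y) o\<^sub>L Z = (X o\<^sub>L Z) - (Y o\<^sub>L Z)"
  by (rule blinfun_eqI) (simp add: blinfun.diff_left)

lemma compose_diff_right: "X o\<^sub>L (Y - Z) = (X o\<^sub>L Y) - (X o\<^sub>L Z)"
  by (rule blinfun_eqI) (simp add: blinfun.diff_left blinfun.diff_right)

lemma compose_id [simp]: "X o\<^sub>L id_blinfun = X" "id_blinfun o\<^sub>L X = X"
  by (auto intro: blinfun_eqI)

lemma scale_op_minus1: "scale_op (-1) X = - X"
  by (rule blinfun_eqI) (simp add: scaleC_minus1 blinfun.minus_left)

lemma scale_op_scale_op: "scale_op c (scale_op d X) = scale_op (c * d) X"
  by (rule blinfun_eqI) (simp add: scaleC_scaleC)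

lemma scale_op_zero_left [simp]: "scale_op 0 X = 0"
  by (rule blinfun_eqI) simp

lemma scale_op_one [simp]: "scale_op 1 X = X"
  by (rule blinfun_eqI) simp

lemma scale_op_of_real: "scale_op (of_real r) X = r *\<^sub>R X"
  by (rule blinfun_eqI) (simp add: scaleR_eq_scaleC blinfun.scaleR_left)

lemma op_prod_Nil [simp]: "op_prod [] = id_blinfun"
  by (simp add: op_prod_def)

lemma op_prod_Cons [simp]: "op_prod (X # Xs) = X o\<^sub>L op_prod Xs"
  by (simp add: op_prod_def)

abbreviation op_power :: "nat \<Rightarrow> ('h::complex_hilbert_space \<Rightarrow>\<^sub>L 'h) \<Rightarrow> ('h \<Rightarrow>\<^sub>L 'h)" where
  "op_power n X \<equiv> op_prod (replicate n X)"

lemma op_prod_append: "op_prod (Xs @ Ys) = op_prod Xs o\<^sub>L op_prod Ys"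
  by (induction Xs) (simp_all add: compose_assoc)

section \<open>Square-summable sequences of vectors\<close>

definition square_summable :: "(nat \<Rightarrow> 'a::real_normed_vector) \<Rightarrow> bool" where
  "square_summable f \<longleftrightarrow> summable (\<lambda>n. (norm (f n))\<^sup>2)"

lemma norm_add_square_le: "(norm (a + b))\<^sup>2 \<le> 2 * (norm a)\<^sup>2 + 2 * (norm (b::'a::real_normed_vector))\<^sup>2"
proof -
  have "(norm (a + b))\<^sup>2 \<le> (norm a + norm b)\<^sup>2" by (intro power_mono norm_triangle_ineq) simp
  also have "\<dots> \<le> 2 * (norm a)\<^sup>2 + 2 * (norm b)\<^sup>2"
    using zero_le_power2[of "norm a - norm b"] by (simp add: power2_sum power2_diff)
  finally show ?thesis .
qed

lemma square_summable_zero [simp]: "square_summable (\<lambda>n. 0)"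
  by (simp add: square_summable_def)

lemma square_summable_add:
  assumes "square_summable f" "square_summable g"
  shows "square_summable (\<lambda>n. f n + g n)"
  unfolding square_summable_def
proof (rule summable_comparison_test')
  show "summable (\<lambda>n. 2 * (norm (f n))\<^sup>2 + 2 * (norm (g n))\<^sup>2)"
    using assms by (intro summable_add summable_mult) (auto simp: square_summable_def)
qed (simp add: norm_add_square_le)

lemma square_summable_bounded_linear:
  assumes "bounded_linear h" "square_summable f"
  shows "square_summable (\<lambda>n. h (f n))"
proof -
  obtain C where C: "\<And>x. norm (h x) \<le> norm x * C"
    using bounded_linear.bounded[OF assms(1)] by blast
  show ?thesis unfolding square_summable_def
  proof (rule summable_comparison_test')
    show "summable (\<lambda>n. C\<^sup>2 * (norm (f n))\<^sup>2)"
      using assms(2) by (intro summable_mult) (auto simp: square_summable_def)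
    show "norm ((norm (h (f n)))\<^sup>2) \<le> C\<^sup>2 * (norm (f n))\<^sup>2" for n
      using power_mono[OF C[of "f n"], of 2] by (simp add: power_mult_distrib mult.commute)
  qed
qed

text \<open>Bounds the amplification of \<open>X\<close>, and makes left multiplication by
  \<open>X\<close> continuous for the ultrastrong seminorms.\<close>

lemma suminf_square_blinfun_le:
  assumes "square_summable v"
  shows "(\<Sum>n. (norm (blinfun_apply X (v n)))\<^sup>2) \<le> (norm X)\<^sup>2 * (\<Sum>n. (norm (v n))\<^sup>2)"
proof -
  have s: "summable (\<lambda>n. (norm (v n))\<^sup>2)" "summable (\<lambda>n. (norm (blinfun_apply X (v n)))\<^sup>2)"
    using assms square_summable_bounded_linear[OF blinfun.bounded_linear_right assms, of X]
    by (auto simp: square_summable_def)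
  have "(norm (blinfun_apply X (v n)))\<^sup>2 \<le> (norm X)\<^sup>2 * (norm (v n))\<^sup>2" for n
    using power_mono[OF norm_blinfun[of X "v n"], of 2] by (simp add: power_mult_distrib)
  then have "(\<Sum>n. (norm (blinfun_apply X (v n)))\<^sup>2) \<le> (\<Sum>n. (norm X)\<^sup>2 * (norm (v n))\<^sup>2)"
    by (rule suminf_le[OF _ s(2) summable_mult[OF s(1)]])
  then show ?thesis by (simp add: suminf_mult[OF s(1)])
qed

lemma square_summable_uminus: "square_summable f \<Longrightarrow> square_summable (\<lambda>n. - f n)"
  by (simp add: square_summable_def)

lemma square_summable_diff:
  "square_summable f \<Longrightarrow> square_summable g \<Longrightarrow> square_summable (\<lambda>n. f n - g n)"
  using square_summable_add[OF _ square_summable_uminus, of f g] by simp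

lemma square_summable_scaleR: "square_summable f \<Longrightarrow> square_summable (\<lambda>n. r *\<^sub>R f n)"
  by (rule square_summable_bounded_linear[OF bounded_linear_scaleR_right])

lemma summable_inner:
  assumes "square_summable f" "square_summable (g :: nat \<Rightarrow> 'a::real_inner)"
  shows "summable (\<lambda>n. inner (f n) (g n))"
proof (rule summable_comparison_test')
  show "summable (\<lambda>n. (norm (f n))\<^sup>2 + (norm (g n))\<^sup>2)"
    using assms by (intro summable_add) (auto simp: square_summable_def)
  show "norm (inner (f n) (g n)) \<le> (norm (f n))\<^sup>2 + (norm (g n))\<^sup>2" for n
  proof -
    have "\<bar>inner (f n) (g n)\<bar> \<le> norm (f n) * norm (g n)" by (rule Cauchy_Schwarz_ineq2)
    moreover have "2 * (norm (f n) * norm (g n)) \<le> (norm (f n))\<^sup>2 + (norm (g n))\<^sup>2"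
      using zero_le_power2[of "norm (f n) - norm (g n)"] by (simp add: power2_diff)
    moreover have "0 \<le> norm (f n) * norm (g n)" by simp
    ultimately show ?thesis unfolding real_norm_def by linarith
  qed
qed

section \<open>The Hilbert space of square-summable sequences\<close>

typedef (overloaded) ('a::real_normed_vector) l2seq = "{f :: nat \<Rightarrow> 'a. square_summable f}"
  morphisms coord Abs_l2seq
  by (rule exI[of _ "\<lambda>n. 0"]) simp

setup_lifting type_definition_l2seq

lemma square_summable_coord: "square_summable (coord f)"
  using coord by blast

text \<open>Only the real structure is built. Complex linearity of matrix entries is read off later
  from their commuting with scalar multiples of the identity.\<close>

instantiation l2seq :: (real_inner) real_inner
begin

lift_definition zero_l2seq :: "'a l2seq" is "\<lambda>n. 0" by simp
lift_definition plus_l2seq :: "'a l2seq \<Rightarrow> 'a l2seq \<Rightarrow> 'a l2seq" is "\<lambda>f g n. f n + g n"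
  by (rule square_summable_add)
lift_definition minus_l2seq :: "'a l2seq \<Rightarrow> 'a l2seq \<Rightarrow> 'a l2seq" is "\<lambda>f g n. f n - g n"
  by (rule square_summable_diff)
lift_definition uminus_l2seq :: "'a l2seq \<Rightarrow> 'a l2seq" is "\<lambda>f n. - f n"
  by (rule square_summable_uminus)
lift_definition scaleR_l2seq :: "real \<Rightarrow> 'a l2seq \<Rightarrow> 'a l2seq" is "\<lambda>r f n. r *\<^sub>R f n"
  by (rule square_summable_scaleR)
definition inner_l2seq :: "'a l2seq \<Rightarrow> 'a l2seq \<Rightarrow> real" where
  "inner_l2seq f g = (\<Sum>n. inner (coord f n) (coord g n))"
definition norm_l2seq :: "'a l2seq \<Rightarrow> real" where
  "norm_l2seq f = sqrt (inner f f)"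
definition dist_l2seq :: "'a l2seq \<Rightarrow> 'a l2seq \<Rightarrow> real" where
  "dist_l2seq f g = norm (f - g)"
definition sgn_l2seq :: "'a l2seq \<Rightarrow> 'a l2seq" where
  "sgn_l2seq f = inverse (norm f) *\<^sub>R f"
definition uniformity_l2seq :: "('a l2seq \<times> 'a l2seq) filter" where
  "uniformity_l2seq = (INF e\<in>{0<..}. principal {(x, y). dist x y < e})"
definition open_l2seq :: "'a l2seq set \<Rightarrow> bool" where
  "open_l2seq U \<longleftrightarrow> (\<forall>x\<in>U. eventually (\<lambda>(x', y). x' = x \<longrightarrow> y \<in> U) uniformity)"

instance
proof
  fix x y z :: "'a l2seq" and r s :: real
  note sum = summable_inner[OF square_summable_coord square_summable_coord]
  show "x + y + z = x + (y + z)" "x + y = y + x" "0 + x = x" "- x + x = 0" "x - y = x + - y"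
    "r *\<^sub>R (x + y) = r *\<^sub>R x + r *\<^sub>R y" "(r + s) *\<^sub>R x = r *\<^sub>R x + s *\<^sub>R x"
    "r *\<^sub>R s *\<^sub>R x = (r * s) *\<^sub>R x" "1 *\<^sub>R x = x"
    by (transfer; simp add: algebra_simps)+
  show "dist x y = norm (x - y)" by (rule dist_l2seq_def)
  show "sgn x = inverse (norm x) *\<^sub>R x" by (rule sgn_l2seq_def)
  show "uniformity = (INF e\<in>{0<..}. principal {(x, y). dist x (y :: 'a l2seq) < e})"
    by (rule uniformity_l2seq_def)
  show "open U \<longleftrightarrow> (\<forall>x\<in>U. eventually (\<lambda>(x', y). x' = x \<longrightarrow> y \<in> U) uniformity)" for U :: "'a l2seq set"
    by (rule open_l2seq_def)
  show "inner x y = inner y x" by (simp add: inner_l2seq_def inner_commute)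
  show "inner (x + y) z = inner x z + inner y z"
    by (simp add: inner_l2seq_def plus_l2seq.rep_eq inner_add_left suminf_add sum)
  show "inner (r *\<^sub>R x) y = r * inner x y"
    by (simp add: inner_l2seq_def scaleR_l2seq.rep_eq suminf_mult sum)
  show "0 \<le> inner x x" unfolding inner_l2seq_def by (rule suminf_nonneg[OF sum]) simp
  show "inner x x = 0 \<longleftrightarrow> x = 0"
    using suminf_eq_zero_iff[OF sum, of x x]
    by (auto simp: inner_l2seq_def zero_l2seq.rep_eq fun_eq_iff simp flip: coord_inject)
  show "norm x = sqrt (inner x x)" by (rule norm_l2seq_def)
qed

end

lemma norm_l2seq_square: "(norm f)\<^sup>2 = (\<Sum>n. (norm (coord f n))\<^sup>2)"
  by (simp add: power2_norm_eq_inner inner_l2seq_def)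

lemma norm_coord_le: "norm (coord f n) \<le> norm (f :: 'a::real_inner l2seq)"
proof -
  have "(\<Sum>i\<in>{n}. (norm (coord f i))\<^sup>2) \<le> (\<Sum>i. (norm (coord f i))\<^sup>2)"
    using square_summable_coord[of f] by (intro sum_le_suminf) (auto simp: square_summable_def)
  then have "(norm (coord f n))\<^sup>2 \<le> (norm f)\<^sup>2" by (simp add: norm_l2seq_square)
  then show ?thesis by (rule power2_le_imp_le) simp
qed

lemma bounded_linear_coord: "bounded_linear (\<lambda>f. coord f n :: 'a::real_inner)"
  by (rule bounded_linear_intro[where K = 1])
    (simp_all add: plus_l2seq.rep_eq scaleR_l2seq.rep_eq norm_coord_le)

lemma coord_sum: "coord (sum g I) n = (\<Sum>i\<in>I. coord (g i) n :: 'a::real_inner)"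
  by (rule bounded_linear.linear[OF bounded_linear_coord, THEN linear_sum])

instance l2seq :: ("{real_inner, complete_space}") complete_space
proof
  fix X :: "nat \<Rightarrow> 'a l2seq" assume X: "Cauchy X"
  have "Cauchy (\<lambda>k. coord (X k) n)" for n
    using bounded_linear.Cauchy[OF bounded_linear_coord X] .
  then have "\<exists>l. (\<lambda>k. coord (X k) n) \<longlonglongrightarrow> l" for n
    by (simp add: Cauchy_convergent_iff convergent_def)
  then obtain f where f: "\<And>n. (\<lambda>k. coord (X k) n) \<longlonglongrightarrow> f n" by metis
  \<comment> \<open>The norm of the difference is controlled through finite partial sums, in which
    the coordinatewise limit can be taken term by term.\<close>
  have close: "(\<Sum>n<m. (norm (coord (X k) n - f n))\<^sup>2) \<le> e\<^sup>2"
    if M: "\<And>l. l \<ge> M \<Longrightarrow> norm (X k - X l) < e" for k M m e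
  proof (rule LIMSEQ_le_const2)
    show "(\<lambda>l. \<Sum>n<m. (norm (coord (X k) n - coord (X l) n))\<^sup>2) \<longlonglongrightarrow> (\<Sum>n<m. (norm (coord (X k) n - f n))\<^sup>2)"
      by (intro tendsto_intros f)
    have "(\<Sum>n<m. (norm (coord (X k) n - coord (X l) n))\<^sup>2) \<le> e\<^sup>2" if "l \<ge> M" for l
    proof -
      have "(\<Sum>n<m. (norm (coord (X k - X l) n))\<^sup>2) \<le> (norm (X k - X l))\<^sup>2"
        unfolding norm_l2seq_square using square_summable_coord[of "X k - X l"]
        by (intro sum_le_suminf) (auto simp: square_summable_def)
      also have "\<dots> \<le> e\<^sup>2" using M[OF that] by (intro power_mono) auto
      finally show ?thesis by (simp add: minus_l2seq.rep_eq)
    qed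
    then show "\<exists>N. \<forall>l\<ge>N. (\<Sum>n<m. (norm (coord (X k) n - coord (X l) n))\<^sup>2) \<le> e\<^sup>2" by blast
  qed
  have ss: "square_summable (\<lambda>n. coord (X k) n - f n)"
    if M: "\<And>l. l \<ge> M \<Longrightarrow> norm (X k - X l) < e" for k M e
    unfolding square_summable_def
    by (rule bounded_imp_summable[where B = "e\<^sup>2"]) (use close[OF M, of _ "Suc _"] in \<open>auto simp: lessThan_Suc_atMost\<close>)
  obtain M1 where M1: "\<And>k l. k \<ge> M1 \<Longrightarrow> l \<ge> M1 \<Longrightarrow> norm (X k - X l) < 1"
    using CauchyD[OF X, of 1] by auto
  \<comment> \<open>\<open>f\<close> is not yet known to be square-summable: it is written as the
    difference of two sequences that are.\<close>
  have "square_summable (\<lambda>n. coord (X M1) n - (coord (X M1) n - f n))"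
    by (intro square_summable_diff square_summable_coord ss[of M1]) (use M1 in auto)
  then have "square_summable f" by simp
  then have F: "coord (Abs_l2seq f) = f" by (simp add: Abs_l2seq_inverse)
  have "X \<longlonglongrightarrow> Abs_l2seq f"
  proof (rule LIMSEQ_I)
    fix r :: real assume r: "0 < r"
    obtain M where M: "\<And>k l. k \<ge> M \<Longrightarrow> l \<ge> M \<Longrightarrow> norm (X k - X l) < r / 2"
      using CauchyD[OF X, of "r / 2"] r by auto
    have "norm (X k - Abs_l2seq f) < r" if k: "k \<ge> M" for k
    proof -
      have *: "\<And>l. l \<ge> M \<Longrightarrow> norm (X k - X l) < r / 2" using M k by blast
      have "(norm (X k - Abs_l2seq f))\<^sup>2 = (\<Sum>n. (norm (coord (X k) n - f n))\<^sup>2)"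
        by (simp add: norm_l2seq_square minus_l2seq.rep_eq F)
      also have "\<dots> \<le> (r / 2)\<^sup>2"
        using ss[OF *] close[OF *] by (intro suminf_le_const) (auto simp: square_summable_def)
      finally have "norm (X k - Abs_l2seq f) \<le> r / 2" by (rule power2_le_imp_le) (use r in simp)
      then show ?thesis using r by simp
    qed
    then show "\<exists>no. \<forall>k\<ge>no. norm (X k - Abs_l2seq f) < r" by blast
  qed
  then show "convergent X" by (auto simp: convergent_def)
qed

lift_definition single :: "nat \<Rightarrow> 'a::real_inner \<Rightarrow> 'a l2seq" is "\<lambda>m v n. if n = m then v else 0"
proof -
  fix m and v :: 'a
  show "square_summable (\<lambda>n. if n = m then v else 0)"
    unfolding square_summable_def by (rule summable_finite[of "{m}"]) auto
qed

lift_definition amplification :: "('a::real_inner \<Rightarrow>\<^sub>L 'a) \<Rightarrow> 'a l2seq \<Rightarrow> 'a l2seq" is "\<lambda>X f n. blinfun_apply X (f n)"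
  by (rule square_summable_bounded_linear) (rule blinfun.bounded_linear_right)

lemma bounded_linear_single: "bounded_linear (single m)"
proof (rule bounded_linear_intro[where K = 1])
  show "norm (single m v) \<le> norm v * 1" for v :: 'a
  proof -
    have "(norm (single m v))\<^sup>2 = (\<Sum>n\<in>{m}. (norm (coord (single m v) n))\<^sup>2)"
      unfolding norm_l2seq_square by (rule suminf_finite) (auto simp: single.rep_eq)
    then show ?thesis by (simp add: single.rep_eq)
  qed
qed (transfer; auto)+

lemma bounded_linear_amplification: "bounded_linear (amplification X)"
proof (rule bounded_linear_intro[where K = "norm X"])
  show "norm (amplification X f) \<le> norm f * norm X" for f
  proof (rule power2_le_imp_le)
    show "(norm (amplification X f))\<^sup>2 \<le> (norm f * norm X)\<^sup>2"
      using suminf_square_blinfun_le[OF square_summable_coord, of X f]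
      by (simp add: norm_l2seq_square amplification.rep_eq power_mult_distrib mult.commute)
  qed simp
qed (transfer; simp add: blinfun.add_right blinfun.scaleR_right)+

text \<open>A bounded operator on sequences is thereby determined by its matrix entries, which is
  how the projection is handled in the density theorem.\<close>

lemma truncation_tendsto:
  fixes f :: "'a::real_inner l2seq"
  shows "(\<lambda>N. \<Sum>m<N. single m (coord f m)) \<longlonglongrightarrow> f"
proof -
  define t where "t = (\<lambda>N. \<Sum>m<N. single m (coord f m))"
  have co: "coord (t N) n = (if n < N then coord f n else 0)" for N n
    by (simp add: t_def coord_sum single.rep_eq if_distrib sum.delta cong: if_cong)
  have s: "summable (\<lambda>n. (norm (coord f n))\<^sup>2)"
    using square_summable_coord by (auto simp: square_summable_def)
  have "(norm (f - t N))\<^sup>2 = (norm f)\<^sup>2 - (\<Sum>n<N. (norm (coord f n))\<^sup>2)" for N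
  proof -
    have sd: "summable (\<lambda>n. (norm (coord (f - t N) n))\<^sup>2)"
      using square_summable_coord by (auto simp: square_summable_def)
    have "(norm (f - t N))\<^sup>2 = (\<Sum>n. (norm (coord f (n + N)))\<^sup>2)"
      unfolding norm_l2seq_square using suminf_split_initial_segment[OF sd, of N]
      by (simp add: minus_l2seq.rep_eq co)
    then show ?thesis unfolding norm_l2seq_square
      using suminf_split_initial_segment[OF s, of N] by simp
  qed
  moreover have "(\<lambda>N. (norm f)\<^sup>2 - (\<Sum>n<N. (norm (coord f n))\<^sup>2)) \<longlonglongrightarrow> (norm f)\<^sup>2 - (norm f)\<^sup>2"
    unfolding norm_l2seq_square by (intro tendsto_intros summable_LIMSEQ s)
  ultimately have "(\<lambda>N. (norm (f - t N))\<^sup>2) \<longlonglongrightarrow> 0" by simp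
  then have "(\<lambda>N. sqrt ((norm (f - t N))\<^sup>2)) \<longlonglongrightarrow> sqrt 0" by (rule tendsto_real_sqrt)
  then have "(\<lambda>N. norm (t N - f)) \<longlonglongrightarrow> 0" by (simp add: norm_minus_commute)
  then show ?thesis unfolding t_def[symmetric] by (simp add: tendsto_norm_zero_iff LIM_zero_iff)
qed

section \<open>Von Neumann's density theorem\<close>

locale star_algebra =
  fixes M :: "('h::complex_hilbert_space \<Rightarrow>\<^sub>L 'h) set"
  assumes unital_star_algebra: "unital_star_algebra M"
begin

lemma lin: "X \<in> M \<Longrightarrow> complex_linear X"
  and id_mem [simp]: "id_blinfun \<in> M"
  and add_mem: "X \<in> M \<Longrightarrow> Y \<in> M \<Longrightarrow> X + Y \<in> M"
  and compose_mem: "X \<in> M \<Longrightarrow> Y \<in> M \<Longrightarrow> X o\<^sub>L Y \<in> M"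
  and scale_mem: "X \<in> M \<Longrightarrow> scale_op c X \<in> M"
  and adj_mem: "X \<in> M \<Longrightarrow> adj X \<in> M"
  using unital_star_algebra by (auto simp: unital_star_algebra_def)

lemma zero_mem [simp]: "0 \<in> M"
  using scale_mem[OF id_mem, of 0] by simp

lemma uminus_mem: "X \<in> M \<Longrightarrow> - X \<in> M"
  using scale_mem[of X "-1"] by (simp add: scale_op_minus1)

lemma diff_mem: "X \<in> M \<Longrightarrow> Y \<in> M \<Longrightarrow> X - Y \<in> M"
  using add_mem[OF _ uminus_mem, of X Y] by simp

lemma scaleR_mem: "X \<in> M \<Longrightarrow> r *\<^sub>R X \<in> M"
  using scale_mem[of X "of_real r"] by (simp add: scale_op_of_real)

lemma sum_mem: "(\<And>i. i \<in> I \<Longrightarrow> f i \<in> M) \<Longrightarrow> sum f I \<in> M"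
  by (induction I rule: infinite_finite_induct) (auto intro: add_mem)

lemma op_prod_mem: "set Xs \<subseteq> M \<Longrightarrow> op_prod Xs \<in> M"
  by (induction Xs) (auto intro: compose_mem)

end

lemma unital_star_algebra_commutant:
  assumes lin: "\<And>X. X \<in> M \<Longrightarrow> complex_linear X" and adj: "\<And>X. X \<in> M \<Longrightarrow> adj X \<in> M"
  shows "unital_star_algebra (commutant M)"
proof -
  have "adj X o\<^sub>L Y = Y o\<^sub>L adj X" if X: "complex_linear X" "\<forall>Y\<in>M. X o\<^sub>L Y = Y o\<^sub>L X" and Y: "Y \<in> M" for X Y
  proof -
    have "adj (X o\<^sub>L adj Y) = adj (adj Y o\<^sub>L X)" using X adj[OF Y] by auto
    then show ?thesis using X(1) lin[OF Y] by (simp add: adj_compose adj_adj complex_linear_adj)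
  qed
  moreover have "(X o\<^sub>L X') o\<^sub>L Y = Y o\<^sub>L (X o\<^sub>L X')"
    if "\<forall>Y\<in>M. X o\<^sub>L Y = Y o\<^sub>L X" "\<forall>Y\<in>M. X' o\<^sub>L Y = Y o\<^sub>L X'" "Y \<in> M" for X X' Y
    using that by (metis compose_assoc)
  ultimately show ?thesis
    unfolding unital_star_algebra_def commutant_def
    using lin by (auto simp: complex_linear_add complex_linear_compose complex_linear_adj
        compose_add_left compose_add_right compose_scale_left compose_scale_right)
qed

lemma commutant_antimono: "M \<subseteq> N \<Longrightarrow> commutant N \<subseteq> commutant M"
  by (auto simp: commutant_def)

lemma (in star_algebra) subset_bicommutant: "M \<subseteq> commutant (commutant M)"
  using lin by (auto simp: commutant_def)

text \<open>The triple commutant is the commutant, because taking commutants reverses inclusions.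
  The lemma places the generated von Neumann algebra inside the bicommutant.\<close>

lemma (in star_algebra) von_neumann_algebra_bicommutant: "von_neumann_algebra (commutant (commutant M))"
proof -
  interpret C: star_algebra "commutant M"
    by unfold_locales (rule unital_star_algebra_commutant[OF lin adj_mem])
  interpret CC: star_algebra "commutant (commutant M)"
    by unfold_locales (rule unital_star_algebra_commutant[OF C.lin C.adj_mem])
  have "commutant (commutant (commutant M)) = commutant M"
    using commutant_antimono[OF subset_bicommutant] C.subset_bicommutant by blast
  then show ?thesis by (simp add: von_neumann_algebra_def CC.unital_star_algebra)
qed

text \<open>A basic neighbourhood of \<open>X\<close> in the ultrastrong topology. A single sequence
  is enough, since two can be interleaved.\<close>

definition ultrastrong_ball ::
    "(nat \<Rightarrow> 'h) \<Rightarrow> real \<Rightarrow> ('h::complex_hilbert_space \<Rightarrow>\<^sub>L 'h) \<Rightarrow> ('h \<Rightarrow>\<^sub>L 'h) set" where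
  "ultrastrong_ball \<xi> \<delta> X = {Y. (\<Sum>n. (norm (blinfun_apply (Y - X) (\<xi> n)))\<^sup>2) < \<delta>}"

lemma closure_subspace_subspace:
  assumes "subspace (S :: 'a::real_normed_vector set)"
  shows "subspace (closure S)"
  unfolding subspace_def
proof (intro conjI ballI allI)
  show "0 \<in> closure S" using subspace_0[OF assms] closure_subset by blast
  fix x assume "x \<in> closure S"
  then obtain f where f: "\<And>n. f n \<in> S" "f \<longlonglongrightarrow> x" by (auto simp: closure_sequential)
  show "c *\<^sub>R x \<in> closure S" for c
    unfolding closure_sequential
    by (rule exI[of _ "\<lambda>n. c *\<^sub>R f n"]) (auto intro!: tendsto_intros f subspace_scale[OF assms])
  fix y assume "y \<in> closure S"
  then obtain g where g: "\<And>n. g n \<in> S" "g \<longlonglongrightarrow> y" by (auto simp: closure_sequential)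
  show "x + y \<in> closure S"
    unfolding closure_sequential
    by (rule exI[of _ "\<lambda>n. f n + g n"]) (auto intro!: tendsto_intros f g subspace_add[OF assms])
qed

lemma bounded_linear_image_closure_subset:
  assumes "bounded_linear h" "h ` S \<subseteq> S"
  shows "h ` closure S \<subseteq> closure S"
proof -
  have "continuous_on (closure S) h" by (rule linear_continuous_on[OF assms(1)])
  then have "h ` closure S \<subseteq> closure (h ` S)" by (rule image_closure_subset) (auto simp: closure_subset)
  also have "\<dots> \<subseteq> closure S" using assms(2) by (rule closure_mono)
  finally show ?thesis .
qed

text \<open>The orthogonal projection of \<open>\<ell>\<^sup>2(H)\<close> onto the closure of \<open>M \<xi>\<close> commutes with the
  amplification of \<open>M\<close>, so its matrix entries lie in the commutant of \<open>M\<close> and commute with \<open>X\<close>.\<close>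

lemma (in star_algebra) von_neumann_density:
  assumes X: "X \<in> commutant (commutant M)" and \<xi>: "square_summable \<xi>" and \<delta>: "0 < \<delta>"
  shows "M \<inter> ultrastrong_ball \<xi> \<delta> X \<noteq> {}"
proof -
  define x where "x = Abs_l2seq \<xi>"
  have cx: "coord x = \<xi>" by (simp add: x_def Abs_l2seq_inverse \<xi>)
  define K0 where "K0 = (\<lambda>Y. amplification Y x) ` M"
  define K where "K = closure K0"
  have amp_add: "amplification (Y + Z) v = amplification Y v + amplification Z v" for Y Z and v :: "'h l2seq"
    by transfer (simp add: blinfun.add_left)
  have amp_scale: "amplification (r *\<^sub>R Y) v = r *\<^sub>R amplification Y v" for Y r and v :: "'h l2seq"
    by transfer (simp add: blinfun.scaleR_left)
  have amp_zero: "amplification 0 v = 0" for v :: "'h l2seq"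
    by transfer simp
  have amp_comp: "amplification (Y o\<^sub>L Z) v = amplification Y (amplification Z v)" for Y Z and v :: "'h l2seq"
    by transfer simp
  have amp_id: "amplification id_blinfun v = v" for v :: "'h l2seq"
    by transfer simp
  define g where "g = (\<lambda>Y. amplification Y x)"
  have K0: "K0 = g ` M" by (simp add: K0_def g_def)
  have "subspace K0"
    unfolding subspace_def K0
  proof (intro conjI ballI allI)
    have "g 0 = 0" by (simp add: g_def amp_zero)
    then show "0 \<in> g ` M" using zero_mem by (metis image_eqI)
    show "u + v \<in> g ` M" if u: "u \<in> g ` M" and v: "v \<in> g ` M" for u v
    proof -
      obtain Y Z where "u = g Y" "v = g Z" and YZ: "Y \<in> M" "Z \<in> M" using u v by blast
      then have "u + v = g (Y + Z)" by (simp add: g_def amp_add)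
      then show ?thesis using add_mem[OF YZ] by blast
    qed
    show "c *\<^sub>R u \<in> g ` M" if u: "u \<in> g ` M" for c u
    proof -
      obtain Y where "u = g Y" and Y: "Y \<in> M" using u by blast
      then have "c *\<^sub>R u = g (c *\<^sub>R Y)" by (simp add: g_def amp_scale)
      then show ?thesis using scaleR_mem[OF Y] by blast
    qed
  qed
  then have subK: "subspace K" unfolding K_def by (rule closure_subspace_subspace)
  have "\<exists>y\<in>K. \<forall>z\<in>K. inner (v - y) z = 0" for v
    by (rule closed_subspace_orthogonal_projection[OF _ subK, of v]) (auto simp: K_def)
  then obtain p where pK: "\<And>v. p v \<in> K" and orth: "\<And>v z. z \<in> K \<Longrightarrow> inner (v - p v) z = 0" by metis
  \<comment> \<open>Uniqueness of the projection: additivity, homogeneity and commutation with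
    \<open>M\<close> all reduce to checking a candidate.\<close>
  have p_eqI: "p v = y" if y: "y \<in> K" "\<And>z. z \<in> K \<Longrightarrow> inner (v - y) z = 0" for v y
  proof -
    have m: "p v - y \<in> K" using subK pK y(1) by (rule subspace_diff)
    have "inner (p v - y) (p v - y) = inner (v - y) (p v - y) - inner (v - p v) (p v - y)"
      by (simp add: inner_diff_left)
    then show ?thesis using y(2)[OF m] orth[OF m, of v] by simp
  qed
  have p_add: "p (u + v) = p u + p v" for u v
  proof (rule p_eqI)
    show "p u + p v \<in> K" using subK pK by (simp add: subspace_add)
    show "inner (u + v - (p u + p v)) z = 0" if "z \<in> K" for z
      using orth[OF that, of u] orth[OF that, of v] by (simp add: inner_diff_left inner_add_left)
  qed
  have p_scale: "p (r *\<^sub>R u) = r *\<^sub>R p u" for r u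
  proof (rule p_eqI)
    show "r *\<^sub>R p u \<in> K" using subK pK by (simp add: subspace_scale)
    show "inner (r *\<^sub>R u - r *\<^sub>R p u) z = 0" if "z \<in> K" for z
      using orth[OF that, of u] by (simp flip: scaleR_diff_right)
  qed
  have "norm (p v) \<le> norm v * 1" for v
  proof -
    have "norm (p v) * norm (p v) = inner v (p v)"
      using orth[OF pK, of v v] power2_norm_eq_inner[of "p v"]
      by (simp add: inner_diff_left power2_eq_square)
    also have "\<dots> \<le> norm v * norm (p v)" by (rule norm_cauchy_schwarz)
    finally show ?thesis by (cases "p v = 0") auto
  qed
  then have bl_p: "bounded_linear p" by (intro bounded_linear_intro[where K = 1] p_add p_scale) auto
  have inner_amp: "inner (amplification Y u) v = inner u (amplification (adj Y) v)" if "Y \<in> M" for Y u v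
    unfolding inner_l2seq_def amplification.rep_eq
    by (simp add: inner_eq_Re_cinner cinner_adj_right lin that)
  have amp_K: "amplification Y v \<in> K" if "Y \<in> M" "v \<in> K" for Y v
  proof -
    have "amplification Y ` K0 \<subseteq> K0"
      using that(1) by (auto simp: K0_def compose_mem simp flip: amp_comp)
    then show ?thesis
      using bounded_linear_image_closure_subset[OF bounded_linear_amplification, of Y K0] that(2)
      by (auto simp: K_def)
  qed
  \<comment> \<open>\<open>K\<close> is invariant under \<open>M\<close>; as \<open>M\<close>
    contains adjoints, so is the orthogonal complement of \<open>K\<close>.\<close>
  have p_amp: "p (amplification Y v) = amplification Y (p v)" if Y: "Y \<in> M" for Y v
  proof (rule p_eqI)
    show "amplification Y (p v) \<in> K" using Y pK by (rule amp_K)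
    fix z assume "z \<in> K"
    then have "inner (v - p v) (amplification (adj Y) z) = 0" by (intro orth amp_K adj_mem Y)
    then have "inner (amplification Y (v - p v)) z = 0" by (simp add: inner_amp Y)
    then show "inner (amplification Y v - amplification Y (p v)) z = 0"
      by (simp add: linear_diff[OF bounded_linear.linear[OF bounded_linear_amplification]])
  qed
  define E where "E = (\<lambda>n m. Blinfun (\<lambda>v. coord (p (single m v)) n))"
  have E: "blinfun_apply (E n m) = (\<lambda>v. coord (p (single m v)) n)" for n m
    unfolding E_def
    by (rule bounded_linear_Blinfun_apply)
      (intro bounded_linear_compose[OF bounded_linear_coord] bounded_linear_compose[OF bl_p] bounded_linear_single)
  have amp_single: "amplification Y (single m v) = single m (blinfun_apply Y v)" for Y m v
    by (simp add: fun_eq_iff amplification.rep_eq single.rep_eq flip: coord_inject)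
  have E_comm: "blinfun_apply (E n m) (blinfun_apply Y v) = blinfun_apply Y (E n m v)" if "Y \<in> M" for Y n m v
    by (simp add: E p_amp[OF that] amplification.rep_eq flip: amp_single)
  have E_comm': "E n m \<in> commutant M" for n m
  proof -
    \<comment> \<open>Complex linearity is commutation with the scalar multiples of the identity,
      which lie in \<open>M\<close>.\<close>
    have "complex_linear (E n m)"
      unfolding complex_linear_def using E_comm[of "scale_op _ id_blinfun" n m] by (simp add: scale_mem)
    then show ?thesis by (auto simp: commutant_def intro!: blinfun_eqI E_comm)
  qed
  have X_E: "blinfun_apply X (E n m v) = E n m (X v)" for n m v
  proof -
    have "X o\<^sub>L E n m = E n m o\<^sub>L X" using X E_comm'[of n m] by (auto simp: commutant_def)
    then show ?thesis by (metis blinfun_apply_blinfun_compose)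
  qed
  have lim: "(\<lambda>N. \<Sum>m<N. E n m (coord f m)) \<longlonglongrightarrow> coord (p f) n" for n f
  proof -
    have "(\<lambda>N. coord (p (\<Sum>m<N. single m (coord f m))) n) \<longlonglongrightarrow> coord (p f) n"
      by (intro bounded_linear.tendsto[OF bounded_linear_coord] bounded_linear.tendsto[OF bl_p] truncation_tendsto)
    then show ?thesis
      by (simp add: E linear_sum[OF bounded_linear.linear[OF bl_p]] coord_sum)
  qed
  have "x \<in> K0" unfolding K0_def by (rule image_eqI[of _ _ id_blinfun]) (auto simp: amp_id)
  then have xK: "x \<in> K" unfolding K_def using closure_subset by blast
  have px: "p x = x" by (rule p_eqI) (auto simp: xK)
  \<comment> \<open>\<open>x\<close> lies in \<open>K\<close> because \<open>id_blinfun\<close> is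
    in \<open>M\<close>, so \<open>p\<close> fixes \<open>x\<close>. As \<open>X\<close> passes
    through the matrix entries of \<open>p\<close>, the amplification of \<open>X\<close> maps
    \<open>x\<close> to a vector that \<open>p\<close> fixes as well, that is, into
    \<open>K\<close>.\<close>
  have "coord (p (amplification X x)) n = coord (amplification X x) n" for n
  proof (rule LIMSEQ_unique)
    show "(\<lambda>N. \<Sum>m<N. E n m (coord (amplification X x) m)) \<longlonglongrightarrow> coord (p (amplification X x)) n"
      by (rule lim)
    have "(\<lambda>N. blinfun_apply X (\<Sum>m<N. E n m (coord x m))) \<longlonglongrightarrow> X (coord (p x) n)"
      by (intro tendsto_intros lim)
    then show "(\<lambda>N. \<Sum>m<N. E n m (coord (amplification X x) m)) \<longlonglongrightarrow> coord (amplification X x) n"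
      by (simp add: blinfun.sum_right X_E amplification.rep_eq px)
  qed
  then have "p (amplification X x) = amplification X x"
    by (simp add: fun_eq_iff flip: coord_inject)
  then have "amplification X x \<in> closure K0" using pK[of "amplification X x"] by (simp add: K_def)
  then obtain k where "k \<in> K0" and k: "dist k (amplification X x) < sqrt \<delta>"
    unfolding closure_approachable using \<delta> by (meson real_sqrt_gt_zero)
  then obtain Y where Y: "Y \<in> M" and "k = amplification Y x" by (auto simp: K0_def)
  then have "(norm (amplification Y x - amplification X x))\<^sup>2 < (sqrt \<delta>)\<^sup>2"
    using k by (intro power_strict_mono) (auto simp: dist_norm)
  then have "(\<Sum>n. (norm (blinfun_apply (Y - X) (\<xi> n)))\<^sup>2) < \<delta>"
    using \<delta> by (simp add: norm_l2seq_square minus_l2seq.rep_eq amplification.rep_eq cx blinfun.diff_left)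
  with Y show ?thesis by (auto simp: ultrastrong_ball_def)
qed

section \<open>Normal functionals\<close>

text \<open>Merges two sequences of vectors into one, so that the intersection of two ultrastrong
  balls contains a third.\<close>

definition interleave :: "(nat \<Rightarrow> 'a) \<Rightarrow> (nat \<Rightarrow> 'a) \<Rightarrow> nat \<Rightarrow> 'a" where
  "interleave f g n = (if even n then f (n div 2) else g (n div 2))"

lemma interleave_sums:
  fixes f g :: "nat \<Rightarrow> real"
  assumes "f sums a" "g sums b"
  shows "interleave f g sums (a + b)"
proof -
  have "(\<lambda>n. if even n then 0 else g ((n - 1) div 2)) sums b"
    by (rule sums_if'[OF assms(2)])
  moreover have "(\<lambda>n. if even n then f (n div 2) else 0) sums a"
  proof -
    have "(\<lambda>n. (\<lambda>n. if even n then 0 else f ((n - 1) div 2)) (Suc n)) sums a"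
      using sums_if'[OF assms(1)] by (subst sums_Suc_iff) simp
    then show ?thesis by (rule sums_cong[THEN iffD1, rotated]) auto
  qed
  ultimately have "(\<lambda>n. (if even n then f (n div 2) else 0) + (if even n then 0 else g ((n - 1) div 2))) sums (a + b)"
    by (rule sums_add[rotated])
  also have "(\<lambda>n. (if even n then f (n div 2) else 0) + (if even n then 0 else g ((n - 1) div 2))) = interleave f g"
    by (auto simp: interleave_def fun_eq_iff elim!: oddE)
  finally show ?thesis .
qed

lemma sum_cinner_bound:
  fixes u v :: "nat \<Rightarrow> 'h::complex_hilbert_space"
  assumes "square_summable u" "square_summable v"
  shows "summable (\<lambda>n. cinner (u n) (v n))"
    and "(cmod (\<Sum>n. cinner (u n) (v n)))\<^sup>2 \<le> (\<Sum>n. (norm (u n))\<^sup>2) * (\<Sum>n. (norm (v n))\<^sup>2)"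
proof -
  have su: "summable (\<lambda>n. (norm (u n))\<^sup>2)" and sv: "summable (\<lambda>n. (norm (v n))\<^sup>2)"
    using assms by (auto simp: square_summable_def)
  have partial: "(\<Sum>n<N. norm (cinner (u n) (v n))) \<le>
      sqrt ((\<Sum>n. (norm (u n))\<^sup>2) * (\<Sum>n. (norm (v n))\<^sup>2))" for N
  proof -
    have "(\<Sum>n<N. norm (cinner (u n) (v n))) \<le> (\<Sum>n<N. norm (u n) * norm (v n))"
      by (intro sum_mono norm_cinner_le)
    also have "\<dots> \<le> sqrt ((\<Sum>n<N. (norm (u n))\<^sup>2) * (\<Sum>n<N. (norm (v n))\<^sup>2))"
      by (intro real_le_rsqrt Cauchy_Schwarz_ineq_sum)
    also have "\<dots> \<le> sqrt ((\<Sum>n. (norm (u n))\<^sup>2) * (\<Sum>n. (norm (v n))\<^sup>2))"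
      using su sv by (intro real_sqrt_le_mono mult_mono sum_le_suminf sum_nonneg suminf_nonneg) auto
    finally show ?thesis .
  qed
  have sn: "summable (\<lambda>n. norm (cinner (u n) (v n)))"
    by (rule bounded_imp_summable[OF _ partial[of "Suc _", unfolded lessThan_Suc_atMost]]) simp
  then show "summable (\<lambda>n. cinner (u n) (v n))" by (rule summable_norm_cancel)
  have "cmod (\<Sum>n. cinner (u n) (v n)) \<le> (\<Sum>n. norm (cinner (u n) (v n)))"
    by (rule summable_norm[OF sn])
  also have "\<dots> \<le> sqrt ((\<Sum>n. (norm (u n))\<^sup>2) * (\<Sum>n. (norm (v n))\<^sup>2))"
    by (rule suminf_le_const[OF sn partial])
  finally have "(cmod (\<Sum>n. cinner (u n) (v n)))\<^sup>2 \<le> (sqrt ((\<Sum>n. (norm (u n))\<^sup>2) * (\<Sum>n. (norm (v n))\<^sup>2)))\<^sup>2"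
    by (rule power_mono) simp
  also have "\<dots> = (\<Sum>n. (norm (u n))\<^sup>2) * (\<Sum>n. (norm (v n))\<^sup>2)"
    using su sv by (intro real_sqrt_pow2 mult_nonneg_nonneg suminf_nonneg) auto
  finally show "(cmod (\<Sum>n. cinner (u n) (v n)))\<^sup>2 \<le> (\<Sum>n. (norm (u n))\<^sup>2) * (\<Sum>n. (norm (v n))\<^sup>2)" .
qed

text \<open>The sigma-weak topology is coarser than the ultrastrong one. Subbasic sets are treated
  by Cauchy-Schwarz, intersections by interleaving.\<close>

lemma sigma_weak_open_ultrastrong:
  fixes U :: "('h::complex_hilbert_space \<Rightarrow>\<^sub>L 'h) set"
  assumes "openin sigma_weak_topology U" and "X \<in> U"
  shows "\<exists>\<xi> \<delta>. square_summable \<xi> \<and> 0 < \<delta> \<and> ultrastrong_ball \<xi> \<delta> X \<subseteq> U"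
proof -
  define G :: "('h \<Rightarrow>\<^sub>L 'h) set set" where "G = {{X. (\<Sum>n. cinner (blinfun_apply X (\<xi> n)) (\<eta> n)) \<in> U} | \<xi> \<eta> U.
        summable (\<lambda>n::nat. (norm (\<xi> n))\<^sup>2) \<and> summable (\<lambda>n. (norm (\<eta> n))\<^sup>2) \<and> open U}"
  have app: "square_summable (\<lambda>n. blinfun_apply Z (\<xi> n))" if "square_summable \<xi>"
    for Z :: "'h \<Rightarrow>\<^sub>L 'h" and \<xi>
    by (rule square_summable_bounded_linear[OF blinfun.bounded_linear_right that])
  have "generate_topology_on G U"
    using assms(1) by (simp add: sigma_weak_topology_def G_def openin_topology_generated_by_iff)
  then have "\<forall>X\<in>U. \<exists>\<xi> \<delta>. square_summable \<xi> \<and> 0 < \<delta> \<and> ultrastrong_ball \<xi> \<delta> X \<subseteq> U"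
  proof induction
    case Empty
    then show ?case by simp
  next
    case (Int a b)
    show ?case
    proof
      fix X assume "X \<in> a \<inter> b"
      then have X: "X \<in> a" "X \<in> b" by auto
      obtain f d where f: "square_summable f" "0 < d" "ultrastrong_ball f d X \<subseteq> a"
        using Int.IH(1) X(1) by blast
      obtain g e where g: "square_summable g" "0 < e" "ultrastrong_ball g e X \<subseteq> b"
        using Int.IH(2) X(2) by blast
      define h where "h = interleave f g"
      have il: "(\<lambda>n. (norm (Z (h n)))\<^sup>2) = interleave (\<lambda>n. (norm (Z (f n)))\<^sup>2) (\<lambda>n. (norm (Z (g n)))\<^sup>2)" for Z :: "'h \<Rightarrow> 'h"
        by (auto simp: h_def interleave_def)
      have "(\<lambda>n. (norm (h n))\<^sup>2) sums ((\<Sum>n. (norm (f n))\<^sup>2) + (\<Sum>n. (norm (g n))\<^sup>2))"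
        using il[of "\<lambda>v. v"] f(1) g(1)
        by (auto simp: square_summable_def intro!: interleave_sums summable_sums)
      then have h: "square_summable h" by (auto simp: square_summable_def sums_iff)
      have "Y \<in> a \<inter> b" if Y: "(\<Sum>n. (norm (blinfun_apply (Y - X) (h n)))\<^sup>2) < min d e" for Y
      proof -
        let ?Z = "blinfun_apply (Y - X)"
        have s: "summable (\<lambda>n. (norm (?Z (f n)))\<^sup>2)" "summable (\<lambda>n. (norm (?Z (g n)))\<^sup>2)"
          using app[OF f(1)] app[OF g(1)] by (auto simp: square_summable_def)
        have "(\<lambda>n. (norm (?Z (h n)))\<^sup>2) sums ((\<Sum>n. (norm (?Z (f n)))\<^sup>2) + (\<Sum>n. (norm (?Z (g n)))\<^sup>2))"
          unfolding il using s by (intro interleave_sums summable_sums)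
        then have "(\<Sum>n. (norm (?Z (f n)))\<^sup>2) + (\<Sum>n. (norm (?Z (g n)))\<^sup>2) < min d e"
          using Y by (simp add: sums_iff)
        moreover have "0 \<le> (\<Sum>n. (norm (?Z (f n)))\<^sup>2)" "0 \<le> (\<Sum>n. (norm (?Z (g n)))\<^sup>2)"
          using s by (auto intro!: suminf_nonneg)
        ultimately have "Y \<in> ultrastrong_ball f d X" "Y \<in> ultrastrong_ball g e X"
          by (auto simp: ultrastrong_ball_def)
        then show ?thesis using f(3) g(3) by blast
      qed
      then show "\<exists>\<xi> \<delta>. square_summable \<xi> \<and> 0 < \<delta> \<and> ultrastrong_ball \<xi> \<delta> X \<subseteq> a \<inter> b"
        using h f(2) g(2) by (intro exI[of _ h] exI[of _ "min d e"]) (auto simp: ultrastrong_ball_def)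
    qed
  next
    case (UN K)
    then show ?case by (meson Sup_upper UnionE subset_trans)
  next
    case (Basis s)
    then obtain \<xi> \<eta> V where s: "s = {X. (\<Sum>n. cinner (blinfun_apply X (\<xi> n)) (\<eta> n)) \<in> V}"
      and \<xi>: "square_summable \<xi>" and \<eta>: "square_summable \<eta>" and V: "open V"
      by (auto simp: G_def square_summable_def)
    show ?case
    proof
      fix X assume "X \<in> s"
      then obtain e where e: "0 < e"
        and ball: "\<And>z. dist z (\<Sum>n. cinner (blinfun_apply X (\<xi> n)) (\<eta> n)) < e \<Longrightarrow> z \<in> V"
        using V by (auto simp: s open_dist)
      \<comment> \<open>The added 1 keeps \<open>N\<close> positive when \<open>\<eta>\<close>
        vanishes.\<close>
      define N where "N = (\<Sum>n. (norm (\<eta> n))\<^sup>2) + 1"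
      have N: "0 < N" "(\<Sum>n. (norm (\<eta> n))\<^sup>2) \<le> N"
        using \<eta> suminf_nonneg[of "\<lambda>n. (norm (\<eta> n))\<^sup>2"] by (auto simp: N_def square_summable_def)
      have "Y \<in> s" if Y: "(\<Sum>n. (norm (blinfun_apply (Y - X) (\<xi> n)))\<^sup>2) < e\<^sup>2 / N" for Y
      proof -
        let ?S = "\<lambda>Z. \<Sum>n. cinner (blinfun_apply Z (\<xi> n)) (\<eta> n)"
        have "?S Y - ?S X = ?S (Y - X)"
          using suminf_diff[OF sum_cinner_bound(1)[OF app[OF \<xi>] \<eta>] sum_cinner_bound(1)[OF app[OF \<xi>] \<eta>], of Y X]
          by (simp add: blinfun.diff_left cinner_diff_left)
        then have "(dist (?S Y) (?S X))\<^sup>2 \<le> (\<Sum>n. (norm (blinfun_apply (Y - X) (\<xi> n)))\<^sup>2) * (\<Sum>n. (norm (\<eta> n))\<^sup>2)"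
          using sum_cinner_bound(2)[OF app[OF \<xi>] \<eta>, of "Y - X"] by (simp add: dist_norm)
        also have "\<dots> \<le> (\<Sum>n. (norm (blinfun_apply (Y - X) (\<xi> n)))\<^sup>2) * N"
          using app[OF \<xi>, of "Y - X"] N
          by (intro mult_left_mono suminf_nonneg) (auto simp: square_summable_def)
        also have "\<dots> < e\<^sup>2" using Y N by (simp add: field_simps)
        finally have "dist (?S Y) (?S X) < e" using e by (simp add: power2_less_imp_less)
        then show ?thesis using ball by (simp add: s)
      qed
      then show "\<exists>\<xi> \<delta>. square_summable \<xi> \<and> 0 < \<delta> \<and> ultrastrong_ball \<xi> \<delta> X \<subseteq> s"
        using \<xi> e N by (intro exI[of _ \<xi>] exI[of _ "e\<^sup>2 / N"]) (auto simp: ultrastrong_ball_def)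
    qed
  qed
  then show ?thesis using assms(2) by blast
qed

lemma topspace_sigma_weak: "topspace sigma_weak_topology = UNIV"
proof -
  have "UNIV \<in> {{X. (\<Sum>n. cinner (blinfun_apply X (\<xi> n)) (\<eta> n :: 'h::complex_hilbert_space)) \<in> U} | \<xi> \<eta> U.
        summable (\<lambda>n::nat. (norm (\<xi> n))\<^sup>2) \<and> summable (\<lambda>n. (norm (\<eta> n))\<^sup>2) \<and> open U}"
    by (rule CollectI, rule exI[of _ "\<lambda>n. 0"], rule exI[of _ "\<lambda>n. 0"], rule exI[of _ UNIV]) auto
  from Union_upper[OF this] show ?thesis
    unfolding sigma_weak_topology_def topology_generated_by_topspace by (rule top.extremum_uniqueI)
qed

section \<open>Consequences of normality\<close>

context wstar_probability_space
begin

sublocale A: star_algebra A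
  using von_neumann by unfold_locales (simp add: von_neumann_algebra_def)

text \<open>The only form in which normality enters the later arguments.\<close>

lemma normal_ultrastrong:
  assumes X: "X \<in> A" and e: "0 < e"
  shows "\<exists>\<xi> \<delta>. square_summable \<xi> \<and> 0 < \<delta> \<and>
    (\<forall>Y \<in> A \<inter> ultrastrong_ball \<xi> \<delta> X. cmod (\<phi> Y - \<phi> X) < e)"
proof -
  have "openin (subtopology sigma_weak_topology A)
      {Y \<in> topspace (subtopology sigma_weak_topology A). \<phi> Y \<in> ball (\<phi> X) e}"
    using normal by (rule openin_continuous_map_preimage) simp
  then obtain U where U: "openin sigma_weak_topology U"
      and eq: "{Y \<in> A. \<phi> Y \<in> ball (\<phi> X) e} = U \<inter> A"
    by (auto simp: openin_subtopology topspace_sigma_weak)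
  have "X \<in> {Y \<in> A. \<phi> Y \<in> ball (\<phi> X) e}" using X e by simp
  then have "X \<in> U" using eq by blast
  from sigma_weak_open_ultrastrong[OF U this] obtain \<xi> \<delta> where *: "square_summable \<xi>" "0 < \<delta>"
    "ultrastrong_ball \<xi> \<delta> X \<subseteq> U" by blast
  have "cmod (\<phi> Y - \<phi> X) < e" if "Y \<in> A \<inter> ultrastrong_ball \<xi> \<delta> X" for Y
  proof -
    have "Y \<in> {Y \<in> A. \<phi> Y \<in> ball (\<phi> X) e}" using *(3) that eq by blast
    then show ?thesis by (simp add: dist_norm norm_minus_commute)
  qed
  then show ?thesis using *(1,2) by blast
qed

lemma zero [simp]: "\<phi> 0 = 0"
  using scale[OF A.id_mem, of 0] by (simp only: scale_op_zero_left mult_zero_left)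

lemma uminus: "X \<in> A \<Longrightarrow> \<phi> (- X) = - \<phi> X"
  using scale[of X "-1"] by (simp add: scale_op_minus1)

lemma diff: "X \<in> A \<Longrightarrow> Y \<in> A \<Longrightarrow> \<phi> (X - Y) = \<phi> X - \<phi> Y"
  using add[of X "- Y"] by (simp add: uminus A.uminus_mem)

text \<open>Ultrastrong continuity at zero bounds \<open>\<phi>\<close> on operators of one small
  fixed norm; scaling does the rest.\<close>

lemma norm_bounded: "\<exists>C>0. \<forall>X\<in>A. cmod (\<phi> X) \<le> C * norm X"
proof -
  obtain \<xi> \<delta> where \<xi>: "square_summable \<xi>" and \<delta>: "0 < \<delta>"
    and *: "\<forall>Y \<in> A \<inter> ultrastrong_ball \<xi> \<delta> 0. cmod (\<phi> Y - \<phi> 0) < 1"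
    using normal_ultrastrong[OF A.zero_mem zero_less_one] by blast
  have small: "cmod (\<phi> Y) < 1" if "Y \<in> A" "(\<Sum>n. (norm (blinfun_apply Y (\<xi> n)))\<^sup>2) < \<delta>" for Y
    using *[rule_format, of Y] that by (simp add: ultrastrong_ball_def)
  define N where "N = (\<Sum>n. (norm (\<xi> n))\<^sup>2) + 1"
  have N: "0 < N" "(\<Sum>n. (norm (\<xi> n))\<^sup>2) < N"
    using \<xi> suminf_nonneg[of "\<lambda>n. (norm (\<xi> n))\<^sup>2"] by (auto simp: N_def square_summable_def)
  \<comment> \<open>All operators of norm \<open>r\<close> lie in the ball, since \<open>N\<close>
    strictly exceeds the sum of the squared norms of \<open>\<xi>\<close>.\<close>
  define r where "r = sqrt (\<delta> / N)"
  have r: "0 < r" "r\<^sup>2 * N = \<delta>" using N \<delta> by (auto simp: r_def)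
  have le1: "cmod (\<phi> Y) \<le> 1" if Y: "Y \<in> A" "norm Y = r" for Y
  proof -
    have "(norm Y)\<^sup>2 * (\<Sum>n. (norm (\<xi> n))\<^sup>2) < \<delta>" using N r by (simp add: Y(2) flip: r(2))
    then show ?thesis using small[OF Y(1)] suminf_square_blinfun_le[OF \<xi>, of Y] by simp
  qed
  have "cmod (\<phi> X) \<le> (1 / r) * norm X" if X: "X \<in> A" for X
  proof (cases "X = 0")
    case False
    define c where "c = r / norm X"
    have "norm (c *\<^sub>R X) = r" using False r by (simp add: c_def)
    then have "cmod (\<phi> (scale_op (of_real c) X)) \<le> 1"
      unfolding scale_op_of_real using X by (intro le1 A.scaleR_mem)
    then show ?thesis using False r X by (simp add: scale c_def norm_mult norm_divide field_simps)
  qed simp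
  then show ?thesis using r by (intro exI[of _ "1 / r"]) auto
qed

text \<open>Left multiplication by \<open>D\<close> enlarges the ultrastrong seminorms at most by
  the factor \<open>norm D\<close>, so the product of \<open>D\<close> and \<open>X\<close> is
  approximated by products of \<open>D\<close> with elements of \<open>M\<close>.\<close>

lemma vanish_on_bicommutant:
  assumes M: "unital_star_algebra M" "M \<subseteq> A" and D: "D \<in> A"
    and van: "\<And>Y. Y \<in> M \<Longrightarrow> \<phi> (D o\<^sub>L Y) = 0" and X: "X \<in> commutant (commutant M)"
  shows "\<phi> (D o\<^sub>L X) = 0"
proof (rule ccontr)
  interpret M: star_algebra M by (rule star_algebra.intro[OF M(1)])
  assume ne: "\<phi> (D o\<^sub>L X) \<noteq> 0"
  have "commutant (commutant M) \<subseteq> commutant (commutant A)" by (rule commutant_antimono[OF commutant_antimono[OF M(2)]])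
  then have XA: "X \<in> A" using X von_neumann by (auto simp: von_neumann_algebra_def)
  have DX: "D o\<^sub>L X \<in> A" by (rule A.compose_mem[OF D XA])
  have pos: "0 < cmod (\<phi> (D o\<^sub>L X))" using ne by simp
  obtain \<xi> \<delta> where \<xi>: "square_summable \<xi>" and \<delta>: "0 < \<delta>"
    and *: "\<forall>Y \<in> A \<inter> ultrastrong_ball \<xi> \<delta> (D o\<^sub>L X). cmod (\<phi> Y - \<phi> (D o\<^sub>L X)) < cmod (\<phi> (D o\<^sub>L X))"
    using normal_ultrastrong[OF DX pos] by blast
  define K where "K = (norm D)\<^sup>2 + 1"
  have K: "0 < K" by (simp add: K_def add_nonneg_pos)
  obtain Y where Y: "Y \<in> M" and less: "(\<Sum>n. (norm (blinfun_apply (Y - X) (\<xi> n)))\<^sup>2) < \<delta> / K"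
    using M.von_neumann_density[OF X \<xi> divide_pos_pos[OF \<delta> K]] by (auto simp: ultrastrong_ball_def)
  have "(\<Sum>n. (norm (blinfun_apply ((D o\<^sub>L Y) - (D o\<^sub>L X)) (\<xi> n)))\<^sup>2)
      \<le> (norm D)\<^sup>2 * (\<Sum>n. (norm (blinfun_apply (Y - X) (\<xi> n)))\<^sup>2)"
    using suminf_square_blinfun_le[of "\<lambda>n. blinfun_apply (Y - X) (\<xi> n)" D]
      square_summable_bounded_linear[OF blinfun.bounded_linear_right \<xi>, of "Y - X"]
    by (simp flip: compose_diff_right)
  also have "\<dots> \<le> (norm D)\<^sup>2 * (\<delta> / K)" using less by (intro mult_left_mono) auto
  also have "\<dots> < \<delta>"
  proof -
    have "(norm D)\<^sup>2 * \<delta> < \<delta> * K" using \<delta> by (simp add: K_def algebra_simps)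
    then show ?thesis using K by (simp add: pos_divide_less_eq)
  qed
  finally show False
    using *[rule_format, of "D o\<^sub>L Y"] van[OF Y] A.compose_mem[OF D] Y M(2)
    by (auto simp: ultrastrong_ball_def)
qed

end

section \<open>Freeness and increments\<close>

lemma unital_star_algebra_Inter:
  "F \<noteq> {} \<Longrightarrow> (\<And>M. M \<in> F \<Longrightarrow> unital_star_algebra M) \<Longrightarrow> unital_star_algebra (\<Inter>F)"
  unfolding unital_star_algebra_def by fastforce

lemma star_alg_gen_minimal: "unital_star_algebra N \<Longrightarrow> S \<subseteq> N \<Longrightarrow> star_alg_gen S \<subseteq> N"
  unfolding star_alg_gen_def by (rule hull_minimal)

lemma star_alg_gen_superset: "S \<subseteq> star_alg_gen S"
  unfolding star_alg_gen_def by (rule hull_subset)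

lemma star_alg_gen_mono: "S \<subseteq> S' \<Longrightarrow> star_alg_gen S \<subseteq> star_alg_gen S'"
  unfolding star_alg_gen_def by (rule hull_mono)

lemma vN_gen_superset: "S \<subseteq> vN_gen S"
  unfolding vN_gen_def by (rule hull_subset)

lemma vN_gen_minimal: "von_neumann_algebra N \<Longrightarrow> S \<subseteq> N \<Longrightarrow> vN_gen S \<subseteq> N"
  unfolding vN_gen_def by (rule hull_minimal)

lemma vN_gen_mono: "S \<subseteq> S' \<Longrightarrow> vN_gen S \<subseteq> vN_gen S'"
  unfolding vN_gen_def by (rule hull_mono)

lemma scale_op_add_right: "scale_op c (X + Y) = scale_op c X + scale_op c Y"
  by (rule blinfun_eqI) (simp add: blinfun.add_left scaleC_add_right)

lemma scale_op_diff: "scale_op c (X - Y) = scale_op c X - scale_op c Y"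
  using scale_op_add_right[of c "X - Y" Y] by (simp add: algebra_simps)

lemma scale_op_zero_right [simp]: "scale_op c 0 = 0"
proof (rule blinfun_eqI)
  show "blinfun_apply (scale_op c 0) v = blinfun_apply 0 v" for v :: 'a
    using scaleC_scaleC[of c 0 "0::'a"] by simp
qed

lemma freely_independent_sym: "freely_independent \<phi> S S' \<Longrightarrow> freely_independent \<phi> S' S"
  unfolding freely_independent_def
proof (intro allI impI)
  fix ps :: "(bool \<times> ('a \<Rightarrow>\<^sub>L 'a)) list"
  assume free: "\<forall>ps. ps \<noteq> [] \<longrightarrow> successively (\<lambda>p q. fst p \<noteq> fst q) ps \<longrightarrow>
        (\<forall>(i, X) \<in> set ps. X \<in> star_alg_gen (if i then S else S') \<and> \<phi> X = 0) \<longrightarrow>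
        \<phi> (op_prod (map snd ps)) = 0"
    and ps: "ps \<noteq> []" "successively (\<lambda>p q. fst p \<noteq> fst q) ps"
      "\<forall>(i, X) \<in> set ps. X \<in> star_alg_gen (if i then S' else S) \<and> \<phi> X = 0"
  let ?qs = "map (\<lambda>(i, X). (\<not> i, X)) ps"
  have 1: "?qs \<noteq> []" using ps(1) by simp
  have 2: "successively (\<lambda>p q. fst p \<noteq> fst q) ?qs"
    using ps(2) by (simp add: successively_map case_prod_beta)
  have 3: "\<forall>(i, X) \<in> set ?qs. X \<in> star_alg_gen (if i then S else S') \<and> \<phi> X = 0"
    using ps(3) by (auto split: if_splits)
  have "\<phi> (op_prod (map snd ?qs)) = 0"
    using free[THEN spec, THEN mp[OF _ 1], THEN mp[OF _ 2], THEN mp[OF _ 3]] .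
  moreover have "map snd ?qs = map snd ps" by auto
  ultimately show "\<phi> (op_prod (map snd ps)) = 0" by (simp only:)
qed

context wstar_probability_space
begin

lemmas phi_add = add

lemma unital_star_algebra_star_alg_gen: "S \<subseteq> A \<Longrightarrow> unital_star_algebra (star_alg_gen S)"
  unfolding star_alg_gen_def hull_def
  by (rule unital_star_algebra_Inter) (auto intro: A.unital_star_algebra)

lemma star_alg_gen_subset: "S \<subseteq> A \<Longrightarrow> star_alg_gen S \<subseteq> A"
  by (rule star_alg_gen_minimal[OF A.unital_star_algebra])

lemma unital_star_algebra_vN_gen: "S \<subseteq> A \<Longrightarrow> unital_star_algebra (vN_gen S)"
  unfolding vN_gen_def hull_def
  by (rule unital_star_algebra_Inter) (use von_neumann in \<open>auto simp: von_neumann_algebra_def\<close>)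

lemma vN_gen_subset: "S \<subseteq> A \<Longrightarrow> vN_gen S \<subseteq> A"
  by (rule vN_gen_minimal[OF von_neumann])

lemma star_alg_gen_subset_vN_gen: "S \<subseteq> A \<Longrightarrow> star_alg_gen S \<subseteq> vN_gen S"
  by (rule star_alg_gen_minimal[OF unital_star_algebra_vN_gen vN_gen_superset])

lemma vN_gen_subset_bicommutant:
  assumes "S \<subseteq> A"
  shows "vN_gen S \<subseteq> commutant (commutant (star_alg_gen S))"
proof -
  interpret S: star_algebra "star_alg_gen S"
    by (rule star_algebra.intro[OF unital_star_algebra_star_alg_gen[OF assms]])
  show ?thesis
    by (rule vN_gen_minimal[OF S.von_neumann_algebra_bicommutant
          order_trans[OF star_alg_gen_superset S.subset_bicommutant]])
qed

section \<open>Alternating words in two algebras\<close>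

definition alternating_word ::
    "('h \<Rightarrow>\<^sub>L 'h) set \<Rightarrow> ('h \<Rightarrow>\<^sub>L 'h) set \<Rightarrow> (bool \<times> ('h \<Rightarrow>\<^sub>L 'h)) list \<Rightarrow> bool" where
  "alternating_word S S' ps \<longleftrightarrow> successively (\<lambda>p q. fst p \<noteq> fst q) ps \<and>
     (\<forall>(i, X) \<in> set ps. X \<in> star_alg_gen (if i then S else S') \<and> \<phi> X = 0)"

inductive_set word_span :: "('h \<Rightarrow>\<^sub>L 'h) set \<Rightarrow> ('h \<Rightarrow>\<^sub>L 'h) set \<Rightarrow> ('h \<Rightarrow>\<^sub>L 'h) set"
  for S S' where
  zero: "0 \<in> word_span S S'"
| add: "a \<in> word_span S S' \<Longrightarrow> b \<in> word_span S S' \<Longrightarrow> a + b \<in> word_span S S'"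
| word: "alternating_word S S' ps \<Longrightarrow> scale_op c (op_prod (map snd ps)) \<in> word_span S S'"

lemma alternating_word_Cons:
  "alternating_word S S' ((i, X) # ps) \<longleftrightarrow> X \<in> star_alg_gen (if i then S else S') \<and> \<phi> X = 0 \<and>
     alternating_word S S' ps \<and> (ps \<noteq> [] \<longrightarrow> fst (hd ps) \<noteq> i)"
  unfolding alternating_word_def by (cases ps) auto

lemma alternating_word_mem:
  assumes "S \<subseteq> A" "S' \<subseteq> A" "alternating_word S S' ps"
  shows "op_prod (map snd ps) \<in> A"
proof -
  have "X \<in> A" if "(i, X) \<in> set ps" for i X
  proof -
    have "X \<in> star_alg_gen (if i then S else S')"
      using assms(3) that unfolding alternating_word_def by blast
    moreover have "star_alg_gen (if i then S else S') \<subseteq> A"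
      using assms(1,2) by (simp add: star_alg_gen_subset)
    ultimately show ?thesis by blast
  qed
  then show ?thesis by (intro A.op_prod_mem) auto
qed

lemma word_span_subset: "S \<subseteq> A \<Longrightarrow> S' \<subseteq> A \<Longrightarrow> word_span S S' \<subseteq> A"
proof
  fix a assume S: "S \<subseteq> A" "S' \<subseteq> A" and "a \<in> word_span S S'"
  from this(3) show "a \<in> A"
    by induction (auto intro: A.add_mem A.scale_mem alternating_word_mem[OF S])
qed

lemma word_span_scale: "a \<in> word_span S S' \<Longrightarrow> scale_op d a \<in> word_span S S'"
  by (induction rule: word_span.induct)
    (auto simp: scale_op_add_right scale_op_scale_op intro: word_span.intros)

text \<open>A letter \<open>g\<close> that cannot be merged with the head of the word is split into
  its centred part, which lengthens the word, and a scalar, which leaves it unchanged. Otherwise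
  \<open>g\<close> is first multiplied into the head.\<close>

lemma word_span_left_mult:
  assumes S: "S \<subseteq> A" "S' \<subseteq> A" and g: "g \<in> star_alg_gen (if i then S else S')"
    and a: "a \<in> word_span S S'"
  shows "g o\<^sub>L a \<in> word_span S S'"
proof -
  interpret G: star_algebra "star_alg_gen (if i then S else S')"
    by (rule star_algebra.intro, rule unital_star_algebra_star_alg_gen) (use S in simp)
  have GA: "star_alg_gen (if i then S else S') \<subseteq> A" using S by (simp add: star_alg_gen_subset)
  have step: "h o\<^sub>L op_prod (map snd ps) \<in> word_span S S'"
    if h: "h \<in> star_alg_gen (if i then S else S')" and ps: "alternating_word S S' ps" "ps \<noteq> [] \<longrightarrow> fst (hd ps) \<noteq> i"
    for h ps
  proof -
    define h0 where "h0 = h - scale_op (\<phi> h) id_blinfun"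
    have "h0 \<in> star_alg_gen (if i then S else S')"
      unfolding h0_def by (intro G.diff_mem G.scale_mem h G.id_mem)
    moreover have "\<phi> h0 = 0"
      using h GA by (subst h0_def, subst diff) (auto simp: scale A.scale_mem unital)
    ultimately have "alternating_word S S' ((i, h0) # ps)" using ps by (simp add: alternating_word_Cons)
    then have "scale_op 1 (op_prod (map snd ((i, h0) # ps))) + scale_op (\<phi> h) (op_prod (map snd ps)) \<in> word_span S S'"
      using ps(1) by (intro word_span.intros)
    moreover have "scale_op 1 (op_prod (map snd ((i, h0) # ps))) + scale_op (\<phi> h) (op_prod (map snd ps))
        = h o\<^sub>L op_prod (map snd ps)"
      by (simp add: h0_def compose_diff_left compose_scale_left)
    ultimately show ?thesis by simp
  qed
  have word_case: "g o\<^sub>L op_prod (map snd ps) \<in> word_span S S'" if ps: "alternating_word S S' ps" for ps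
  proof (cases "ps \<noteq> [] \<longrightarrow> fst (hd ps) \<noteq> i")
    case True
    then show ?thesis using g ps by (intro step)
  next
    case False
    then obtain p qs where qs: "ps = (i, p) # qs" by (cases ps) auto
    then have "(g o\<^sub>L p) o\<^sub>L op_prod (map snd qs) \<in> word_span S S'"
      using ps g by (intro step G.compose_mem) (auto simp: alternating_word_Cons)
    then show ?thesis by (simp add: qs compose_assoc)
  qed
  from a show ?thesis
  proof induction
    case zero
    then show ?case by (simp add: word_span.zero)
  next
    case (add a b)
    then show ?case by (simp add: compose_add_right word_span.add)
  next
    case (word ps c)
    have "complex_linear g" using g GA A.lin by blast
    then show ?case using word_span_scale[OF word_case[OF word]] by (simp add: compose_scale_right)
  qed
qed

text \<open>That \<open>word_span\<close> is an algebra is not evident. The operators which,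
  together with their adjoints, preserve it under left multiplication do form one; they include the
  generators, and applying them to the empty word finishes the proof.\<close>

lemma star_alg_gen_Un_subset_word_span:
  assumes S: "S \<subseteq> A" "S' \<subseteq> A"
  shows "star_alg_gen (S \<union> S') \<subseteq> word_span S S'"
proof -
  define N where "N = {a \<in> A. (\<forall>v \<in> word_span S S'. a o\<^sub>L v \<in> word_span S S') \<and>
    (\<forall>v \<in> word_span S S'. adj a o\<^sub>L v \<in> word_span S S')}"
  have "unital_star_algebra N"
    unfolding unital_star_algebra_def
  proof (intro conjI ballI allI)
    show "id_blinfun \<in> N" by (auto simp: N_def)
    show "complex_linear X" if "X \<in> N" for X using that A.lin by (auto simp: N_def)
    show "X + Y \<in> N" if "X \<in> N" "Y \<in> N" for X Y
      using that by (auto simp: N_def A.add_mem adj_add A.lin compose_add_left intro: word_span.add)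
    show "X o\<^sub>L Y \<in> N" if "X \<in> N" "Y \<in> N" for X Y
      using that by (auto simp: N_def A.compose_mem adj_compose A.lin compose_assoc)
    show "scale_op c X \<in> N" if "X \<in> N" for X c
      using that by (auto simp: N_def A.scale_mem adj_scale A.lin compose_scale_left intro: word_span_scale)
    show "adj X \<in> N" if "X \<in> N" for X
      using that by (auto simp: N_def A.adj_mem adj_adj A.lin)
  qed
  moreover have "S \<union> S' \<subseteq> N"
  proof
    fix a assume a: "a \<in> S \<union> S'"
    obtain i where i: "a \<in> (if i then S else S')" using a by (metis UnE)
    interpret G: star_algebra "star_alg_gen (if i then S else S')"
      by (rule star_algebra.intro, rule unital_star_algebra_star_alg_gen) (use S in simp)
    have "a \<in> star_alg_gen (if i then S else S')" using i star_alg_gen_superset by blast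
    then show "a \<in> N" using a S
      by (auto simp: N_def intro!: word_span_left_mult[OF S] G.adj_mem)
  qed
  ultimately have "star_alg_gen (S \<union> S') \<subseteq> N" by (rule star_alg_gen_minimal)
  moreover have "alternating_word S S' []" by (simp add: alternating_word_def)
  then have "id_blinfun \<in> word_span S S'" using word_span.word[of S S' "[]" 1] by simp
  ultimately show ?thesis by (force simp: N_def)
qed

text \<open>In the application \<open>S\<close> and \<open>S'\<close> are the ranges of two free
  Brownian motions, \<open>R\<close> and \<open>R'\<close> their pasts, and \<open>D\<close> an
  increment of the first. Expand \<open>a\<close> into alternating words over the pasts. A word that
  does not start in \<open>R\<close> can be preceded by \<open>D\<close>; if it starts with
  \<open>p\<close> from \<open>R\<close>, the product of \<open>D\<close> and \<open>p\<close> is a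
  single centred letter. Freeness kills both kinds.\<close>

lemma free_increment_orthogonal:
  assumes S: "S \<subseteq> A" "S' \<subseteq> A" and sub: "R \<subseteq> S" "R' \<subseteq> S'"
    and free: "freely_independent \<phi> S S'"
    and D: "D \<in> star_alg_gen S" "\<phi> D = 0" "\<And>p. p \<in> star_alg_gen R \<Longrightarrow> \<phi> (D o\<^sub>L p) = 0"
    and a: "a \<in> star_alg_gen (R \<union> R')"
  shows "\<phi> (D o\<^sub>L a) = 0"
proof -
  interpret S: star_algebra "star_alg_gen S"
    by (rule star_algebra.intro[OF unital_star_algebra_star_alg_gen[OF S(1)]])
  have R: "R \<subseteq> A" "R' \<subseteq> A" using S sub by auto
  have DA: "D \<in> A" using D(1) star_alg_gen_subset[OF S(1)] by auto
  have gen: "star_alg_gen R \<subseteq> star_alg_gen S" "star_alg_gen R' \<subseteq> star_alg_gen S'"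
    by (rule star_alg_gen_mono[OF sub(1)], rule star_alg_gen_mono[OF sub(2)])
  have mono: "alternating_word S S' ps" if "alternating_word R R' ps" for ps
    using that
  proof (induction ps)
    case (Cons q ps)
    obtain i X where q: "q = (i, X)" by (cases q)
    have "star_alg_gen (if i then R else R') \<subseteq> star_alg_gen (if i then S else S')" using gen by simp
    then show ?case using Cons by (auto simp: q alternating_word_Cons)
  qed (simp add: alternating_word_def)
  have van: "\<phi> (op_prod (map snd ps)) = 0" if "alternating_word S S' ps" "ps \<noteq> []" for ps
    using free that unfolding freely_independent_def alternating_word_def by blast
  have word_case: "\<phi> (D o\<^sub>L op_prod (map snd ps)) = 0" if ps: "alternating_word R R' ps" for ps
  proof (cases "ps \<noteq> [] \<longrightarrow> \<not> fst (hd ps)")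
    case True
    then have "alternating_word S S' ((True, D) # ps)"
      using mono[OF ps] D by (simp add: alternating_word_Cons)
    from van[OF this] show ?thesis by simp
  next
    case False
    then obtain p qs where qs: "ps = (True, p) # qs" by (cases ps) auto
    then have p: "p \<in> star_alg_gen R" and qs': "alternating_word R R' qs" "qs \<noteq> [] \<longrightarrow> \<not> fst (hd qs)"
      using ps by (auto simp: alternating_word_Cons)
    have "alternating_word S S' ((True, D o\<^sub>L p) # qs)"
      using D p gen mono[OF qs'(1)] qs'(2) by (auto simp: alternating_word_Cons intro: S.compose_mem)
    from van[OF this] show ?thesis by (simp add: qs compose_assoc)
  qed
  have "a \<in> word_span R R'" using a star_alg_gen_Un_subset_word_span[OF R] by blast
  then show ?thesis
  proof induction
    case zero
    then show ?case by simp
  next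
    case (add a b)
    then have "a \<in> A" "b \<in> A" using word_span_subset[OF R] by auto
    with add show ?case using DA by (simp add: compose_add_right phi_add A.compose_mem)
  next
    case (word ps c)
    then show ?case
      using DA alternating_word_mem[OF R word]
      by (simp add: compose_scale_right A.lin scale A.compose_mem word_case[OF word])
  qed
qed

section \<open>Moments of the semicircle law\<close>

definition semicircle_density :: "real \<Rightarrow> real \<Rightarrow> real" where
  "semicircle_density v x = sqrt (max 0 (4 * v - x\<^sup>2)) / (2 * pi * v)"

lemma borel_measurable_semicircle_density [measurable]: "semicircle_density v \<in> borel_measurable borel"
  unfolding semicircle_density_def[abs_def] by measurable

lemma semicircular_moment:
  assumes "semicircular \<phi> 0 v X" "0 < v"
  shows "\<phi> (op_power n X) = complex_of_real (\<integral>x. semicircle_density v x * x ^ n \<partial>lborel)"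
proof -
  have "semicircle_measure 0 v = density lborel (\<lambda>x. ennreal (semicircle_density v x))"
    by (simp add: semicircle_measure_def semicircle_density_def)
  moreover have "0 \<le> semicircle_density v x" for x using assms(2) by (simp add: semicircle_density_def)
  ultimately have "(\<integral>x. x ^ n \<partial>semicircle_measure 0 v) = (\<integral>x. semicircle_density v x * x ^ n \<partial>lborel)"
    by (simp add: integral_density)
  then show ?thesis using assms(1) by (simp add: semicircular_def)
qed

lemma semicircular_mean:
  assumes sc: "semicircular \<phi> 0 v X" and v: "0 < v"
  shows "\<phi> X = 0"
proof -
  let ?g = "semicircle_density v"
  \<comment> \<open>The substitution of \<open>-x\<close> for \<open>x\<close>; the density is
    even.\<close>
  have "(\<integral>x. ?g x * x \<partial>lborel) = \<bar>-1\<bar> *\<^sub>R (\<integral>x. ?g (0 + (-1) * x) * (0 + (-1) * x) \<partial>lborel)"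
    by (rule lborel_integral_real_affine) simp
  then have "(\<integral>x. ?g x * x \<partial>lborel) = 0" by (simp add: semicircle_density_def)
  then show ?thesis using semicircular_moment[OF sc v, of 1] by simp
qed

text \<open>The density vanishes where \<open>x^2\<close> exceeds \<open>4 * v\<close>, and its
  total mass is one. Together the bounds for all \<open>k\<close> encode the operator norm
  \<open>2 * sqrt v\<close>.\<close>

lemma semicircular_moment_bound:
  assumes sc: "semicircular \<phi> 0 v X" and v: "0 < v"
  shows "cmod (\<phi> (op_power (2 * k) X)) \<le> (2 * sqrt v) ^ (2 * k)"
proof -
  define g where "g = semicircle_density v"
  have m [measurable]: "g \<in> borel_measurable borel" unfolding g_def by measurable
  have pos: "0 \<le> g x" for x using v by (simp add: g_def semicircle_density_def)
  note mom = semicircular_moment[OF sc v, folded g_def]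
  \<comment> \<open>Total mass one is read off from the zeroth moment, so the density need not be
    integrated; a nonzero integral also forces integrability.\<close>
  have "complex_of_real (\<integral>x. g x \<partial>lborel) = 1" using mom[of 0] unital by simp
  then have one: "(\<integral>x. g x \<partial>lborel) = 1" by (simp only: of_real_eq_1_iff)
  then have int: "integrable lborel g" using not_integrable_integral_eq by fastforce
  have le: "g x * x ^ (2 * k) \<le> g x * (4 * v) ^ k" for x
  proof (cases "x\<^sup>2 \<le> 4 * v")
    case True
    then have "(x\<^sup>2) ^ k \<le> (4 * v) ^ k" by (intro power_mono) auto
    then show ?thesis using pos[of x] by (simp add: power_mult mult_left_mono)
  qed (simp add: g_def semicircle_density_def)
  have int': "integrable lborel (\<lambda>x. g x * (4 * v) ^ k)" using int by simp
  have intk: "integrable lborel (\<lambda>x. g x * x ^ (2 * k))"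
    by (rule Bochner_Integration.integrable_bound[OF int'])
      (use le pos v in \<open>auto simp: abs_mult power_mult\<close>)
  have "(\<integral>x. g x * x ^ (2 * k) \<partial>lborel) \<le> (\<integral>x. g x * (4 * v) ^ k \<partial>lborel)"
    by (rule integral_mono[OF intk int' le])
  also have "\<dots> = (4 * v) ^ k" using one by simp
  finally have "(\<integral>x. g x * x ^ (2 * k) \<partial>lborel) \<le> (2 * sqrt v) ^ (2 * k)"
    using v by (simp add: power_mult power_mult_distrib)
  moreover have "0 \<le> (\<integral>x. g x * x ^ (2 * k) \<partial>lborel)"
    by (rule Bochner_Integration.integral_nonneg) (simp add: pos power_mult)
  ultimately show ?thesis by (simp add: mom)
qed

section \<open>Increments of Brownian motion against the past\<close>

lemma free_brownian_increment_orthogonal: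
  assumes x: "free_brownian_motion A \<phi> x" and y: "free_brownian_motion A \<phi> y"
    and free: "freely_independent \<phi> (x ` {0..}) (y ` {0..})"
    and st: "0 \<le> s" "s < t" and a: "a \<in> star_alg_gen (x ` {0..s} \<union> y ` {0..s})"
  shows "\<phi> ((x t - x s) o\<^sub>L a) = 0"
proof (rule free_increment_orthogonal[OF _ _ _ _ free _ _ _ a])
  have xA: "x ` {0..} \<subseteq> A" using x by (auto simp: free_brownian_motion_def)
  show "x ` {0..} \<subseteq> A" by fact
  show "y ` {0..} \<subseteq> A" using y by (auto simp: free_brownian_motion_def)
  show "x ` {0..s} \<subseteq> x ` {0..}" "y ` {0..s} \<subseteq> y ` {0..}" by auto
  interpret X: star_algebra "star_alg_gen (x ` {0..})"
    by (rule star_algebra.intro[OF unital_star_algebra_star_alg_gen[OF xA]])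
  have "x t \<in> star_alg_gen (x ` {0..})" "x s \<in> star_alg_gen (x ` {0..})"
    using star_alg_gen_superset[of "x ` {0..}"] st by auto
  then show D: "x t - x s \<in> star_alg_gen (x ` {0..})" by (rule X.diff_mem)
  then have DA: "x t - x s \<in> A" using star_alg_gen_subset[OF xA] by blast
  have sc: "semicircular \<phi> 0 (t - s) (x t - x s)"
    and ind: "freely_independent \<phi> {x t - x s} (vN_gen (x ` {0..s}))"
    using x st by (auto simp: free_brownian_motion_def)
  show mean: "\<phi> (x t - x s) = 0" using semicircular_mean[OF sc] st by simp
  \<comment> \<open>Against the past of the same motion: \<open>p\<close> is replaced by its centred
    part, which forms with the increment an alternating word of length two.\<close>
  fix p assume p: "p \<in> star_alg_gen (x ` {0..s})"
  have xsA: "x ` {0..s} \<subseteq> A" using xA by auto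
  interpret V: star_algebra "vN_gen (x ` {0..s})"
    by (rule star_algebra.intro[OF unital_star_algebra_vN_gen[OF xsA]])
  have pV: "p \<in> vN_gen (x ` {0..s})" using p star_alg_gen_subset_vN_gen[OF xsA] by blast
  then have pA: "p \<in> A" using vN_gen_subset[OF xsA] by blast
  define p0 where "p0 = p - scale_op (\<phi> p) id_blinfun"
  have p0V: "p0 \<in> vN_gen (x ` {0..s})" unfolding p0_def by (intro V.diff_mem V.scale_mem V.id_mem pV)
  then have p0A: "p0 \<in> A" using vN_gen_subset[OF xsA] by blast
  have "\<phi> p0 = 0" using pA by (simp add: p0_def diff A.scale_mem scale unital)
  then have "alternating_word {x t - x s} (vN_gen (x ` {0..s})) [(True, x t - x s), (False, p0)]"
    using mean p0V star_alg_gen_superset[of "{x t - x s}"] star_alg_gen_superset[of "vN_gen (x ` {0..s})"]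
    by (auto simp: alternating_word_def)
  then have "\<phi> (op_prod (map snd [(True, x t - x s), (False, p0)])) = 0"
    using ind unfolding freely_independent_def alternating_word_def by blast
  then have "\<phi> ((x t - x s) o\<^sub>L p0) = 0" by simp
  moreover have "(x t - x s) o\<^sub>L p = ((x t - x s) o\<^sub>L p0) + scale_op (\<phi> p) (x t - x s)"
    using DA by (simp add: p0_def compose_diff_right compose_scale_right A.lin)
  ultimately show "\<phi> ((x t - x s) o\<^sub>L p) = 0"
    using DA p0A mean by (simp add: phi_add A.compose_mem A.scale_mem scale)
qed

lemma circular_brownian_mem:
  assumes "circular_brownian_motion A \<phi> w" "0 \<le> t"
  shows "w t \<in> A"
  using assms
  by (auto simp: circular_brownian_motion_def free_brownian_motion_def intro!: A.scale_mem A.add_mem)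

text \<open>The past of \<open>w\<close> mixes \<open>x\<close> and \<open>y\<close>, so the
  increments of each must be orthogonal to their joint past. Linearity gives the claim on the
  generated \<open>star_alg_gen\<close>, and \<open>vanish_on_bicommutant\<close> carries it to
  \<open>filtration\<close>.\<close>

lemma circular_brownian_increment_orthogonal:
  assumes w: "circular_brownian_motion A \<phi> w" and st: "0 \<le> s" "s \<le> t"
    and a: "a \<in> filtration w s"
  shows "\<phi> ((w t - w s) o\<^sub>L a) = 0"
proof (cases "s = t")
  case False
  then have lt: "s < t" using st by simp
  obtain x y where x: "free_brownian_motion A \<phi> x" and y: "free_brownian_motion A \<phi> y"
    and free: "freely_independent \<phi> (x ` {0..}) (y ` {0..})"
    and weq: "\<And>t. t \<ge> 0 \<Longrightarrow> w t = scale_op (1 / complex_of_real (sqrt 2)) (x t + scale_op \<i> (y t))"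
    using w unfolding circular_brownian_motion_def by blast
  let ?c = "1 / complex_of_real (sqrt 2)"
  let ?B = "x ` {0..s} \<union> y ` {0..s}"
  have mem: "x r \<in> A" "y r \<in> A" "w r \<in> A" if "0 \<le> r" for r
    using x y that circular_brownian_mem[OF w] by (auto simp: free_brownian_motion_def)
  have BA: "?B \<subseteq> A" using mem by auto
  have wA: "w ` {0..s} \<subseteq> A" using mem by auto
  interpret B: star_algebra "star_alg_gen ?B"
    by (rule star_algebra.intro[OF unital_star_algebra_star_alg_gen[OF BA]])
  have "w ` {0..s} \<subseteq> star_alg_gen ?B"
    using star_alg_gen_superset[of ?B] by (auto simp: weq intro!: B.scale_mem B.add_mem)
  then have sub: "star_alg_gen (w ` {0..s}) \<subseteq> star_alg_gen ?B"
    by (rule star_alg_gen_minimal[OF B.unital_star_algebra])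
  have dw: "w t - w s = scale_op ?c ((x t - x s) + scale_op \<i> (y t - y s))"
    using st by (simp add: weq scale_op_diff scale_op_add_right algebra_simps)
  have D: "w t - w s \<in> A" "x t - x s \<in> A" "y t - y s \<in> A"
    using st by (auto intro!: A.diff_mem mem)
  have van: "\<phi> ((w t - w s) o\<^sub>L Y) = 0" if Y: "Y \<in> star_alg_gen (w ` {0..s})" for Y
  proof -
    have Y': "Y \<in> star_alg_gen ?B" using Y sub by blast
    then have YA: "Y \<in> A" using star_alg_gen_subset[OF BA] by blast
    have "\<phi> ((x t - x s) o\<^sub>L Y) = 0"
      by (rule free_brownian_increment_orthogonal[OF x y free st(1) lt Y'])
    moreover have "\<phi> ((y t - y s) o\<^sub>L Y) = 0"
      by (rule free_brownian_increment_orthogonal[OF y x freely_independent_sym[OF free] st(1) lt])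
        (use Y' in \<open>simp add: Un_commute\<close>)
    moreover have "(w t - w s) o\<^sub>L Y =
        scale_op ?c (((x t - x s) o\<^sub>L Y) + scale_op \<i> ((y t - y s) o\<^sub>L Y))"
      unfolding dw by (simp only: compose_scale_left compose_add_left)
    ultimately show ?thesis
      using D YA by (simp add: scale phi_add A.add_mem A.scale_mem A.compose_mem)
  qed
  show ?thesis
  proof (rule vanish_on_bicommutant[OF _ _ D(1) van])
    show "unital_star_algebra (star_alg_gen (w ` {0..s}))"
      by (rule unital_star_algebra_star_alg_gen[OF wA])
    show "star_alg_gen (w ` {0..s}) \<subseteq> A" by (rule star_alg_gen_subset[OF wA])
    show "a \<in> commutant (commutant (star_alg_gen (w ` {0..s})))"
      using a vN_gen_subset_bicommutant[OF wA] by (auto simp: filtration_def)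
  qed
qed simp

end

section \<open>Noncommutative \<open>L\<^sup>p\<close> norms for dyadic \<open>p\<close>\<close>

lemma op_prod_concat: "op_prod (concat Xss) = op_prod (map op_prod Xss)"
  by (induction Xss) (simp_all add: op_prod_append)

lemma op_prod_concat_replicate: "op_prod (concat (replicate n Xs)) = op_power n (op_prod Xs)"
  by (simp add: op_prod_concat)

lemma op_prod_replicate_double:
  "op_power n (X o\<^sub>L X) = op_power (2 * n) X"
  by (induction n) (simp_all add: compose_assoc)

text \<open>Iterating \<open>step\<close> bounds \<open>r n\<close> from below by
  \<open>\<alpha> * (r 0 / \<alpha>) ^ (2 ^ n)\<close>. If \<open>r 0 / \<alpha>\<close> exceeded
  \<open>K\<close>, this would outgrow \<open>c * K ^ (2 ^ n)\<close> whatever \<open>c\<close>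
  is.\<close>

lemma power_geometric_bound:
  fixes r :: "nat \<Rightarrow> real"
  assumes nonneg: "\<And>n. 0 \<le> r n" and \<alpha>: "0 \<le> \<alpha>" and K: "0 < K"
    and step: "\<And>n. (r n)\<^sup>2 \<le> \<alpha> * r (Suc n)" and bound: "\<And>n. r n \<le> c * K ^ (2 ^ n)"
  shows "r 0 \<le> K * \<alpha>"
proof (cases "\<alpha> = 0")
  case True
  then show ?thesis using step[of 0] by simp
next
  case False
  then have \<alpha>: "0 < \<alpha>" using \<alpha> by simp
  have lower: "\<alpha> * (r 0 / \<alpha>) ^ (2 ^ n) \<le> r n" for n
  proof (induction n)
    case (Suc n)
    have "\<alpha> * (\<alpha> * (r 0 / \<alpha>) ^ (2 ^ Suc n)) = (\<alpha> * (r 0 / \<alpha>) ^ (2 ^ n))\<^sup>2"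
      by (simp add: power_mult_distrib power2_eq_square flip: power_mult power_add mult_2)
    also have "\<dots> \<le> (r n)\<^sup>2" using Suc \<alpha> nonneg[of 0] by (intro power_mono) auto
    also have "\<dots> \<le> \<alpha> * r (Suc n)" by (rule step)
    finally show ?case using \<alpha> by simp
  qed (use \<alpha> in simp)
  show ?thesis
  proof (rule ccontr)
    assume "\<not> r 0 \<le> K * \<alpha>"
    then have x: "1 < r 0 / (K * \<alpha>)" using \<alpha> K by (simp add: field_simps)
    then obtain n where n: "c / \<alpha> < (r 0 / (K * \<alpha>)) ^ n" using real_arch_pow by blast
    have "(r 0 / (K * \<alpha>)) ^ n \<le> (r 0 / (K * \<alpha>)) ^ (2 ^ n)"
      using x by (intro power_increasing) (auto intro: less_imp_le)
    also have "\<dots> = (r 0 / \<alpha>) ^ (2 ^ n) / K ^ (2 ^ n)" by (simp add: power_divide power_mult_distrib)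
    also have "\<dots> \<le> c / \<alpha>"
      using order_trans[OF lower[of n] bound[of n]] \<alpha> K by (simp add: field_simps)
    finally show False using n by simp
  qed
qed

text \<open>Each pair holds a main term and a perturbation; the moment estimates come from expanding
  a product of such sums.\<close>

abbreviation pair_sums :: "(('h::complex_hilbert_space \<Rightarrow>\<^sub>L 'h) \<times> ('h \<Rightarrow>\<^sub>L 'h)) list \<Rightarrow> ('h \<Rightarrow>\<^sub>L 'h) list" where
  "pair_sums \<equiv> map (\<lambda>(X, D). X + D)"

fun pair_up :: "('h::complex_hilbert_space \<Rightarrow>\<^sub>L 'h) list \<Rightarrow> ('h \<Rightarrow>\<^sub>L 'h) list" where
  "pair_up (X # Y # Xs) = (X o\<^sub>L Y) # pair_up Xs"
| "pair_up _ = []"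

lemma op_prod_pair_up: "even (length Xs) \<Longrightarrow> op_prod (pair_up Xs) = op_prod Xs"
  by (induction Xs rule: pair_up.induct) (simp_all add: compose_assoc)

lemma length_pair_up: "length (pair_up Xs) = length Xs div 2"
  by (induction Xs rule: pair_up.induct) simp_all

lemma (in star_algebra) pair_up_mem: "set Xs \<subseteq> M \<Longrightarrow> set (pair_up Xs) \<subseteq> M"
  by (induction Xs rule: pair_up.induct) (auto intro: compose_mem)

lemma (in star_algebra) adj_op_prod: "set Xs \<subseteq> M \<Longrightarrow> adj (op_prod Xs) = op_prod (map adj (rev Xs))"
  by (induction Xs) (simp_all add: adj_compose lin op_prod_mem op_prod_append)

context wstar_probability_space
begin

section \<open>Positivity and traciality of the state\<close>

lemma phi_square: "X \<in> A \<Longrightarrow> \<phi> (adj X o\<^sub>L X) = complex_of_real (Re (\<phi> (adj X o\<^sub>L X)))"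
  and phi_square_nonneg: "X \<in> A \<Longrightarrow> 0 \<le> Re (\<phi> (adj X o\<^sub>L X))"
  using positive[of X] by (auto simp: complex_nonneg_Reals_iff complex_eq_iff)

text \<open>Positivity at \<open>X + c\<close> makes
  \<open>c * \<phi> (adj X) + cnj c * \<phi> X\<close> real; \<open>c = 1\<close> and
  \<open>c = \<i>\<close> settle the imaginary and the real part.\<close>

lemma phi_adj:
  assumes X: "X \<in> A"
  shows "\<phi> (adj X) = cnj (\<phi> X)"
proof -
  have *: "Im (c * \<phi> (adj X) + cnj c * \<phi> X) = 0" for c
  proof -
    let ?Y = "scale_op c id_blinfun"
    have Y: "?Y \<in> A" by (rule A.scale_mem) simp
    have "adj (X + ?Y) o\<^sub>L (X + ?Y) = (adj X o\<^sub>L X) + scale_op c (adj X) + (scale_op (cnj c) X + scale_op (c * cnj c) id_blinfun)"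
      using X Y
      by (simp add: adj_add adj_scale A.lin compose_add_left compose_add_right compose_scale_left
          compose_scale_right complex_linear_adj scale_op_scale_op scale_op_add_right add_ac mult.commute)
    then have "\<phi> (adj (X + ?Y) o\<^sub>L (X + ?Y)) = \<phi> (adj X o\<^sub>L X) + c * \<phi> (adj X) + (cnj c * \<phi> X + c * cnj c)"
      using X by (simp add: phi_add scale unital A.add_mem A.scale_mem A.compose_mem A.adj_mem)
    moreover have "Im (\<phi> (adj (X + ?Y) o\<^sub>L (X + ?Y))) = 0" "Im (\<phi> (adj X o\<^sub>L X)) = 0"
      using phi_square[OF A.add_mem[OF X Y]] phi_square[OF X] by (metis Im_complex_of_real)+
    ultimately show ?thesis by simp
  qed
  from *[of 1] *[of \<i>] show ?thesis by (simp add: complex_eq_iff)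
qed

lemma phi_Cauchy_Schwarz:
  assumes X: "X \<in> A" and Y: "Y \<in> A"
  shows "(cmod (\<phi> (adj Y o\<^sub>L X)))\<^sup>2 \<le> Re (\<phi> (adj X o\<^sub>L X)) * Re (\<phi> (adj Y o\<^sub>L Y))"
proof (cases "\<phi> (adj Y o\<^sub>L Y) = 0")
  case True
  then have "Y = 0" using faithful[OF Y] by simp
  moreover have "adj 0 = (0 :: 'h \<Rightarrow>\<^sub>L 'h)" by (rule adj_unique) simp
  ultimately show ?thesis by simp
next
  case False
  define p where "p = Re (\<phi> (adj Y o\<^sub>L Y))"
  have p: "\<phi> (adj Y o\<^sub>L Y) = complex_of_real p" "0 < p"
    using phi_square[OF Y] phi_square_nonneg[OF Y] False by (auto simp: p_def less_le complex_eq_iff)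
  define z where "z = \<phi> (adj Y o\<^sub>L X)"
  have "adj (adj Y o\<^sub>L X) = adj X o\<^sub>L Y" using X Y by (simp add: adj_compose A.lin complex_linear_adj adj_adj)
  then have z': "\<phi> (adj X o\<^sub>L Y) = cnj z"
    using phi_adj[of "adj Y o\<^sub>L X"] X Y by (simp add: z_def A.compose_mem A.adj_mem)
  \<comment> \<open>The scalar at which the quadratic expression below is minimal.\<close>
  define c where "c = - (z / p)"
  let ?Z = "X + scale_op c Y"
  have Z: "?Z \<in> A" using X Y by (intro A.add_mem A.scale_mem)
  have "adj ?Z o\<^sub>L ?Z = (adj X o\<^sub>L X) + scale_op c (adj X o\<^sub>L Y)
      + (scale_op (cnj c) (adj Y o\<^sub>L X) + scale_op (c * cnj c) (adj Y o\<^sub>L Y))"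
    using X Y
    by (simp add: adj_add adj_scale A.lin compose_add_left compose_add_right compose_scale_left
        compose_scale_right complex_linear_adj scale_op_scale_op scale_op_add_right add_ac mult.commute)
  then have "\<phi> (adj ?Z o\<^sub>L ?Z) = \<phi> (adj X o\<^sub>L X) + c * cnj z + (cnj c * z + c * cnj c * p)"
    using X Y by (simp add: phi_add scale A.add_mem A.scale_mem A.compose_mem A.adj_mem z' p flip: z_def)
  also have "\<dots> = \<phi> (adj X o\<^sub>L X) - of_real ((cmod z)\<^sup>2 / p)"
    using p(2) complex_norm_square[of z] by (simp add: c_def field_simps)
  finally have "Re (\<phi> (adj ?Z o\<^sub>L ?Z)) = Re (\<phi> (adj X o\<^sub>L X)) - (cmod z)\<^sup>2 / p" by simp
  then have "(cmod z)\<^sup>2 / p \<le> Re (\<phi> (adj X o\<^sub>L X))" using phi_square_nonneg[OF Z] by simp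
  then show ?thesis using p(2) by (simp add: z_def p_def field_simps)
qed

lemma phi_replicate_rotate:
  assumes "X \<in> A" "Y \<in> A"
  shows "\<phi> (op_power n (X o\<^sub>L Y)) = \<phi> (op_power n (Y o\<^sub>L X))"
proof (cases n)
  case (Suc k)
  have shift: "X o\<^sub>L op_power j (Y o\<^sub>L X) = op_power j (X o\<^sub>L Y) o\<^sub>L X" for j
    by (induction j) (simp_all add: compose_assoc)
  have mem: "op_power k (X o\<^sub>L Y) \<in> A"
    using assms by (intro A.op_prod_mem) (auto intro: A.compose_mem)
  have "op_power n (X o\<^sub>L Y) = op_power k (X o\<^sub>L Y) o\<^sub>L (X o\<^sub>L Y)"
    unfolding Suc replicate_append_same[symmetric] replicate_Suc by (simp add: op_prod_append)
  also have "\<phi> \<dots> = \<phi> (Y o\<^sub>L (op_power k (X o\<^sub>L Y) o\<^sub>L X))"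
    using tracial[of "op_power k (X o\<^sub>L Y) o\<^sub>L X" Y] assms mem
    by (simp add: compose_assoc A.compose_mem)
  also have "\<dots> = \<phi> (op_power n (Y o\<^sub>L X))"
    unfolding Suc by (simp add: compose_assoc flip: shift)
  finally show ?thesis .
qed simp

text \<open>The index \<open>m\<close> stands for the exponent \<open>p = 2\<^bsup>m+1\<^esup>\<close>.\<close>

definition pnorm :: "nat \<Rightarrow> ('h \<Rightarrow>\<^sub>L 'h) \<Rightarrow> real" where
  "pnorm m X = root (2 ^ Suc m) (Re (\<phi> (op_power (2 ^ m) (adj X o\<^sub>L X))))"

text \<open>For positive \<open>m\<close> the word is the square of a selfadjoint element, the same
  power with half the exponent.\<close>

lemma phi_power_square:
  assumes X: "X \<in> A"
  shows "\<phi> (op_power (2 ^ m) (adj X o\<^sub>L X)) \<in> \<real>\<^sub>\<ge>\<^sub>0"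
proof (cases m)
  case 0
  then show ?thesis using positive[OF X] by simp
next
  case (Suc k)
  let ?P = "adj X o\<^sub>L X" and ?Y = "op_power (2 ^ k) (adj X o\<^sub>L X)"
  have P: "?P \<in> A" "adj ?P = ?P"
    using X by (auto simp: A.compose_mem A.adj_mem adj_compose A.lin complex_linear_adj adj_adj)
  then have "adj ?Y = ?Y" by (subst A.adj_op_prod) auto
  moreover have "?Y \<in> A" using P by (intro A.op_prod_mem) auto
  moreover have "op_power (2 ^ m) ?P = ?Y o\<^sub>L ?Y"
    by (simp add: Suc mult_2 replicate_add op_prod_append)
  ultimately show ?thesis using positive[of ?Y] by simp
qed

lemma pnorm_nonneg [simp]: "X \<in> A \<Longrightarrow> 0 \<le> pnorm m X"
  using phi_power_square[of X m] by (simp add: pnorm_def complex_nonneg_Reals_iff)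

lemma pnorm_power:
  assumes "X \<in> A"
  shows "\<phi> (op_power (2 ^ m) (adj X o\<^sub>L X)) = complex_of_real (pnorm m X ^ 2 ^ Suc m)"
  using phi_power_square[OF assms, of m]
  by (simp add: pnorm_def complex_nonneg_Reals_iff complex_eq_iff real_root_pow_pos2 del: power_Suc)

lemma pnorm_0_square: "X \<in> A \<Longrightarrow> \<phi> (adj X o\<^sub>L X) = complex_of_real ((pnorm 0 X)\<^sup>2)"
  using pnorm_power[of X 0] by simp

lemma pnorm_eqI:
  assumes "X \<in> A" "0 \<le> r" "\<phi> (op_power (2 ^ m) (adj X o\<^sub>L X)) = complex_of_real (r ^ 2 ^ Suc m)"
  shows "pnorm m X = r"
proof -
  have "complex_of_real (pnorm m X ^ 2 ^ Suc m) = complex_of_real (r ^ 2 ^ Suc m)"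
    using pnorm_power[OF assms(1), of m] assms(3) by (simp only:)
  then have "pnorm m X ^ 2 ^ Suc m = r ^ 2 ^ Suc m" by (simp only: of_real_eq_iff)
  then show ?thesis using assms by (simp add: power_eq_iff_eq_base del: power_Suc)
qed

lemma pnorm_leI:
  assumes "X \<in> A" "0 \<le> r" "cmod (\<phi> (op_power (2 ^ m) (adj X o\<^sub>L X))) \<le> r ^ 2 ^ Suc m"
  shows "pnorm m X \<le> r"
proof (rule power_le_imp_le_base[where n = "2 ^ Suc m - 1"])
  \<comment> \<open>Roots are taken by a rule for exponents of the form \<open>Suc n\<close>, hence
    the shift by one.\<close>
  have "Suc (2 ^ Suc m - 1) = 2 ^ Suc m" by simp
  then show "pnorm m X ^ Suc (2 ^ Suc m - 1) \<le> r ^ Suc (2 ^ Suc m - 1)"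
    using assms pnorm_power[OF assms(1), of m] by (simp add: norm_power del: power_Suc)
qed (use assms in simp)

lemma pnorm_adj:
  assumes "X \<in> A"
  shows "pnorm m (adj X) = pnorm m X"
proof (rule pnorm_eqI)
  show "\<phi> (op_power (2 ^ m) (adj (adj X) o\<^sub>L adj X)) = complex_of_real (pnorm m X ^ 2 ^ Suc m)"
    using assms phi_replicate_rotate[of X "adj X"] by (simp add: adj_adj A.lin A.adj_mem pnorm_power)
qed (use assms in \<open>auto intro: A.adj_mem\<close>)

lemma pnorm_id [simp]: "pnorm m id_blinfun = 1"
proof (rule pnorm_eqI)
  have "op_power n id_blinfun = (id_blinfun :: 'h \<Rightarrow>\<^sub>L 'h)" for n
    by (induction n) auto
  from this[of "2 ^ m"] show "\<phi> (op_power (2 ^ m) (adj id_blinfun o\<^sub>L id_blinfun)) = complex_of_real (1 ^ 2 ^ Suc m)"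
    by (simp only: adj_id compose_id unital power_one of_real_1)
qed auto

lemma pnorm_scale:
  assumes "X \<in> A"
  shows "pnorm m (scale_op c X) = cmod c * pnorm m X"
proof (rule pnorm_eqI)
  let ?P = "adj X o\<^sub>L X"
  have P: "?P \<in> A" using assms by (intro A.compose_mem A.adj_mem)
  have rep: "op_power n (scale_op d ?P) = scale_op (d ^ n) (op_power n ?P)" for n d
    by (induction n) (use P in \<open>simp_all add: compose_scale_left compose_scale_right A.lin scale_op_scale_op mult.commute\<close>)
  have "adj (scale_op c X) o\<^sub>L scale_op c X = scale_op (of_real ((cmod c)\<^sup>2)) ?P"
    using assms
    by (simp add: adj_scale A.lin compose_scale_left compose_scale_right complex_linear_adj scale_op_scale_op
        complex_norm_square mult.commute del: of_real_power)
  moreover have "op_power (2 ^ m) ?P \<in> A" using P by (intro A.op_prod_mem) auto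
  ultimately have "\<phi> (op_power (2 ^ m) (adj (scale_op c X) o\<^sub>L scale_op c X))
      = of_real ((cmod c)\<^sup>2) ^ (2 ^ m) * complex_of_real (pnorm m X ^ 2 ^ Suc m)"
    using assms by (simp add: rep scale pnorm_power del: of_real_power power_Suc)
  also have "\<dots> = complex_of_real ((cmod c * pnorm m X) ^ 2 ^ Suc m)"
    by (simp add: power_mult_distrib power_mult)
  finally show "\<phi> (op_power (2 ^ m) (adj (scale_op c X) o\<^sub>L scale_op c X))
      = complex_of_real ((cmod c * pnorm m X) ^ 2 ^ Suc m)" .
qed (use assms in \<open>auto intro: A.scale_mem\<close>)

lemma pnorm_uminus: "X \<in> A \<Longrightarrow> pnorm m (- X) = pnorm m X"
  using pnorm_scale[of X m "-1"] by (simp add: scale_op_minus1)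

lemma pnorm_zero [simp]: "pnorm m 0 = 0"
  using pnorm_scale[OF A.id_mem, of m 0] by simp

lemma pnorm_square_self:
  assumes X: "X \<in> A"
  shows "pnorm m (adj X o\<^sub>L X) = (pnorm (Suc m) X)\<^sup>2"
proof (rule pnorm_eqI)
  let ?P = "adj X o\<^sub>L X"
  have "adj ?P = ?P" using X by (simp add: adj_compose A.lin complex_linear_adj adj_adj)
  then have "\<phi> (op_power (2 ^ m) (adj ?P o\<^sub>L ?P)) = complex_of_real (pnorm (Suc m) X ^ 2 ^ Suc (Suc m))"
    using pnorm_power[OF X, of "Suc m"] by (simp add: op_prod_replicate_double)
  also have "\<dots> = complex_of_real ((pnorm (Suc m) X)\<^sup>2 ^ 2 ^ Suc m)"
    by (simp flip: power_mult)
  finally show "\<phi> (op_power (2 ^ m) (adj ?P o\<^sub>L ?P)) = complex_of_real ((pnorm (Suc m) X)\<^sup>2 ^ 2 ^ Suc m)" .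
qed (use X in \<open>auto intro: A.compose_mem A.adj_mem\<close>)

lemma prod_list_pnorm_nonneg: "set Xs \<subseteq> A \<Longrightarrow> 0 \<le> prod_list (map (pnorm m) Xs)"
  by (induction Xs) auto

text \<open>Hoelder at level \<open>m\<close> is a hypothesis here and in the next lemma because
  both serve inside the induction that proves it.\<close>

lemma hoelder_alternating_aux:
  assumes hoelder: "\<And>Xs. length Xs = 2 ^ Suc m \<Longrightarrow> set Xs \<subseteq> A \<Longrightarrow>
      cmod (\<phi> (op_prod Xs)) \<le> prod_list (map (pnorm m) Xs)"
    and X: "X \<in> A" and Y: "Y \<in> A"
  shows "cmod (\<phi> (op_power (2 ^ m) (X o\<^sub>L Y))) \<le> (pnorm m X * pnorm m Y) ^ 2 ^ m"
proof -
  let ?Xs = "\<lambda>n. concat (replicate n [X, Y])"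
  have len: "length (?Xs n) = n * 2" for n by (induction n) auto
  have prod: "prod_list (map (pnorm m) (?Xs n)) = (pnorm m X * pnorm m Y) ^ n" for n
    by (induction n) auto
  have "cmod (\<phi> (op_prod (?Xs (2 ^ m)))) \<le> prod_list (map (pnorm m) (?Xs (2 ^ m)))"
    using X Y by (intro hoelder) (auto simp: len)
  then show ?thesis unfolding prod by (simp add: op_prod_concat_replicate)
qed

lemma pnorm_compose_aux:
  assumes hoelder: "\<And>Xs. length Xs = 2 ^ Suc m \<Longrightarrow> set Xs \<subseteq> A \<Longrightarrow>
      cmod (\<phi> (op_prod Xs)) \<le> prod_list (map (pnorm m) Xs)"
    and X: "X \<in> A" and Y: "Y \<in> A"
  shows "pnorm m (X o\<^sub>L Y) \<le> pnorm (Suc m) X * pnorm (Suc m) Y"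
proof (rule pnorm_leI)
  let ?q = "2 ^ m :: nat" and ?P = "adj X o\<^sub>L X" and ?Q = "Y o\<^sub>L adj Y"
  have PQ: "?P \<in> A" "?Q \<in> A" using X Y by (auto intro: A.compose_mem A.adj_mem)
  have "\<phi> (op_power ?q (adj (X o\<^sub>L Y) o\<^sub>L (X o\<^sub>L Y)))
      = \<phi> (op_power ?q (adj Y o\<^sub>L (?P o\<^sub>L Y)))"
    using X Y by (simp add: adj_compose A.lin compose_assoc)
  also have "\<dots> = \<phi> (op_power ?q ((?P o\<^sub>L Y) o\<^sub>L adj Y))"
    using X Y PQ by (intro phi_replicate_rotate A.adj_mem A.compose_mem)
  also have "cmod \<dots> \<le> (pnorm m ?P * pnorm m ?Q) ^ ?q"
    using hoelder_alternating_aux[OF hoelder PQ] by (simp add: compose_assoc)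
  also have "pnorm m ?Q = (pnorm (Suc m) Y)\<^sup>2"
    using pnorm_square_self[of "adj Y" m] Y by (simp add: A.adj_mem adj_adj A.lin pnorm_adj)
  also have "pnorm m ?P = (pnorm (Suc m) X)\<^sup>2" by (rule pnorm_square_self[OF X])
  also have "((pnorm (Suc m) X)\<^sup>2 * (pnorm (Suc m) Y)\<^sup>2) ^ ?q = (pnorm (Suc m) X * pnorm (Suc m) Y) ^ 2 ^ Suc m"
    by (simp add: power_mult_distrib power_mult)
  finally show "cmod (\<phi> (op_power ?q (adj (X o\<^sub>L Y) o\<^sub>L (X o\<^sub>L Y)))) \<le> (pnorm (Suc m) X * pnorm (Suc m) Y) ^ 2 ^ Suc m" .
qed (use X Y in \<open>auto intro: A.compose_mem\<close>)

text \<open>Pairing neighbours halves the number of factors, and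
  \<open>\<parallel>X Y\<parallel>\<^sub>p\<^sup>p = \<phi>((X\<^sup>* X Y Y\<^sup>*)\<^bsup>p/2\<^esup>)\<close> is again a product of \<open>p\<close> factors.\<close>

theorem hoelder:
  "length Xs = 2 ^ Suc m \<Longrightarrow> set Xs \<subseteq> A \<Longrightarrow> cmod (\<phi> (op_prod Xs)) \<le> prod_list (map (pnorm m) Xs)"
proof (induction m arbitrary: Xs)
  case 0
  then obtain X Y where Xs: "Xs = [X, Y]" by (auto simp: length_Suc_conv numeral_2_eq_2)
  then have XY: "X \<in> A" "Y \<in> A" using 0 by auto
  have "(cmod (\<phi> (adj (adj X) o\<^sub>L Y)))\<^sup>2 \<le> (pnorm 0 Y)\<^sup>2 * (pnorm 0 (adj X))\<^sup>2"
    using phi_Cauchy_Schwarz[of Y "adj X"] XY by (simp add: pnorm_0_square A.adj_mem)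
  then have "(cmod (\<phi> (X o\<^sub>L Y)))\<^sup>2 \<le> (pnorm 0 X * pnorm 0 Y)\<^sup>2"
    using XY by (simp add: adj_adj A.lin pnorm_adj power_mult_distrib mult.commute)
  then have "cmod (\<phi> (X o\<^sub>L Y)) \<le> pnorm 0 X * pnorm 0 Y"
    by (rule power2_le_imp_le) (use XY in simp)
  then show ?case by (simp add: Xs)
next
  case (Suc m)
  have le: "prod_list (map (pnorm m) (pair_up Ys)) \<le> prod_list (map (pnorm (Suc m)) Ys)"
    if "set Ys \<subseteq> A" "even (length Ys)" for Ys
    using that
  proof (induction Ys rule: pair_up.induct)
    case (1 X Y Ys)
    have "pnorm m (X o\<^sub>L Y) \<le> pnorm (Suc m) X * pnorm (Suc m) Y"
      using 1 by (intro pnorm_compose_aux Suc.IH) auto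
    then have "pnorm m (X o\<^sub>L Y) * prod_list (map (pnorm m) (pair_up Ys))
        \<le> (pnorm (Suc m) X * pnorm (Suc m) Y) * prod_list (map (pnorm (Suc m)) Ys)"
      using 1 by (intro mult_mono prod_list_pnorm_nonneg A.pair_up_mem) auto
    then show ?case by (simp add: mult.assoc)
  qed auto
  have "cmod (\<phi> (op_prod Xs)) = cmod (\<phi> (op_prod (pair_up Xs)))"
    using Suc.prems by (simp add: op_prod_pair_up)
  also have "\<dots> \<le> prod_list (map (pnorm m) (pair_up Xs))"
    using Suc.prems by (intro Suc.IH A.pair_up_mem) (auto simp: length_pair_up)
  also have "\<dots> \<le> prod_list (map (pnorm (Suc m)) Xs)" using Suc.prems by (intro le) auto
  finally show ?case .
qed

lemma pnorm_compose: "X \<in> A \<Longrightarrow> Y \<in> A \<Longrightarrow> pnorm m (X o\<^sub>L Y) \<le> pnorm (Suc m) X * pnorm (Suc m) Y"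
  by (rule pnorm_compose_aux[OF hoelder])

lemma phi_compose_le: "X \<in> A \<Longrightarrow> Y \<in> A \<Longrightarrow> cmod (\<phi> (X o\<^sub>L Y)) \<le> pnorm 0 X * pnorm 0 Y"
  using hoelder[of "[X, Y]" 0] by simp

lemma pnorm_mono: "m \<le> n \<Longrightarrow> X \<in> A \<Longrightarrow> pnorm m X \<le> pnorm n X"
proof (induction rule: dec_induct)
  case (step n)
  then show ?case using pnorm_compose[of X id_blinfun n] by simp
qed simp

text \<open>Each factor split off by \<open>pnorm_compose\<close> costs one level, which explains
  the condition on \<open>n\<close>.\<close>

lemma pnorm_op_prod:
  "set Xs \<subseteq> A \<Longrightarrow> m + length Xs \<le> n \<Longrightarrow> pnorm m (op_prod Xs) \<le> prod_list (map (pnorm n) Xs)"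
proof (induction Xs arbitrary: m)
  case (Cons X Xs)
  have "pnorm m (X o\<^sub>L op_prod Xs) \<le> pnorm (Suc m) X * pnorm (Suc m) (op_prod Xs)"
    using Cons.prems by (intro pnorm_compose A.op_prod_mem) auto
  also have "\<dots> \<le> pnorm n X * prod_list (map (pnorm n) Xs)"
    using Cons.prems by (intro mult_mono pnorm_mono Cons.IH pnorm_nonneg A.op_prod_mem) auto
  finally show ?case by simp
qed simp

text \<open>Links the operator norm, in which the integral and the continuity of \<open>b\<close>
  are given, with the \<open>L^2\<close> norm, in which errors are estimated.\<close>

lemma pnorm_0_le_norm: "\<exists>C>0. \<forall>X\<in>A. pnorm 0 X \<le> C * norm X"
proof -
  obtain C where C: "0 < C" "\<And>X. X \<in> A \<Longrightarrow> cmod (\<phi> X) \<le> C * norm X" using norm_bounded by blast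
  have "pnorm 0 X \<le> sqrt C * norm X" if X: "X \<in> A" for X
  proof (rule power2_le_imp_le)
    have "(pnorm 0 X)\<^sup>2 = cmod (\<phi> (adj X o\<^sub>L X))" using pnorm_0_square[OF X] by (simp add: norm_power)
    also have "\<dots> \<le> C * norm (adj X o\<^sub>L X)" using X by (intro C A.compose_mem A.adj_mem)
    also have "\<dots> \<le> C * (norm (adj X) * norm X)"
      using C by (intro mult_left_mono norm_blinfun_compose) auto
    also have "\<dots> \<le> C * (norm X * norm X)"
      using C X by (intro mult_left_mono mult_right_mono norm_adj_le A.lin) auto
    finally show "(pnorm 0 X)\<^sup>2 \<le> (sqrt C * norm X)\<^sup>2"
      using C by (simp add: power_mult_distrib) (simp add: power2_eq_square)
  qed (use C in simp)
  then show ?thesis using C by (intro exI[of _ "sqrt C"]) auto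
qed

text \<open>Iterating \<open>\<parallel>Z Y\<parallel>\<^sup>2 \<le> \<parallel>Y\<parallel> \<parallel>Z\<^sup>* Z Y\<parallel>\<close> along \<open>Z = X, X\<^sup>2, X\<^sup>4, \<dots>\<close> extracts the operator bound from the
  moments alone, without spectral theory.\<close>

lemma pnorm_compose_bounded:
  assumes X: "X \<in> A" "adj X = X" and K: "0 < K"
    and mom: "\<And>k. cmod (\<phi> (op_power (2 * k) X)) \<le> K ^ (2 * k)" and Y: "Y \<in> A"
  shows "pnorm m (X o\<^sub>L Y) \<le> K * pnorm m Y"
proof -
  define P where "P n = op_power (2 ^ n) X" for n
  have P: "P n \<in> A" "adj (P n) = P n" "P n o\<^sub>L P n = P (Suc n)" for n
    using X by (auto simp: P_def A.adj_op_prod mult_2 replicate_add op_prod_append intro!: A.op_prod_mem)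
  \<comment> \<open>Hoelder for the word that alternates between \<open>adj Y\<close> and
    \<open>?W\<close>, followed by a root.\<close>
  have step: "(pnorm m (Z o\<^sub>L Y))\<^sup>2 \<le> pnorm m Y * pnorm m ((adj Z o\<^sub>L Z) o\<^sub>L Y)" if Z: "Z \<in> A" for Z
  proof -
    let ?q = "2 ^ m :: nat" and ?W = "(adj Z o\<^sub>L Z) o\<^sub>L Y"
    have W: "?W \<in> A" using Y Z by (intro A.compose_mem A.adj_mem)
    have "pnorm m (Z o\<^sub>L Y) ^ 2 ^ Suc m = cmod (\<phi> (op_power ?q (adj (Z o\<^sub>L Y) o\<^sub>L (Z o\<^sub>L Y))))"
      using Y Z by (simp add: pnorm_power A.compose_mem norm_power)
    also have "adj (Z o\<^sub>L Y) o\<^sub>L (Z o\<^sub>L Y) = adj Y o\<^sub>L ?W"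
      using Y Z by (simp add: adj_compose A.lin compose_assoc)
    also have "cmod (\<phi> (op_power ?q (adj Y o\<^sub>L ?W))) \<le> (pnorm m (adj Y) * pnorm m ?W) ^ ?q"
      using Y W by (intro hoelder_alternating_aux hoelder A.adj_mem)
    also have "pnorm m (adj Y) = pnorm m Y" using Y by (rule pnorm_adj)
    finally have "((pnorm m (Z o\<^sub>L Y))\<^sup>2) ^ Suc (?q - 1) \<le> (pnorm m Y * pnorm m ?W) ^ Suc (?q - 1)"
      by (simp flip: power_mult)
    then show ?thesis by (rule power_le_imp_le_base) (use Y W in simp)
  qed
  have "pnorm m (P 0 o\<^sub>L Y) \<le> K * pnorm m Y"
  proof (rule power_geometric_bound)
    show "0 \<le> pnorm m (P n o\<^sub>L Y)" for n using P Y by (intro pnorm_nonneg A.compose_mem)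
    show "0 \<le> pnorm m Y" using Y by simp
    show "(pnorm m (P n o\<^sub>L Y))\<^sup>2 \<le> pnorm m Y * pnorm m (P (Suc n) o\<^sub>L Y)" for n
      using step[OF P(1)[of n]] by (simp add: P)
    \<comment> \<open>A crude bound by Hoelder at the next level. Its factor
      \<open>pnorm (Suc m) Y\<close> plays the constant \<open>c\<close> of
      \<open>power_geometric_bound\<close> and is absent from the conclusion.\<close>
    show "pnorm m (P n o\<^sub>L Y) \<le> pnorm (Suc m) Y * K ^ 2 ^ n" for n
    proof -
      have "pnorm (Suc m) (P n) \<le> K ^ 2 ^ n"
      proof (rule pnorm_leI[OF P(1)])
        have "op_power (2 ^ Suc m) (adj (P n) o\<^sub>L P n) = op_power (2 * (2 ^ m * 2 ^ Suc n)) X"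
        proof -
          have "op_power i (op_power j X) = op_power (i * j) X" for i j
            by (induction i) (auto simp: replicate_add op_prod_append)
          then show ?thesis by (simp add: P) (simp add: P_def mult_ac)
        qed
        then have "cmod (\<phi> (op_power (2 ^ Suc m) (adj (P n) o\<^sub>L P n))) \<le> K ^ (2 * (2 ^ m * 2 ^ Suc n))"
          using mom by metis
        also have "\<dots> = (K ^ 2 ^ n) ^ 2 ^ Suc (Suc m)" by (simp add: mult_ac flip: power_mult)
        finally show "cmod (\<phi> (op_power (2 ^ Suc m) (adj (P n) o\<^sub>L P n))) \<le> (K ^ 2 ^ n) ^ 2 ^ Suc (Suc m)" .
      qed (use K in simp)
      then have "pnorm (Suc m) (P n) * pnorm (Suc m) Y \<le> K ^ 2 ^ n * pnorm (Suc m) Y"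
        using Y by (intro mult_right_mono) auto
      then show ?thesis using pnorm_compose[OF P(1)[of n] Y, of m] by (simp add: mult.commute)
    qed
  qed (rule K)
  then show ?thesis by (simp add: P_def)
qed

section \<open>Expanding moments of products of sums\<close>

definition bounded_pairs :: "nat \<Rightarrow> real \<Rightarrow> real \<Rightarrow> (('h \<Rightarrow>\<^sub>L 'h) \<times> ('h \<Rightarrow>\<^sub>L 'h)) list \<Rightarrow> bool" where
  "bounded_pairs m \<alpha> \<delta> ps \<longleftrightarrow>
     (\<forall>(X, D) \<in> set ps. X \<in> A \<and> D \<in> A \<and> pnorm m X \<le> \<alpha> \<and> pnorm m D \<le> \<delta>)"

lemma bounded_pairs_Cons:
  "bounded_pairs m \<alpha> \<delta> ((X, D) # ps) \<longleftrightarrow>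
    X \<in> A \<and> D \<in> A \<and> pnorm m X \<le> \<alpha> \<and> pnorm m D \<le> \<delta> \<and> bounded_pairs m \<alpha> \<delta> ps"
  by (simp add: bounded_pairs_def)

lemma pair_sums_mem: "bounded_pairs m \<alpha> \<delta> ps \<Longrightarrow> set (pair_sums ps) \<subseteq> A"
  by (auto simp: bounded_pairs_def intro!: A.add_mem)

lemma phi_op_prod_add:
  assumes "set Xs \<subseteq> A" "X \<in> A" "D \<in> A" "set Ys \<subseteq> A"
  shows "\<phi> (op_prod (Xs @ (X + D) # Ys)) = \<phi> (op_prod (Xs @ X # Ys)) + \<phi> (op_prod (Xs @ D # Ys))"
  using assms A.op_prod_mem[OF assms(1)] A.op_prod_mem[OF assms(4)]
  by (simp add: op_prod_append compose_add_left compose_add_right phi_add A.compose_mem)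

text \<open>\<open>Xs\<close> holds the factors in which a summand has been chosen,
  \<open>ps\<close> the unexpanded ones; the total length stays fixed, so that Hoelder applies once
  all are chosen. The triangle inequality for \<open>pnorm\<close> is a consequence and hence not
  yet available.\<close>

lemma phi_expand_le:
  fixes \<alpha> \<delta> :: real
  assumes "set Xs \<subseteq> A" "bounded_pairs m \<alpha> \<delta> ps" "length Xs + length ps = 2 ^ Suc m" "0 \<le> \<alpha>" "0 \<le> \<delta>"
  shows "cmod (\<phi> (op_prod (Xs @ pair_sums ps))) \<le> prod_list (map (pnorm m) Xs) * (\<alpha> + \<delta>) ^ length ps"
  using assms
proof (induction ps arbitrary: Xs)
  case Nil
  then show ?case using hoelder[of Xs m] by simp
next
  case (Cons p ps)
  obtain X D where p: "p = (X, D)" by (cases p)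
  let ?f = "pair_sums ps"
  have mem: "X \<in> A" "D \<in> A" "pnorm m X \<le> \<alpha>" "pnorm m D \<le> \<delta>" and ps: "bounded_pairs m \<alpha> \<delta> ps"
    using Cons.prems(2) by (auto simp: p bounded_pairs_Cons)
  have IH: "cmod (\<phi> (op_prod (Xs @ Z # ?f))) \<le> prod_list (map (pnorm m) Xs) * c * (\<alpha> + \<delta>) ^ length ps"
    if Z: "Z \<in> A" "pnorm m Z \<le> c" for Z c
  proof -
    have "cmod (\<phi> (op_prod ((Xs @ [Z]) @ ?f))) \<le> prod_list (map (pnorm m) (Xs @ [Z])) * (\<alpha> + \<delta>) ^ length ps"
      by (rule Cons.IH) (use Cons.prems ps Z in auto)
    also have "\<dots> \<le> prod_list (map (pnorm m) Xs) * c * (\<alpha> + \<delta>) ^ length ps"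
      using Z Cons.prems prod_list_pnorm_nonneg[of Xs m]
      by (auto intro!: mult_right_mono mult_left_mono)
    finally show ?thesis by simp
  qed
  have "\<phi> (op_prod (Xs @ pair_sums (p # ps))) = \<phi> (op_prod (Xs @ X # ?f)) + \<phi> (op_prod (Xs @ D # ?f))"
    using phi_op_prod_add[OF Cons.prems(1) mem(1,2) pair_sums_mem[OF ps]] by (simp add: p)
  then have "cmod (\<phi> (op_prod (Xs @ pair_sums (p # ps))))
      \<le> cmod (\<phi> (op_prod (Xs @ X # ?f))) + cmod (\<phi> (op_prod (Xs @ D # ?f)))"
    using norm_triangle_ineq by metis
  also have "\<dots> \<le> prod_list (map (pnorm m) Xs) * \<alpha> * (\<alpha> + \<delta>) ^ length ps + prod_list (map (pnorm m) Xs) * \<delta> * (\<alpha> + \<delta>) ^ length ps"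
    by (intro add_mono IH mem)
  also have "\<dots> = prod_list (map (pnorm m) Xs) * (\<alpha> + \<delta>) ^ length (p # ps)" by (simp add: algebra_simps)
  finally show ?case .
qed

text \<open>The \<open>p\<close>-th power is the value of a word in \<open>p\<close> sums; Hoelder
  on every term of its expansion adds up to the binomial power of
  \<open>pnorm m X + pnorm m Y\<close>.\<close>

lemma pnorm_triangle:
  assumes X: "X \<in> A" and Y: "Y \<in> A"
  shows "pnorm m (X + Y) \<le> pnorm m X + pnorm m Y"
proof (rule pnorm_leI)
  let ?ps = "concat (replicate (2 ^ m) [(adj X, adj Y), (X, Y)])"
  have len: "length (concat (replicate n [(adj X, adj Y), (X, Y)])) = n * 2" for n by (induction n) auto
  have "pair_sums ?ps = concat (replicate (2 ^ m) [adj X + adj Y, X + Y])"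
    by (simp add: map_concat)
  then have "op_power (2 ^ m) (adj (X + Y) o\<^sub>L (X + Y)) = op_prod ([] @ pair_sums ?ps)"
    using X Y by (simp add: op_prod_concat_replicate adj_add A.lin del: map_concat)
  moreover have "cmod (\<phi> (op_prod ([] @ pair_sums ?ps))) \<le> prod_list (map (pnorm m) []) * (pnorm m X + pnorm m Y) ^ length ?ps"
    by (rule phi_expand_le) (use X Y in \<open>auto simp: len A.adj_mem pnorm_adj bounded_pairs_def\<close>)
  ultimately show "cmod (\<phi> (op_power (2 ^ m) (adj (X + Y) o\<^sub>L (X + Y)))) \<le> (pnorm m X + pnorm m Y) ^ 2 ^ Suc m"
    by (simp add: len mult.commute)
qed (use X Y in \<open>auto intro: A.add_mem\<close>)

text \<open>The same expansion without the word consisting of main terms only, which accounts for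
  the subtracted power of \<open>\<alpha>\<close>.\<close>

lemma phi_expand_diff_le:
  fixes \<alpha> \<delta> :: real
  assumes "set Xs \<subseteq> A" "bounded_pairs m \<alpha> \<delta> ps" "length Xs + length ps = 2 ^ Suc m" "0 \<le> \<alpha>" "0 \<le> \<delta>"
  shows "cmod (\<phi> (op_prod (Xs @ pair_sums ps)) - \<phi> (op_prod (Xs @ map fst ps)))
    \<le> prod_list (map (pnorm m) Xs) * ((\<alpha> + \<delta>) ^ length ps - \<alpha> ^ length ps)"
  using assms
proof (induction ps arbitrary: Xs)
  case (Cons p ps)
  obtain X D where p: "p = (X, D)" by (cases p)
  let ?f = "pair_sums ps" and ?c = "prod_list (map (pnorm m) Xs)" and ?n = "length ps"
  have mem: "X \<in> A" "D \<in> A" "pnorm m X \<le> \<alpha>" "pnorm m D \<le> \<delta>" and ps: "bounded_pairs m \<alpha> \<delta> ps"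
    using Cons.prems(2) by (auto simp: p bounded_pairs_Cons)
  have c: "0 \<le> ?c" using Cons.prems(1) by (rule prod_list_pnorm_nonneg)
  have d: "0 \<le> (\<alpha> + \<delta>) ^ ?n - \<alpha> ^ ?n" using Cons.prems by (simp add: power_mono)
  have "cmod (\<phi> (op_prod ((Xs @ [X]) @ ?f)) - \<phi> (op_prod ((Xs @ [X]) @ map fst ps)))
      \<le> prod_list (map (pnorm m) (Xs @ [X])) * ((\<alpha> + \<delta>) ^ ?n - \<alpha> ^ ?n)"
    by (rule Cons.IH) (use Cons.prems mem ps in auto)
  also have "\<dots> \<le> ?c * \<alpha> * ((\<alpha> + \<delta>) ^ ?n - \<alpha> ^ ?n)"
    using mem c d by (auto intro!: mult_right_mono mult_left_mono)
  finally have 1: "cmod (\<phi> (op_prod (Xs @ X # ?f)) - \<phi> (op_prod (Xs @ X # map fst ps)))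
      \<le> ?c * \<alpha> * ((\<alpha> + \<delta>) ^ ?n - \<alpha> ^ ?n)" by simp
  have "cmod (\<phi> (op_prod ((Xs @ [D]) @ ?f))) \<le> prod_list (map (pnorm m) (Xs @ [D])) * (\<alpha> + \<delta>) ^ ?n"
    by (rule phi_expand_le) (use Cons.prems mem ps in auto)
  also have "\<dots> \<le> ?c * \<delta> * (\<alpha> + \<delta>) ^ ?n"
    using mem c Cons.prems by (auto intro!: mult_right_mono mult_left_mono)
  finally have 2: "cmod (\<phi> (op_prod (Xs @ D # ?f))) \<le> ?c * \<delta> * (\<alpha> + \<delta>) ^ ?n" by simp
  have "\<phi> (op_prod (Xs @ pair_sums (p # ps))) = \<phi> (op_prod (Xs @ X # ?f)) + \<phi> (op_prod (Xs @ D # ?f))"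
    using phi_op_prod_add[OF Cons.prems(1) mem(1,2) pair_sums_mem[OF ps]] by (simp add: p)
  then have "\<phi> (op_prod (Xs @ pair_sums (p # ps))) - \<phi> (op_prod (Xs @ map fst (p # ps)))
      = (\<phi> (op_prod (Xs @ X # ?f)) - \<phi> (op_prod (Xs @ X # map fst ps))) + \<phi> (op_prod (Xs @ D # ?f))"
    by (simp add: p)
  then have "cmod (\<phi> (op_prod (Xs @ pair_sums (p # ps))) - \<phi> (op_prod (Xs @ map fst (p # ps))))
      \<le> ?c * \<alpha> * ((\<alpha> + \<delta>) ^ ?n - \<alpha> ^ ?n) + ?c * \<delta> * (\<alpha> + \<delta>) ^ ?n"
    using norm_triangle_le[OF add_mono[OF 1 2]] by (simp only:)
  also have "\<dots> = ?c * ((\<alpha> + \<delta>) ^ length (p # ps) - \<alpha> ^ length (p # ps))"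
    by (simp add: algebra_simps)
  finally show ?case .
qed simp

text \<open>Words with a single perturbation vanish by assumption, so of the binomial expansion only
  the terms with at least two perturbations remain.\<close>

lemma phi_expand_second_order_le:
  fixes \<alpha> \<delta> :: real
  assumes "set Xs \<subseteq> A" "bounded_pairs m \<alpha> \<delta> ps" "length Xs + length ps = 2 ^ Suc m" "0 \<le> \<alpha>" "0 \<le> \<delta>"
    and "\<And>us X D vs. ps = us @ (X, D) # vs \<Longrightarrow> \<phi> (op_prod (Xs @ map fst us @ D # map fst vs)) = 0"
  shows "cmod (\<phi> (op_prod (Xs @ pair_sums ps)) - \<phi> (op_prod (Xs @ map fst ps)))
    \<le> prod_list (map (pnorm m) Xs) * ((\<alpha> + \<delta>) ^ length ps - \<alpha> ^ length ps - length ps * \<alpha> ^ (length ps - 1) * \<delta>)"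
  using assms
proof (induction ps arbitrary: Xs)
  case (Cons p ps)
  obtain X D where p: "p = (X, D)" by (cases p)
  let ?f = "pair_sums ps" and ?c = "prod_list (map (pnorm m) Xs)" and ?n = "length ps"
  let ?e = "(\<alpha> + \<delta>) ^ ?n - \<alpha> ^ ?n - ?n * \<alpha> ^ (?n - 1) * \<delta>"
  have mem: "X \<in> A" "D \<in> A" "pnorm m X \<le> \<alpha>" "pnorm m D \<le> \<delta>" and ps: "bounded_pairs m \<alpha> \<delta> ps"
    using Cons.prems(2) by (auto simp: p bounded_pairs_Cons)
  have c: "0 \<le> ?c" using Cons.prems(1) by (rule prod_list_pnorm_nonneg)
  have d: "0 \<le> (\<alpha> + \<delta>) ^ ?n - \<alpha> ^ ?n" using Cons.prems by (simp add: power_mono)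
  have e: "0 \<le> ?e"
  proof -
    have "\<alpha> ^ n + n * \<alpha> ^ (n - 1) * \<delta> \<le> (\<alpha> + \<delta>) ^ n" for n
    proof (induction n)
      case (Suc n)
      have "\<alpha> ^ Suc n + Suc n * \<alpha> ^ n * \<delta> \<le> (\<alpha> + \<delta>) * (\<alpha> ^ n + n * \<alpha> ^ (n - 1) * \<delta>)"
        using Cons.prems(4,5) by (cases n) (auto simp: algebra_simps)
      also have "\<dots> \<le> (\<alpha> + \<delta>) * (\<alpha> + \<delta>) ^ n"
        using Suc Cons.prems by (intro mult_left_mono) auto
      finally show ?case by simp
    qed simp
    from this[of ?n] show ?thesis by simp
  qed
  have "cmod (\<phi> (op_prod ((Xs @ [X]) @ ?f)) - \<phi> (op_prod ((Xs @ [X]) @ map fst ps)))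
      \<le> prod_list (map (pnorm m) (Xs @ [X])) * ?e"
  proof (rule Cons.IH)
    fix us Y E vs assume "ps = us @ (Y, E) # vs"
    then show "\<phi> (op_prod ((Xs @ [X]) @ map fst us @ E # map fst vs)) = 0"
      using Cons.prems(6)[of "p # us" Y E vs] by (simp add: p)
  qed (use Cons.prems mem ps in auto)
  also have "\<dots> \<le> ?c * \<alpha> * ?e"
    using mem c e by (auto intro!: mult_right_mono mult_left_mono)
  finally have 1: "cmod (\<phi> (op_prod (Xs @ X # ?f)) - \<phi> (op_prod (Xs @ X # map fst ps))) \<le> ?c * \<alpha> * ?e" by simp
  \<comment> \<open>Once \<open>D\<close> is chosen, the word with main terms elsewhere is zero, so
    a first-order estimate of the rest already gives a second-order one.\<close>
  have "cmod (\<phi> (op_prod ((Xs @ [D]) @ ?f)) - \<phi> (op_prod ((Xs @ [D]) @ map fst ps)))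
      \<le> prod_list (map (pnorm m) (Xs @ [D])) * ((\<alpha> + \<delta>) ^ ?n - \<alpha> ^ ?n)"
    by (rule phi_expand_diff_le) (use Cons.prems mem ps in auto)
  also have "\<dots> \<le> ?c * \<delta> * ((\<alpha> + \<delta>) ^ ?n - \<alpha> ^ ?n)"
    using mem c d by (auto intro!: mult_right_mono mult_left_mono)
  finally have 2: "cmod (\<phi> (op_prod (Xs @ D # ?f))) \<le> ?c * \<delta> * ((\<alpha> + \<delta>) ^ ?n - \<alpha> ^ ?n)"
    using Cons.prems(6)[of "[]" X D ps] by (simp add: p)
  have "\<phi> (op_prod (Xs @ pair_sums (p # ps))) = \<phi> (op_prod (Xs @ X # ?f)) + \<phi> (op_prod (Xs @ D # ?f))"
    using phi_op_prod_add[OF Cons.prems(1) mem(1,2) pair_sums_mem[OF ps]] by (simp add: p)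
  then have "\<phi> (op_prod (Xs @ pair_sums (p # ps))) - \<phi> (op_prod (Xs @ map fst (p # ps)))
      = (\<phi> (op_prod (Xs @ X # ?f)) - \<phi> (op_prod (Xs @ X # map fst ps))) + \<phi> (op_prod (Xs @ D # ?f))"
    by (simp add: p)
  then have "cmod (\<phi> (op_prod (Xs @ pair_sums (p # ps))) - \<phi> (op_prod (Xs @ map fst (p # ps))))
      \<le> ?c * \<alpha> * ?e + ?c * \<delta> * ((\<alpha> + \<delta>) ^ ?n - \<alpha> ^ ?n)"
    using norm_triangle_le[OF add_mono[OF 1 2]] by (simp only:)
  also have "\<dots> = ?c * ((\<alpha> + \<delta>) ^ length (p # ps) - \<alpha> ^ length (p # ps) - length (p # ps) * \<alpha> ^ (length (p # ps) - 1) * \<delta>)"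
    by (cases ?n) (auto simp: algebra_simps)
  finally show ?case .
qed simp

end

section \<open>Circular Brownian motion and moment bounds\<close>

text \<open>The remainder constant is uniform for \<open>u\<close> up to \<open>U\<close>, so that
  in \<open>pnorm_step\<close> it depends on \<open>T\<close> but not on the cell.\<close>

lemma power_second_order_le:
  fixes u U :: real
  assumes "0 \<le> u" "u \<le> U"
  shows "(1 + u) ^ n \<le> 1 + real n * u + (real n)\<^sup>2 * (1 + U) ^ n * u\<^sup>2"
proof (induction n)
  case (Suc n)
  have "(1 + u) ^ Suc n \<le> (1 + u) * (1 + real n * u + (real n)\<^sup>2 * (1 + U) ^ n * u\<^sup>2)"
    using Suc assms by (simp add: mult_left_mono)
  also have "\<dots> = 1 + real (Suc n) * u + real n * u\<^sup>2 + (real n)\<^sup>2 * ((1 + u) * (1 + U) ^ n) * u\<^sup>2"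
    by (simp add: algebra_simps power2_eq_square)
  also have "\<dots> \<le> 1 + real (Suc n) * u + real n * (1 + U) ^ Suc n * u\<^sup>2 + (real n)\<^sup>2 * (1 + U) ^ Suc n * u\<^sup>2"
  proof (intro add_mono order_refl mult_right_mono mult_left_mono)
    have "1 \<le> (1 + U) ^ Suc n" using assms by (intro one_le_power) auto
    then have "real n * 1 \<le> real n * (1 + U) ^ Suc n" by (intro mult_left_mono) auto
    then show "real n \<le> real n * (1 + U) ^ Suc n" by simp
    show "(1 + u) * (1 + U) ^ n \<le> (1 + U) ^ Suc n" using assms by (simp add: mult_right_mono)
  qed auto
  also have "\<dots> = 1 + real (Suc n) * u + (real n + (real n)\<^sup>2) * ((1 + U) ^ Suc n * u\<^sup>2)"
    by (simp add: algebra_simps)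
  also have "\<dots> \<le> 1 + real (Suc n) * u + (real (Suc n))\<^sup>2 * ((1 + U) ^ Suc n * u\<^sup>2)"
  proof (intro add_mono order_refl mult_right_mono)
    show "real n + (real n)\<^sup>2 \<le> (real (Suc n))\<^sup>2" by (simp add: power2_eq_square algebra_simps)
    show "0 \<le> (1 + U) ^ Suc n * u\<^sup>2" using assms by simp
  qed
  finally show ?case by (simp add: mult.assoc)
qed simp

text \<open>Only the first \<open>j\<close> cells of the grid enter, so that \<open>j\<close> can
  drive a recursion. The grid may repeat points, which covers a partition cut off at a time
  \<open>t\<close>.\<close>

definition path_product :: "(real \<Rightarrow> ('h::complex_hilbert_space \<Rightarrow>\<^sub>L 'h)) \<Rightarrow> real list \<Rightarrow> nat \<Rightarrow> ('h \<Rightarrow>\<^sub>L 'h)" where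
  "path_product w Q j = op_prod (map (\<lambda>i. id_blinfun + (w (Q ! Suc i) - w (Q ! i))) [0..<j])"

lemma path_product_0 [simp]: "path_product w Q 0 = id_blinfun"
  by (simp add: path_product_def)

lemma path_product_Suc:
  "path_product w Q (Suc j) = path_product w Q j o\<^sub>L (id_blinfun + (w (Q ! Suc j) - w (Q ! j)))"
  by (simp add: path_product_def op_prod_append)

locale circular_bm = wstar_probability_space A \<phi>
  for A :: "('h::complex_hilbert_space \<Rightarrow>\<^sub>L 'h) set" and \<phi> +
  fixes w :: "real \<Rightarrow> ('h \<Rightarrow>\<^sub>L 'h)"
  assumes circular: "circular_brownian_motion A \<phi> w"
begin

lemma w_image_subset: "w ` {0..s} \<subseteq> A"
  using circular_brownian_mem[OF circular] by auto

sublocale F: star_algebra "filtration w s" for s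
  unfolding filtration_def
  by (rule star_algebra.intro, rule unital_star_algebra_vN_gen, rule w_image_subset)

lemma filtration_subset: "a \<in> filtration w s \<Longrightarrow> a \<in> A"
  using vN_gen_subset[OF w_image_subset[of s]] by (auto simp: filtration_def)

lemma filtration_mono: "a \<in> filtration w s \<Longrightarrow> s \<le> t \<Longrightarrow> a \<in> filtration w t"
  using vN_gen_mono[of "w ` {0..s}" "w ` {0..t}"] by (force simp: filtration_def)

lemma increment_mem_filtration: "0 \<le> s \<Longrightarrow> s \<le> t \<Longrightarrow> w t - w s \<in> filtration w t"
  using vN_gen_superset[of "w ` {0..t}"] by (intro F.diff_mem) (auto simp: filtration_def)

lemma increment_mem: "0 \<le> s \<Longrightarrow> s \<le> t \<Longrightarrow> w t - w s \<in> A"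
  using increment_mem_filtration filtration_subset by blast

lemma increment_orthogonal:
  assumes "0 \<le> s" "s \<le> t" "a \<in> filtration w s"
  shows "\<phi> ((w t - w s) o\<^sub>L a) = 0" and "\<phi> (adj (w t - w s) o\<^sub>L a) = 0"
proof -
  have *: "\<phi> ((w t - w s) o\<^sub>L a) = 0" if "a \<in> filtration w s" for a
    using circular_brownian_increment_orthogonal[OF circular] assms that by blast
  show "\<phi> ((w t - w s) o\<^sub>L a) = 0" by (rule * [OF assms(3)])
  have a: "a \<in> A" "adj a \<in> A" and D: "w t - w s \<in> A"
    using assms filtration_subset[of a s] by (auto simp: increment_mem A.adj_mem)
  have "adj (w t - w s) o\<^sub>L a = adj (adj a o\<^sub>L (w t - w s))"
    using a D by (simp add: adj_compose A.lin adj_adj)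
  also have "\<phi> \<dots> = cnj (\<phi> (adj a o\<^sub>L (w t - w s)))" using a D by (intro phi_adj A.compose_mem)
  also have "\<phi> (adj a o\<^sub>L (w t - w s)) = \<phi> ((w t - w s) o\<^sub>L adj a)" by (rule tracial[OF a(2) D])
  also have "\<dots> = 0" using assms by (intro * F.adj_mem)
  finally show "\<phi> (adj (w t - w s) o\<^sub>L a) = 0" by simp
qed

text \<open>The factor \<open>2 * sqrt (t - s)\<close> is the operator norm of the increment,
  extracted from its moments; the adjoint moves the increment to the left.\<close>

lemma free_brownian_increment_bound:
  assumes x: "free_brownian_motion A \<phi> x" and st: "0 \<le> s" "s < t" and a: "a \<in> A"
  shows "pnorm m (a o\<^sub>L (x t - x s)) \<le> 2 * sqrt (t - s) * pnorm m a"
proof -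
  let ?D = "x t - x s"
  have D: "?D \<in> A" and sc: "semicircular \<phi> 0 (t - s) ?D"
    using x st by (auto simp: free_brownian_motion_def intro!: A.diff_mem)
  then have adj: "adj ?D = ?D" by (simp add: semicircular_def)
  have "pnorm m (a o\<^sub>L ?D) = pnorm m (?D o\<^sub>L adj a)"
    using pnorm_adj[of "a o\<^sub>L ?D" m] a D adj by (simp add: A.compose_mem adj_compose A.lin)
  also have "\<dots> \<le> 2 * sqrt (t - s) * pnorm m (adj a)"
    using a st by (intro pnorm_compose_bounded D adj A.adj_mem semicircular_moment_bound[OF sc]) auto
  finally show ?thesis using a by (simp add: pnorm_adj)
qed

text \<open>Two parts of size \<open>2 * sqrt (t - s)\<close> divided by \<open>sqrt 2\<close>: the
  triangle inequality gives \<open>4 / sqrt 2 = sqrt 8\<close>.\<close>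

lemma increment_bound:
  assumes st: "0 \<le> s" "s \<le> t" and a: "a \<in> A"
  shows "pnorm m (a o\<^sub>L (w t - w s)) \<le> sqrt (8 * (t - s)) * pnorm m a"
proof (cases "s = t")
  case False
  then have lt: "s < t" using st by simp
  obtain x y where x: "free_brownian_motion A \<phi> x" and y: "free_brownian_motion A \<phi> y"
    and weq: "\<And>t. t \<ge> 0 \<Longrightarrow> w t = scale_op (1 / complex_of_real (sqrt 2)) (x t + scale_op \<i> (y t))"
    using circular unfolding circular_brownian_motion_def by blast
  let ?c = "1 / complex_of_real (sqrt 2)" and ?X = "a o\<^sub>L (x t - x s)" and ?Y = "a o\<^sub>L (y t - y s)"
  have mem: "x t - x s \<in> A" "y t - y s \<in> A"
    using x y st by (auto simp: free_brownian_motion_def intro!: A.diff_mem)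
  then have XY: "?X \<in> A" "?Y \<in> A" using a by (auto intro: A.compose_mem)
  have "w t - w s = scale_op ?c ((x t - x s) + scale_op \<i> (y t - y s))"
    using st by (simp add: weq scale_op_diff scale_op_add_right algebra_simps)
  then have "a o\<^sub>L (w t - w s) = scale_op ?c (?X + scale_op \<i> ?Y)"
    using a by (simp add: compose_scale_right compose_add_right A.lin)
  then have "pnorm m (a o\<^sub>L (w t - w s)) = (1 / sqrt 2) * pnorm m (?X + scale_op \<i> ?Y)"
    using XY by (simp add: pnorm_scale A.add_mem A.scale_mem norm_divide)
  also have "\<dots> \<le> (1 / sqrt 2) * (pnorm m ?X + pnorm m ?Y)"
    using pnorm_triangle[of ?X "scale_op \<i> ?Y" m] XY
    by (intro mult_left_mono) (auto simp: pnorm_scale A.scale_mem)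
  also have "\<dots> \<le> (1 / sqrt 2) * (2 * sqrt (t - s) * pnorm m a + 2 * sqrt (t - s) * pnorm m a)"
    by (intro mult_left_mono add_mono free_brownian_increment_bound x y st(1) lt a) simp
  also have "\<dots> = sqrt (8 * (t - s)) * pnorm m a"
  proof -
    have "sqrt (8 * (t - s)) = 2 * sqrt 2 * sqrt (t - s)"
      using real_sqrt_mult[of 4 2] real_sqrt_mult[of 8 "t - s"] by simp
    then show ?thesis by (simp add: field_simps)
  qed
  finally show ?thesis .
qed simp

text \<open>Expand \<open>\<parallel>B (1 + \<Delta>)\<parallel>\<^sub>p\<^sup>p\<close>: the terms of first order in \<open>\<Delta>\<close> vanish, the others are \<open>O(t - s)\<close>.\<close>

lemma pnorm_step:
  assumes st: "0 \<le> s" "s \<le> t" "t \<le> T" and B: "B \<in> filtration w s" and n: "n = 2 ^ Suc m"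
  shows "pnorm m (B o\<^sub>L (id_blinfun + (w t - w s))) ^ n
    \<le> (1 + 8 * (real n)\<^sup>2 * (1 + sqrt (8 * T)) ^ n * (t - s)) * pnorm m B ^ n"
proof -
  let ?D = "w t - w s" and ?q = "2 ^ m :: nat"
  define \<alpha> where "\<alpha> = pnorm m B"
  define u where "u = sqrt (8 * (t - s))"
  have D: "?D \<in> A" using st by (intro increment_mem)
  have BA: "B \<in> A" using B by (rule filtration_subset)
  have BD: "B o\<^sub>L ?D \<in> A" using BA D by (rule A.compose_mem)
  have \<alpha>: "0 \<le> \<alpha>" using BA by (simp add: \<alpha>_def)
  have u: "0 \<le> u" "u \<le> sqrt (8 * T)" "u\<^sup>2 = 8 * (t - s)" using st by (auto simp: u_def)
  \<comment> \<open>Factors alternate between the adjoint and the element itself; the main term is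
    \<open>B\<close> and the perturbation is \<open>B\<close> times the increment.\<close>
  let ?ps = "concat (replicate ?q [(adj B, adj (B o\<^sub>L ?D)), (B, B o\<^sub>L ?D)])"
  have len: "length ?ps = n" 
  proof -
    have "length (concat (replicate k [(adj B, adj (B o\<^sub>L ?D)), (B, B o\<^sub>L ?D)])) = k * 2" for k
      by (induction k) auto
    then show ?thesis by (simp add: n)
  qed
  have sum: "op_prod ([] @ pair_sums ?ps)
      = op_power ?q (adj (B o\<^sub>L (id_blinfun + ?D)) o\<^sub>L (B o\<^sub>L (id_blinfun + ?D)))"
  proof -
    have "pair_sums ?ps = concat (replicate ?q [adj B + adj (B o\<^sub>L ?D), B + (B o\<^sub>L ?D)])"
      by (simp add: map_concat)
    then show ?thesis using BA BD
      by (simp add: op_prod_concat_replicate compose_add_right adj_add A.lin del: map_concat)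
  qed
  have fst: "op_prod ([] @ map fst ?ps) = op_power ?q (adj B o\<^sub>L B)"
  proof -
    have "map fst ?ps = concat (replicate ?q [adj B, B])" by (simp add: map_concat)
    then show ?thesis by (simp add: op_prod_concat_replicate del: map_concat)
  qed
  \<comment> \<open>By traciality the single perturbation moves to the front, where the increment or
    its adjoint meets an element of the past.\<close>
  have vanish: "\<phi> (op_prod ([] @ map fst us @ E # map fst vs)) = 0" if split: "?ps = us @ (X, E) # vs" for us X E vs
  proof -
    have "set ?ps \<subseteq> {(adj B, adj (B o\<^sub>L ?D)), (B, B o\<^sub>L ?D)}" by auto
    then have sub: "set us \<union> {(X, E)} \<union> set vs \<subseteq> {(adj B, adj (B o\<^sub>L ?D)), (B, B o\<^sub>L ?D)}"
      unfolding split by auto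
    then have E: "E = adj (B o\<^sub>L ?D) \<or> E = B o\<^sub>L ?D" by auto
    have "set (map fst us) \<subseteq> {adj B, B}" "set (map fst vs) \<subseteq> {adj B, B}" using sub by force+
    moreover have "{adj B, B} \<subseteq> filtration w s" using B by (auto intro: F.adj_mem)
    ultimately have mem: "set (map fst us) \<subseteq> filtration w s" "set (map fst vs) \<subseteq> filtration w s"
      by blast+
    define U where "U = op_prod (map fst us)"
    define V where "V = op_prod (map fst vs)"
    have UV: "V o\<^sub>L U \<in> filtration w s" unfolding U_def V_def by (intro F.compose_mem F.op_prod_mem mem)
    have UVA: "U \<in> A" "V \<in> A" unfolding U_def V_def by (auto intro!: filtration_subset F.op_prod_mem[OF mem(1)] F.op_prod_mem[OF mem(2)])
    have EA: "E \<in> A" using E BD by (auto intro: A.adj_mem)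
    have "op_prod ([] @ map fst us @ E # map fst vs) = U o\<^sub>L (E o\<^sub>L V)"
      by (simp add: U_def V_def op_prod_append)
    also have "\<phi> \<dots> = \<phi> (E o\<^sub>L (V o\<^sub>L U))"
      using tracial[of U "E o\<^sub>L V"] UVA EA by (simp add: A.compose_mem compose_assoc)
    also have "\<dots> = 0" using E
    proof
      assume E: "E = B o\<^sub>L ?D"
      have "\<phi> (E o\<^sub>L (V o\<^sub>L U)) = \<phi> (?D o\<^sub>L ((V o\<^sub>L U) o\<^sub>L B))"
        using tracial[of B "?D o\<^sub>L (V o\<^sub>L U)"] BA D UVA by (simp add: E A.compose_mem compose_assoc)
      also have "\<dots> = 0" using st F.compose_mem[OF UV B] by (intro increment_orthogonal)
      finally show ?thesis .
    next
      assume E: "E = adj (B o\<^sub>L ?D)"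
      have "\<phi> (E o\<^sub>L (V o\<^sub>L U)) = \<phi> (adj ?D o\<^sub>L (adj B o\<^sub>L (V o\<^sub>L U)))"
        using BA D by (simp add: E adj_compose A.lin compose_assoc)
      also have "\<dots> = 0" using st F.compose_mem[OF F.adj_mem[OF B] UV] by (intro increment_orthogonal)
      finally show ?thesis .
    qed
    finally show ?thesis .
  qed
  \<comment> \<open>The perturbation is measured relative to \<open>\<alpha>\<close>, so that
    \<open>\<alpha> ^ n\<close> factors out of the whole bound.\<close>
  have "pnorm m (B o\<^sub>L ?D) \<le> u * \<alpha>" unfolding u_def \<alpha>_def using st BA by (intro increment_bound)
  then have "cmod (\<phi> (op_prod ([] @ pair_sums ?ps)) - \<phi> (op_prod ([] @ map fst ?ps)))
      \<le> prod_list (map (pnorm m) []) * ((\<alpha> + u * \<alpha>) ^ length ?ps - \<alpha> ^ length ?ps - length ?ps * \<alpha> ^ (length ?ps - 1) * (u * \<alpha>))"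
    using BA BD \<alpha> u len n by (intro phi_expand_second_order_le vanish) (auto simp: A.adj_mem pnorm_adj bounded_pairs_def \<alpha>_def[symmetric])
  also have "\<dots> = ((1 + u) ^ n - 1 - real n * u) * \<alpha> ^ n"
  proof -
    have "(\<alpha> + u * \<alpha>) ^ n = (1 + u) ^ n * \<alpha> ^ n"
      by (simp add: algebra_simps flip: power_mult_distrib)
    moreover have "\<alpha> ^ (n - 1) * \<alpha> = \<alpha> ^ n" using power_minus_mult[of n \<alpha>] n by simp
    ultimately show ?thesis unfolding len by (simp add: algebra_simps)
  qed
  also have "\<dots> \<le> ((real n)\<^sup>2 * (1 + sqrt (8 * T)) ^ n * u\<^sup>2) * \<alpha> ^ n"
    using power_second_order_le[OF u(1,2), of n] \<alpha> by (intro mult_right_mono) auto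
  finally have "cmod (\<phi> (op_power ?q (adj (B o\<^sub>L (id_blinfun + ?D)) o\<^sub>L (B o\<^sub>L (id_blinfun + ?D))))
      - \<phi> (op_power ?q (adj B o\<^sub>L B))) \<le> ((real n)\<^sup>2 * (1 + sqrt (8 * T)) ^ n * u\<^sup>2) * \<alpha> ^ n"
    unfolding sum fst .
  moreover have "B o\<^sub>L (id_blinfun + ?D) \<in> A" using BA D by (intro A.compose_mem A.add_mem A.id_mem)
  ultimately have "cmod (complex_of_real (pnorm m (B o\<^sub>L (id_blinfun + ?D)) ^ n) - complex_of_real (\<alpha> ^ n))
      \<le> ((real n)\<^sup>2 * (1 + sqrt (8 * T)) ^ n * u\<^sup>2) * \<alpha> ^ n"
    using BA by (simp only: pnorm_power n \<alpha>_def)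
  then have "\<bar>pnorm m (B o\<^sub>L (id_blinfun + ?D)) ^ n - \<alpha> ^ n\<bar> \<le> ((real n)\<^sup>2 * (1 + sqrt (8 * T)) ^ n * u\<^sup>2) * \<alpha> ^ n"
    by (simp only: norm_of_real flip: of_real_diff)
  then show ?thesis unfolding u(3) \<alpha>_def[symmetric] by (simp add: algebra_simps abs_le_iff)
qed

lemma path_product_mem_filtration:
  assumes "sorted Q" "\<And>q. q \<in> set Q \<Longrightarrow> 0 \<le> q"
  shows "j < length Q \<Longrightarrow> path_product w Q j \<in> filtration w (Q ! j)"
proof (induction j)
  case (Suc j)
  have le: "0 \<le> Q ! j" "Q ! j \<le> Q ! Suc j"
    using assms Suc.prems by (auto simp: sorted_iff_nth_mono)
  then show ?case unfolding path_product_Suc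
    using Suc by (intro F.compose_mem F.add_mem F.id_mem increment_mem_filtration)
      (auto intro: filtration_mono)
qed simp

text \<open>Each step multiplies the \<open>n\<close>-th power by at most \<open>1 + C * h\<close>,
  hence by at most \<open>exp (C * h)\<close>, and the lengths \<open>h\<close> add up to at most
  \<open>T\<close>. As \<open>C\<close> depends on \<open>m\<close> and \<open>T\<close> alone, the
  bound is uniform over all grids.\<close>

lemma path_product_moment_bound:
  "\<exists>M. \<forall>Q j. sorted Q \<longrightarrow> set Q \<subseteq> {0..T} \<longrightarrow> j < length Q \<longrightarrow> pnorm m (path_product w Q j) \<le> M"
proof (cases "0 \<le> T")
  case True
  define n :: nat where "n = 2 ^ Suc m"
  define C where "C = 8 * (real n)\<^sup>2 * (1 + sqrt (8 * T)) ^ n"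
  have C: "0 \<le> C" using True by (simp add: C_def)
  have "pnorm m (path_product w Q j) \<le> exp (C * T)"
    if Q: "sorted Q" "set Q \<subseteq> {0..T}" "j < length Q" for Q j
  proof -
    have memF: "path_product w Q i \<in> filtration w (Q ! i)" if "i < length Q" for i
      using Q that by (intro path_product_mem_filtration) auto
    have range: "0 \<le> Q ! i" "Q ! i \<le> T" if "i < length Q" for i
      using Q(2) nth_mem[OF that] by auto
    have "pnorm m (path_product w Q j) ^ n \<le> exp (C * (Q ! j - Q ! 0))"
      using Q(3)
    proof (induction j)
      case (Suc j)
      have le: "0 \<le> Q ! j" "Q ! j \<le> Q ! Suc j" "Q ! Suc j \<le> T"
        using Q Suc.prems range by (auto simp: sorted_iff_nth_mono)
      have "pnorm m (path_product w Q (Suc j)) ^ n \<le> (1 + C * (Q ! Suc j - Q ! j)) * pnorm m (path_product w Q j) ^ n"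
        unfolding path_product_Suc C_def using Suc.prems le memF[of j] by (intro pnorm_step n_def) auto
      also have "\<dots> \<le> exp (C * (Q ! Suc j - Q ! j)) * exp (C * (Q ! j - Q ! 0))"
        using Suc le C filtration_subset[OF memF[of j]]
        by (intro mult_mono exp_ge_add_one_self) auto
      also have "\<dots> = exp (C * (Q ! Suc j - Q ! 0))" by (simp add: algebra_simps flip: exp_add)
      finally show ?case .
    qed simp
    also have "\<dots> \<le> exp (C * T)"
    proof -
      have "0 < length Q" using Q(3) by linarith
      then have "Q ! j - Q ! 0 \<le> T" using range[of 0] range[OF Q(3)] by linarith
      then show ?thesis using C by (simp add: mult_left_mono)
    qed
    \<comment> \<open>\<open>exp (C * T)\<close> is at least 1; raising it to the
      \<open>n\<close>-th power lets the root be taken on both sides.\<close>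
    also have "\<dots> \<le> exp (C * T) ^ n"
      using C True by (intro self_le_power) (auto simp: n_def)
    finally have "pnorm m (path_product w Q j) ^ Suc (n - 1) \<le> exp (C * T) ^ Suc (n - 1)"
      by (simp add: n_def del: power_Suc)
    then show ?thesis by (rule power_le_imp_le_base) simp
  qed
  then show ?thesis by blast
next
  case False
  have "\<not> j < length Q" if "set Q \<subseteq> {0..T}" for Q :: "real list" and j
    using nth_mem[of j Q] that False by auto
  then show ?thesis by blast
qed

end

section \<open>Step integrals on refined grids\<close>

text \<open>Grids are nondecreasing lists; repeated points contribute nothing. This allows both truncation at a
  time \<open>t\<close> and merging of two grids.\<close>

fun grid_integral :: "(real \<Rightarrow> ('h::complex_hilbert_space \<Rightarrow>\<^sub>L 'h)) \<Rightarrow> (real \<Rightarrow> ('h \<Rightarrow>\<^sub>L 'h)) \<Rightarrow> real list \<Rightarrow> ('h \<Rightarrow>\<^sub>L 'h)" where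
  "grid_integral w u (p # q # R) = (u p o\<^sub>L (w q - w p)) + grid_integral w u (q # R)"
| "grid_integral w u _ = 0"

fun grid_sum :: "(real \<Rightarrow> real) \<Rightarrow> real list \<Rightarrow> real" where
  "grid_sum f (p # q # R) = (q - p) * f p + grid_sum f (q # R)"
| "grid_sum f _ = 0"

fun const_on_grid :: "(real \<Rightarrow> 'a) \<Rightarrow> real list \<Rightarrow> bool" where
  "const_on_grid f (p # q # R) \<longleftrightarrow> (\<forall>s\<in>{p..<q}. f s = f p) \<and> const_on_grid f (q # R)"
| "const_on_grid f _ \<longleftrightarrow> True"


lemma const_on_grid_iff:
  "const_on_grid f R \<longleftrightarrow> (\<forall>j. Suc j < length R \<longrightarrow> (\<forall>s\<in>{R ! j..<R ! Suc j}. f s = f (R ! j)))"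
proof (induction f R rule: const_on_grid.induct)
  case (1 f p q R)
  have split: "(\<forall>j. P j) \<longleftrightarrow> P 0 \<and> (\<forall>j. P (Suc j))" for P :: "nat \<Rightarrow> bool"
    by (metis not0_implies_Suc)
  show ?case unfolding const_on_grid.simps 1 by (subst (2) split) simp
qed auto

lemma grid_integral_eq_sum:
  "grid_integral w u R = (\<Sum>j<length R - 1. u (R ! j) o\<^sub>L (w (R ! Suc j) - w (R ! j)))"
proof (induction w u R rule: grid_integral.induct)
  case (1 w u p q R)
  then show ?case by (simp add: sum.lessThan_Suc_shift del: sum.lessThan_Suc)
qed auto

lemma grid_sum_eq_sum: "grid_sum f R = (\<Sum>j<length R - 1. (R ! Suc j - R ! j) * f (R ! j))"
proof (induction f R rule: grid_sum.induct)
  case (1 f p q R)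
  then show ?case by (simp add: sum.lessThan_Suc_shift del: sum.lessThan_Suc)
qed auto

section \<open>Refining a grid\<close>

lemma const_on_grid_insort:
  "sorted R \<Longrightarrow> const_on_grid u R \<Longrightarrow> hd R \<le> r \<Longrightarrow> r \<le> last R \<Longrightarrow>
    const_on_grid u (insort r R)"
proof (induction u R rule: const_on_grid.induct)
  case (1 u p q R)
  have pq: "p \<le> q" and sorted: "sorted (q # R)" using 1(2) by auto
  have up: "u s = u p" if "s \<in> {p..<q}" for s
    using 1(3)[unfolded const_on_grid.simps] that by blast
  have rest: "const_on_grid u (q # R)" using 1(3)[unfolded const_on_grid.simps] by blast
  show ?case
  proof (cases "r \<le> q")
    case True
    show ?thesis
    proof (cases "r \<le> p")
      case rp: True
      then have "r = p" using 1(4) by simp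
      then have eq: "insort r (p # q # R) = p # p # q # R" by simp
      have "\<forall>s\<in>{p..<p}. u s = u p" by simp
      then show ?thesis unfolding eq const_on_grid.simps using rest up by blast
    next
      case False
      have 1: "u s = u r" if s: "s \<in> {r..<q}" for s
      proof -
        have "s \<in> {p..<q}" "r \<in> {p..<q}" using s False by auto
        then show ?thesis by (metis up)
      qed
      have 2: "u s = u p" if "s \<in> {p..<r}" for s using that True by (intro up) auto
      have eq: "insort r (p # q # R) = p # r # q # R" using False True by simp
      show ?thesis unfolding eq const_on_grid.simps using 1 2 rest by blast
    qed
  next
    case False
    then have eq: "insort r (p # q # R) = p # q # insort r R" using pq by auto
    have "insort r (q # R) = q # insort r R" using False by simp
    moreover have "const_on_grid u (insort r (q # R))" using 1(1)[OF sorted rest] 1(5) False by simp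
    ultimately have "const_on_grid u (q # insort r R)" by simp
    then show ?thesis unfolding eq const_on_grid.simps using up by blast
  qed
qed auto

lemma hd_insort: "sorted R \<Longrightarrow> R \<noteq> [] \<Longrightarrow> hd R \<le> r \<Longrightarrow> hd (insort r R) = (hd R :: real)"
  by (cases R) auto

lemma last_insort: "sorted R \<Longrightarrow> R \<noteq> [] \<Longrightarrow> r \<le> last R \<Longrightarrow> last (insort r R) = (last R :: real)"
  by (induction R) (auto split: if_splits)

lemma grid_integral_insort:
  "sorted R \<Longrightarrow> R \<noteq> [] \<Longrightarrow> hd R \<le> r \<Longrightarrow> r \<le> last R \<Longrightarrow> const_on_grid u R \<Longrightarrow>
    grid_integral w u (insort r R) = grid_integral w u R"
proof (induction w u R rule: grid_integral.induct)
  case (1 w u p q R)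
  have pq: "p \<le> q" and sorted: "sorted (q # R)" and hd: "p \<le> r" and last: "r \<le> last (q # R)"
    using 1(2,4,5) by auto
  have up: "u s = u p" if "s \<in> {p..<q}" for s
    using 1(6)[unfolded const_on_grid.simps] that by blast
  have rest: "const_on_grid u (q # R)" using 1(6)[unfolded const_on_grid.simps] by blast
  show ?case
  proof (cases "r \<le> q")
    case True
    have split: "(X o\<^sub>L (w r - w p)) + (X o\<^sub>L (w q - w r)) = X o\<^sub>L (w q - w p)" for X
      by (simp flip: compose_add_right)
    \<comment> \<open>If \<open>r\<close> is an endpoint, the new cell is degenerate and contributes
      zero; otherwise \<open>u\<close> has the same value at \<open>r\<close> as at
      \<open>p\<close>.\<close>
    consider "r = p" | "p < r" "r < q" | "p < r" "r = q" using hd True by force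
    then show ?thesis
    proof cases
      case 2
      then have "u r = u p" by (intro up) auto
      then show ?thesis using 2 by (simp add: split flip: add.assoc)
    qed auto
  next
    case False
    then have "insort r (p # q # R) = p # q # insort r R" using pq by auto
    moreover have "insort r (q # R) = q # insort r R" using False by simp
    moreover have "grid_integral w u (insort r (q # R)) = grid_integral w u (q # R)"
      using False last by (intro 1(1) sorted rest) auto
    ultimately show ?thesis by simp
  qed
next
  case ("2_2" w u p)
  then show ?case by auto
qed auto

lemma sorted_subset_hd_last: "sorted R \<Longrightarrow> set R \<subseteq> {hd R..last R :: real}"
proof (induction R)
  case (Cons p R)
  then show ?case by (cases "R = []") auto
qed simp

text \<open>The points of \<open>P\<close> are inserted into \<open>Q\<close> one at a time.
  Integrands on two different grids can thus be moved to one.\<close>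

lemma grid_integral_merge:
  assumes P: "sorted P" "P \<noteq> []" and Q: "sorted Q" "Q \<noteq> []" and eq: "hd P = hd Q" "last P = last Q"
    and u: "const_on_grid u Q"
  defines "S \<equiv> sort (P @ Q)"
  shows "const_on_grid u S" and "grid_integral w u S = grid_integral w u Q"
    and "sorted S" and "S \<noteq> []" and "hd S = hd Q" and "last S = last Q"
proof -
  have fold: "sorted (foldr insort Ps Q) \<and> foldr insort Ps Q \<noteq> [] \<and> hd (foldr insort Ps Q) = hd Q \<and>
      last (foldr insort Ps Q) = last Q \<and> const_on_grid u (foldr insort Ps Q) \<and>
      grid_integral w u (foldr insort Ps Q) = grid_integral w u Q"
    if "set Ps \<subseteq> {hd Q..last Q}" for Ps
    using that
  proof (induction Ps)
    case (Cons r Ps)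
    then have IH: "sorted (foldr insort Ps Q)" "foldr insort Ps Q \<noteq> []" "hd (foldr insort Ps Q) = hd Q"
      "last (foldr insort Ps Q) = last Q" "const_on_grid u (foldr insort Ps Q)"
      "grid_integral w u (foldr insort Ps Q) = grid_integral w u Q" by auto
    have r: "hd Q \<le> r" "r \<le> last Q" using Cons.prems by auto
    show ?case
      using IH r by (simp add: sorted_insort hd_insort last_insort const_on_grid_insort grid_integral_insort)
  qed (use Q u in auto)
  have "S = foldr insort P Q"
    using sorted_sort_id[OF Q(1)] by (simp add: S_def sort_key_def)
  then show "const_on_grid u S" "grid_integral w u S = grid_integral w u Q" "sorted S" "S \<noteq> []" "hd S = hd Q" "last S = last Q"
    using fold[of P] sorted_subset_hd_last[OF P(1)] eq by auto
qed

lemma grid_sum_has_integral: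
  "sorted R \<Longrightarrow> R \<noteq> [] \<Longrightarrow> const_on_grid f R \<Longrightarrow> (f has_integral grid_sum f R) {hd R..last R}"
proof (induction f R rule: grid_sum.induct)
  case (1 f p q R)
  have le: "p \<le> q" "q \<le> last (q # R)" and sorted: "sorted (q # R)" using 1(2) by auto
  have up: "f s = f p" if "s \<in> {p..<q}" for s
    using 1(4)[unfolded const_on_grid.simps] that by blast
  have rest: "const_on_grid f (q # R)" using 1(4)[unfolded const_on_grid.simps] by blast
  have "((\<lambda>s. f p) has_integral (q - p) * f p) {p..q}"
    using has_integral_const_real[of "f p" p q] le by simp
  \<comment> \<open>Cells are half-open, so nothing is known of \<open>f\<close> at
    \<open>q\<close>; a single point does not affect the integral.\<close>
  then have "(f has_integral (q - p) * f p) {p..q}"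
    by (rule has_integral_spike_finite[of "{q}", rotated 2]) (auto intro!: up)
  moreover have "(f has_integral grid_sum f (q # R)) {q..last (q # R)}"
    using 1(1)[OF sorted _ rest] by simp
  ultimately have "(f has_integral (q - p) * f p + grid_sum f (q # R)) {p..last (q # R)}"
    by (rule has_integral_combine[OF le])
  then show ?case by simp
qed (auto simp: has_integral_refl)

text \<open>\<open>step_process\<close> for values in any real vector space; the error estimate also
  needs a real-valued step function.\<close>

definition step_function :: "real list \<Rightarrow> (nat \<Rightarrow> 'a::real_vector) \<Rightarrow> real \<Rightarrow> 'a" where
  "step_function P c s = (\<Sum>j<length P - 1. indicator {P ! j..<P ! Suc j} s *\<^sub>R c j)"

lemma step_process_eq_step_function: "step_process = step_function"
  by (simp add: fun_eq_iff step_process_def step_function_def)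

lemma step_function_eq:
  fixes c :: "nat \<Rightarrow> 'a::real_vector"
  assumes "sorted P" "Suc i < length P" "s \<in> {P ! i..<P ! Suc i}"
  shows "step_function P c s = c i"
proof -
  have "indicator {P ! j..<P ! Suc j} s *\<^sub>R c j = (if j = i then c i else 0)" if "j < length P - 1" for j
  proof -
    consider "j < i" | "i < j" | "i = j" by linarith
    then show ?thesis
    proof cases
      case 1
      then have "P ! Suc j \<le> P ! i" using assms by (intro sorted_nth_mono) auto
      then show ?thesis using 1 assms(3) by (auto simp: indicator_def)
    next
      case 2
      then have "P ! Suc i \<le> P ! j" using assms that by (intro sorted_nth_mono) auto
      then show ?thesis using 2 assms(3) by (auto simp: indicator_def)
    qed (use assms in auto)
  qed
  then have "step_function P c s = (\<Sum>j<length P - 1. if j = i then c i else 0)"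
    unfolding step_function_def by (intro sum.cong) auto
  also have "\<dots> = c i"
  proof -
    have "i < length P - 1" using assms(2) by simp
    then show ?thesis by (simp add: sum.delta)
  qed
  finally show ?thesis .
qed

lemma const_on_grid_step_function:
  assumes "sorted P"
  shows "const_on_grid (step_function P c) P"
  unfolding const_on_grid_iff
proof (intro allI impI ballI)
  fix i s assume i: "Suc i < length P" and s: "s \<in> {P ! i..<P ! Suc i}"
  then have s': "P ! i \<in> {P ! i..<P ! Suc i}" by auto
  show "step_function P c s = step_function P c (P ! i)"
    using step_function_eq[OF assms i s, of c] step_function_eq[OF assms i s', of c] by (simp only:)
qed

lemmas step_process_eq = step_function_eq[where c = c for c :: "nat \<Rightarrow> ('h::complex_hilbert_space \<Rightarrow>\<^sub>L 'h)",
  folded step_process_eq_step_function]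

lemma const_on_grid_step_process: "sorted P \<Longrightarrow> const_on_grid (step_process P c) P"
  unfolding step_process_eq_step_function by (rule const_on_grid_step_function)

lemma step_process_outside: "\<forall>j. Suc j < length P \<longrightarrow> s \<notin> {P ! j..<P ! Suc j} \<Longrightarrow> step_process P c s = 0"
  unfolding step_process_def by (rule sum.neutral) (auto simp: indicator_def)

lemma step_integral_eq_grid_integral:
  assumes "sorted P"
  shows "step_integral w P c = grid_integral w (step_process P c) P"
  unfolding step_integral_def grid_integral_eq_sum
proof (rule sum.cong)
  fix j assume "j \<in> {..<length P - 1}"
  then have j: "Suc j < length P" by auto
  then have "P ! j \<le> P ! Suc j" using assms by (intro sorted_nth_mono) auto
  \<comment> \<open>On an empty cell \<open>step_process\<close> need not take the value
    \<open>c j\<close>, but there the increment of \<open>w\<close> is zero.\<close>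
  then consider "P ! j = P ! Suc j" | "P ! j \<in> {P ! j..<P ! Suc j}" by fastforce
  then show "c j o\<^sub>L (w (P ! Suc j) - w (P ! j)) = step_process P c (P ! j) o\<^sub>L (w (P ! Suc j) - w (P ! j))"
  proof cases
    case 2
    from step_process_eq[OF assms j this, of c] show ?thesis by simp
  qed simp
qed simp

lemma grid_integral_diff:
  "grid_integral w (\<lambda>s. u s - v s) R = grid_integral w u R - grid_integral w v R"
  by (simp add: grid_integral_eq_sum compose_diff_left sum_subtractf)

lemma const_on_grid_combine:
  "const_on_grid u R \<Longrightarrow> const_on_grid v R \<Longrightarrow> const_on_grid (\<lambda>s. f (u s) (v s)) R"
  unfolding const_on_grid_iff by metis

text \<open>\<open>path_product\<close> is the Euler scheme for the equation: its increment over a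
  cell is its value at the left endpoint times the increment of \<open>w\<close>, and the sum
  telescopes. Taking \<open>Suc n\<close> points leaves \<open>n\<close> cells.\<close>

lemma step_integral_path_product:
  "n < length Q \<Longrightarrow> step_integral w (take (Suc n) Q) (path_product w Q) = path_product w Q n - id_blinfun"
proof -
  assume n: "n < length Q"
  have "(\<Sum>j<k. path_product w Q j o\<^sub>L (w (Q ! Suc j) - w (Q ! j))) = path_product w Q k - id_blinfun" for k
    by (induction k) (simp_all add: path_product_Suc compose_add_right)
  then show ?thesis using n by (simp add: step_integral_def min_absorb2)
qed

lemma exists_grid_interval: "Q ! 0 \<le> (s::real) \<Longrightarrow> s < Q ! n \<Longrightarrow> \<exists>j<n. s \<in> {Q ! j..<Q ! Suc j}"
proof (induction n)
  case (Suc n)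
  then show ?case by (cases "s < Q ! n") (auto intro: less_SucI)
qed auto

lemma discrete_gronwall:
  fixes a h :: "nat \<Rightarrow> real"
  assumes \<alpha>: "0 \<le> \<alpha>" and \<beta>: "0 \<le> \<beta>" and h: "\<And>j. j < N \<Longrightarrow> 0 \<le> h j"
    and a: "\<And>n. n \<le> N \<Longrightarrow> a n \<le> \<alpha> + \<beta> * (\<Sum>j<n. h j * a j)"
  shows "n \<le> N \<Longrightarrow> a n \<le> \<alpha> * exp (\<beta> * (\<Sum>j<n. h j))"
proof -
  assume n: "n \<le> N"
  have "\<alpha> + \<beta> * (\<Sum>j<n. h j * a j) \<le> \<alpha> * exp (\<beta> * (\<Sum>j<n. h j))"
    using n
  proof (induction n)
    case (Suc n)
    \<comment> \<open>The induction runs on this upper bound for \<open>a n\<close> rather than on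
      \<open>a n\<close>, because the bound satisfies a one-step recursion.\<close>
    define S where "S = \<alpha> + \<beta> * (\<Sum>j<n. h j * a j)"
    have "\<alpha> + \<beta> * (\<Sum>j<Suc n. h j * a j) = S + \<beta> * h n * a n" by (simp add: S_def algebra_simps)
    also have "\<dots> \<le> S + \<beta> * h n * S"
      using a[of n] h[of n] \<beta> Suc.prems by (intro add_left_mono mult_left_mono) (auto simp: S_def)
    also have "\<dots> = (1 + \<beta> * h n) * S" by (simp add: algebra_simps)
    also have "\<dots> \<le> exp (\<beta> * h n) * (\<alpha> * exp (\<beta> * (\<Sum>j<n. h j)))"
    proof -
      have 1: "S \<le> \<alpha> * exp (\<beta> * (\<Sum>j<n. h j))" using Suc by (simp add: S_def)
      have 2: "0 \<le> 1 + \<beta> * h n" using h[of n] \<beta> Suc.prems by simp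
      have "(1 + \<beta> * h n) * S \<le> (1 + \<beta> * h n) * (\<alpha> * exp (\<beta> * (\<Sum>j<n. h j)))"
        using 1 2 by (rule mult_left_mono)
      also have "\<dots> \<le> exp (\<beta> * h n) * (\<alpha> * exp (\<beta> * (\<Sum>j<n. h j)))"
        using \<alpha> by (intro mult_right_mono exp_ge_add_one_self) auto
      finally show ?thesis .
    qed
    also have "\<dots> = \<alpha> * exp (\<beta> * (\<Sum>j<Suc n. h j))" by (simp add: algebra_simps flip: exp_add)
    finally show ?case .
  qed simp
  with a[OF n] show ?thesis by simp
qed

section \<open>Bounds in \<open>L^2\<close> for step integrals\<close>

context circular_bm
begin

lemma grid_integral_mem:
  "sorted R \<Longrightarrow> (\<And>r. r \<in> set R \<Longrightarrow> 0 \<le> r \<and> u r \<in> filtration w r) \<Longrightarrow> grid_integral w u R \<in> A"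
proof (induction R rule: induct_list012)
  case (3 p q R)
  have "u p \<in> A" using 3(4)[of p] filtration_subset by auto
  moreover have "w q - w p \<in> A" using 3(3) 3(4)[of p] by (intro increment_mem) auto
  moreover have "grid_integral w u (q # R) \<in> A" using 3 by auto
  ultimately show ?case by (simp add: A.add_mem A.compose_mem)
qed auto

lemma grid_integral_orthogonal:
  "sorted R \<Longrightarrow> (\<And>r. r \<in> set R \<Longrightarrow> 0 \<le> r \<and> u r \<in> filtration w r) \<Longrightarrow> a \<in> filtration w (hd R) \<Longrightarrow>
    \<phi> (a o\<^sub>L grid_integral w u R) = 0"
proof (induction R rule: induct_list012)
  case (3 p q R)
  have le: "0 \<le> p" "p \<le> q" using 3(3) 3(4)[of p] by auto
  have a: "a \<in> filtration w p" and up: "u p \<in> filtration w p" using 3(4)[of p] 3(5) by auto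
  then have "a o\<^sub>L u p \<in> filtration w p" by (rule F.compose_mem)
  then have "\<phi> ((w q - w p) o\<^sub>L (a o\<^sub>L u p)) = 0" using le by (intro increment_orthogonal)
  moreover have mem: "a \<in> A" "u p \<in> A" "w q - w p \<in> A"
    using a up filtration_subset le by (auto intro: increment_mem)
  ultimately have 1: "\<phi> (a o\<^sub>L (u p o\<^sub>L (w q - w p))) = 0"
    using tracial[of "a o\<^sub>L u p" "w q - w p"] by (simp add: A.compose_mem compose_assoc)
  have "grid_integral w u (q # R) \<in> A" using 3 by (intro grid_integral_mem) auto
  moreover have "\<phi> (a o\<^sub>L grid_integral w u (q # R)) = 0"
    using 3 le by (intro 3(2)) (auto intro: filtration_mono[OF a])
  ultimately show ?case using 1 mem by (simp add: compose_add_right phi_add A.compose_mem)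
qed auto

text \<open>An Ito-type inequality. The first term lies in the past of the remaining sum, so the
  mixed terms vanish and squared norms add; \<open>increment_bound\<close> supplies the 8.\<close>

lemma grid_integral_bound:
  "sorted R \<Longrightarrow> (\<And>r. r \<in> set R \<Longrightarrow> 0 \<le> r \<and> u r \<in> filtration w r) \<Longrightarrow>
    (pnorm 0 (grid_integral w u R))\<^sup>2 \<le> 8 * grid_sum (\<lambda>s. (pnorm 0 (u s))\<^sup>2) R"
proof (induction R rule: induct_list012)
  case (3 p q R)
  let ?X = "u p o\<^sub>L (w q - w p)" and ?Y = "grid_integral w u (q # R)"
  have le: "0 \<le> p" "p \<le> q" using 3(3) 3(4)[of p] by auto
  have up: "u p \<in> filtration w p" using 3(4)[of p] by auto
  have XF: "?X \<in> filtration w q"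
    using le by (intro F.compose_mem increment_mem_filtration filtration_mono[OF up])
  have upA: "u p \<in> A" using up by (rule filtration_subset)
  have XA: "?X \<in> A" using XF by (rule filtration_subset)
  have YA: "?Y \<in> A" using 3 by (intro grid_integral_mem) auto
  have XY: "\<phi> (adj ?X o\<^sub>L ?Y) = 0"
    using 3 XF by (intro grid_integral_orthogonal F.adj_mem) auto
  have "adj (adj ?X o\<^sub>L ?Y) = adj ?Y o\<^sub>L ?X" using XA YA by (simp add: adj_compose A.lin complex_linear_adj adj_adj)
  then have YX: "\<phi> (adj ?Y o\<^sub>L ?X) = 0"
    using phi_adj[of "adj ?X o\<^sub>L ?Y"] XA YA XY by (simp add: A.compose_mem A.adj_mem)
  have "adj (?X + ?Y) o\<^sub>L (?X + ?Y) = (adj ?X o\<^sub>L ?X) + (adj ?X o\<^sub>L ?Y) + ((adj ?Y o\<^sub>L ?X) + (adj ?Y o\<^sub>L ?Y))"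
    using XA YA by (simp add: adj_add A.lin compose_add_left compose_add_right add_ac)
  then have "\<phi> (adj (?X + ?Y) o\<^sub>L (?X + ?Y)) = \<phi> (adj ?X o\<^sub>L ?X) + \<phi> (adj ?Y o\<^sub>L ?Y)"
    using XA YA by (simp add: phi_add XY YX A.compose_mem A.adj_mem A.add_mem)
  then have "complex_of_real ((pnorm 0 (?X + ?Y))\<^sup>2) = complex_of_real ((pnorm 0 ?X)\<^sup>2 + (pnorm 0 ?Y)\<^sup>2)"
    using XA YA by (simp only: pnorm_0_square A.add_mem of_real_add)
  then have eq: "(pnorm 0 (?X + ?Y))\<^sup>2 = (pnorm 0 ?X)\<^sup>2 + (pnorm 0 ?Y)\<^sup>2" by (simp only: of_real_eq_iff)
  have "(pnorm 0 ?X)\<^sup>2 \<le> (sqrt (8 * (q - p)) * pnorm 0 (u p))\<^sup>2"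
    using increment_bound[OF le upA] XA by (intro power_mono) auto
  also have "\<dots> = 8 * ((q - p) * (pnorm 0 (u p))\<^sup>2)" using le by (simp add: power_mult_distrib)
  finally have "(pnorm 0 ?X)\<^sup>2 \<le> 8 * ((q - p) * (pnorm 0 (u p))\<^sup>2)" .
  moreover have "(pnorm 0 ?Y)\<^sup>2 \<le> 8 * grid_sum (\<lambda>s. (pnorm 0 (u s))\<^sup>2) (q # R)"
    using 3 by (intro 3(2)) auto
  ultimately show ?case using eq by simp
qed auto

lemma step_process_mem_filtration:
  assumes "\<And>j. Suc j < length P \<Longrightarrow> c j \<in> filtration w (P ! j)"
  shows "step_process P c s \<in> filtration w s"
  unfolding step_process_def
proof (rule F.sum_mem)
  fix j assume "j \<in> {..<length P - 1}"
  then have c: "c j \<in> filtration w (P ! j)" using assms by auto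
  show "indicator {P ! j..<P ! Suc j} s *\<^sub>R c j \<in> filtration w s"
  proof (cases "s \<in> {P ! j..<P ! Suc j}")
    case True
    then show ?thesis using filtration_mono[OF c] by auto
  qed auto
qed

text \<open>On the merged grid the difference of the two step integrals is a single one, to which
  \<open>grid_integral_bound\<close> applies.\<close>

lemma step_integral_diff_bound:
  assumes P: "sorted P" "P \<noteq> []" "hd P = 0" "last P = t" and Q: "sorted Q" "Q \<noteq> []" "hd Q = 0" "last Q = t"
    and c: "\<And>j. Suc j < length P \<Longrightarrow> c j \<in> filtration w (P ! j)"
    and d: "\<And>j. Suc j < length Q \<Longrightarrow> d j \<in> filtration w (Q ! j)"
  defines "f \<equiv> \<lambda>s. (pnorm 0 (step_process P c s - step_process Q d s))\<^sup>2"
  shows "f integrable_on {0..t}"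
    and "(pnorm 0 (step_integral w P c - step_integral w Q d))\<^sup>2 \<le> 8 * integral {0..t} f"
proof -
  let ?u = "step_process P c" and ?v = "step_process Q d"
  define S where "S = sort (P @ Q)"
  \<comment> \<open>\<open>grid_integral_merge\<close> is used in both orders, and both produce the
    same merged grid.\<close>
  have S': "S = sort (Q @ P)" unfolding S_def by (rule properties_for_sort) auto
  have hl: "hd P = hd Q" "last P = last Q" "hd Q = hd P" "last Q = last P" using P Q by auto
  note v = grid_integral_merge[OF P(1,2) Q(1,2) hl(1,2) const_on_grid_step_process[OF Q(1)], folded S_def]
  note u = grid_integral_merge[OF Q(1,2) P(1,2) hl(3,4) const_on_grid_step_process[OF P(1)], folded S']
  have S: "sorted S" "S \<noteq> []" "hd S = 0" "last S = t" using v(3-6) Q by auto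
  have "const_on_grid f S" unfolding f_def
    by (rule const_on_grid_combine[where f = "\<lambda>x y. (pnorm 0 (x - y))\<^sup>2", OF u(1) v(1)])
  then have int: "(f has_integral grid_sum f S) {0..t}" using grid_sum_has_integral[of S f] S by simp
  then show "f integrable_on {0..t}" by blast
  have "step_integral w P c - step_integral w Q d = grid_integral w (\<lambda>s. ?u s - ?v s) S"
    using P Q by (simp add: step_integral_eq_grid_integral grid_integral_diff u(2) v(2))
  also have "(pnorm 0 \<dots>)\<^sup>2 \<le> 8 * grid_sum f S" unfolding f_def
  proof (rule grid_integral_bound[OF S(1)])
    fix r assume "r \<in> set S"
    then have "0 \<le> r" using sorted_subset_hd_last[OF S(1)] S(3) by auto
    then show "0 \<le> r \<and> ?u r - ?v r \<in> filtration w r"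
      using c d by (auto intro!: F.diff_mem step_process_mem_filtration)
  qed
  also have "grid_sum f S = integral {0..t} f" using int by (simp add: integral_unique)
  finally show "(pnorm 0 (step_integral w P c - step_integral w Q d))\<^sup>2 \<le> 8 * integral {0..t} f" .
qed

lemma step_integral_mem:
  assumes "sorted P" "hd P = 0" "\<And>j. Suc j < length P \<Longrightarrow> c j \<in> filtration w (P ! j)"
  shows "step_integral w P c \<in> A"
  unfolding step_integral_eq_grid_integral[OF assms(1)]
proof (rule grid_integral_mem[OF assms(1)])
  fix r assume "r \<in> set P"
  then have "0 \<le> r" using sorted_subset_hd_last[OF assms(1)] assms(2) by auto
  then show "0 \<le> r \<and> step_process P c r \<in> filtration w r"
    using assms(3) by (auto intro!: step_process_mem_filtration)
qed

end

section \<open>Convergence in \<open>L\<^sup>2\<close>\<close>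

locale free_multiplicative_bm = circular_bm A \<phi> w
  for A :: "('h::complex_hilbert_space \<Rightarrow>\<^sub>L 'h) set" and \<phi> w +
  fixes b :: "real \<Rightarrow> ('h \<Rightarrow>\<^sub>L 'h)"
  assumes fmbm: "free_multiplicative_brownian_motion w b"
begin

lemma b_mem: "0 \<le> t \<Longrightarrow> b t \<in> A"
  using fmbm filtration_subset by (auto simp: free_multiplicative_brownian_motion_def)

text \<open>Compare the \<open>k\<close>-th approximant of the integral of \<open>b\<close> with the
  step integral that yields \<open>path_product\<close>. The integrands differ by three terms:
  approximant minus \<open>b\<close>, which vanishes as \<open>k\<close> grows; the oscillation of
  \<open>b\<close> on a cell, at most \<open>\<omega>\<close>; and the error at the left endpoint,
  which feeds the Gronwall argument.\<close>

lemma path_product_error_step: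
  assumes Q: "sorted Q" "Q \<noteq> []" "hd Q = 0" and n: "n < length Q"
    and C: "0 < C" "\<And>X. X \<in> A \<Longrightarrow> pnorm 0 X \<le> C * norm X"
    and \<omega>: "0 \<le> \<omega>" "\<And>j s. Suc j < length Q \<Longrightarrow> s \<in> {Q ! j..<Q ! Suc j} \<Longrightarrow> norm (b s - b (Q ! j)) \<le> \<omega>"
  defines "e \<equiv> \<lambda>j. (pnorm 0 (b (Q ! j) - path_product w Q j))\<^sup>2"
  shows "e n \<le> 32 * C\<^sup>2 * \<omega>\<^sup>2 * Q ! n + 32 * (\<Sum>j<n. (Q ! Suc j - Q ! j) * e j)"
proof -
  define t where "t = Q ! n"
  define R where "R = take (Suc n) Q"
  define v where "v = step_process R (path_product w Q)"
  have nonneg: "0 \<le> q" if "q \<in> set Q" for q using sorted_subset_hd_last[OF Q(1)] Q(3) that by auto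
  have Q0: "Q ! 0 = 0" using Q by (simp add: hd_conv_nth)
  have lenR: "length R = Suc n" using n by (simp add: R_def)
  have R_nth: "R ! j = Q ! j" if "j \<le> n" for j using that by (simp add: R_def)
  have "R ! 0 = 0" "R ! n = t" using R_nth[of 0] R_nth[of n] Q0 by (auto simp: t_def)
  moreover have Rne: "R \<noteq> []" using lenR by auto
  ultimately have R: "sorted R" "hd R = 0" "last R = t"
    using Q(1) lenR by (auto simp: R_def sorted_wrt_take hd_conv_nth last_conv_nth)
  have range: "0 \<le> Q ! j" "Q ! j \<le> t" if "j \<le> n" for j
    using that n Q(1) nonneg by (auto simp: t_def sorted_iff_nth_mono)
  have t: "0 \<le> t" using range[of n] by simp
  have ppF: "path_product w Q j \<in> filtration w (Q ! j)" if "j \<le> n" for j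
    using that n Q(1) nonneg by (intro path_product_mem_filtration) auto
  have ppA: "path_product w Q j \<in> A" if "j \<le> n" for j using ppF[OF that] by (rule filtration_subset)
  have d: "path_product w Q j \<in> filtration w (R ! j)" if "Suc j < length R" for j
    using that ppF[of j] R_nth[of j] lenR by simp
  \<comment> \<open>From \<open>(x + y + z)^2 <= 2 x^2 + 4 y^2 + 4 z^2\<close>, where the
    \<open>x\<close> term disappears as \<open>k\<close> grows; times the 8 of the
    \<open>L^2\<close> bound this gives 32.\<close>
  define g where "g j = 4 * C\<^sup>2 * \<omega>\<^sup>2 + 4 * e j" for j
  let ?H = "\<Sum>j<n. (Q ! Suc j - Q ! j) * g j"
  \<comment> \<open>A step function as majorant, so that no integrability in \<open>s\<close> of
    \<open>L^2\<close> norms involving \<open>b s\<close> has to be established.\<close>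
  define G where "G = step_function R g"
  have g: "0 \<le> g j" for j by (simp add: g_def e_def)
  have G_eq: "G s = g j" "v s = path_product w Q j" if "j < n" "s \<in> {Q ! j..<Q ! Suc j}" for j s
  proof -
    have "Suc j < length R" "s \<in> {R ! j..<R ! Suc j}"
      using that R_nth[of j] R_nth[of "Suc j"] lenR by auto
    then show "G s = g j" "v s = path_product w Q j"
      unfolding G_def v_def by (rule step_function_eq[OF R(1)], rule step_process_eq[OF R(1)])
  qed
  have "grid_sum G R = ?H"
    unfolding grid_sum_eq_sum lenR
  proof (rule sum.cong)
    fix j assume "j \<in> {..<n}"
    then have j: "j < n" by simp
    then have "Q ! j \<le> Q ! Suc j" using Q(1) n by (intro sorted_nth_mono) auto
    then consider "Q ! j = Q ! Suc j" | "Q ! j \<in> {Q ! j..<Q ! Suc j}" by fastforce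
    then show "(R ! Suc j - R ! j) * G (R ! j) = (Q ! Suc j - Q ! j) * g j"
      using j by cases (auto simp: R_nth G_eq)
  qed simp
  moreover have "const_on_grid G R" unfolding G_def by (rule const_on_grid_step_function[OF R(1)])
  ultimately have intG: "(G has_integral ?H) {0..t}"
    using grid_sum_has_integral[OF R(1) Rne, of G] R by simp
  obtain I where I: "has_free_integral w b t I" "b t = id_blinfun + I"
    using fmbm t unfolding free_multiplicative_brownian_motion_def by blast
  obtain P c where P: "\<And>k::nat. partition_of t (P k)"
    and c: "\<And>k j. Suc j < length (P k) \<Longrightarrow> c k j \<in> filtration w (P k ! j)"
    and int: "\<And>k. (\<lambda>s. (norm (step_process (P k) (c k) s - b s))\<^sup>2) integrable_on {0..t}"
    and lim: "(\<lambda>k. integral {0..t} (\<lambda>s. (norm (step_process (P k) (c k) s - b s))\<^sup>2)) \<longlonglongrightarrow> 0"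
      "(\<lambda>k. step_integral w (P k) (c k)) \<longlonglongrightarrow> I"
    using I(1) unfolding has_free_integral_def by blast
  have Pk: "sorted (P k)" "P k \<noteq> []" "hd (P k) = 0" "last (P k) = t" for k
    using P[of k] by (auto simp: partition_of_def strict_sorted_imp_sorted)
  let ?J = "\<lambda>k. step_integral w (P k) (c k)" and ?\<delta> = "\<lambda>k. integral {0..t} (\<lambda>s. (norm (step_process (P k) (c k) s - b s))\<^sup>2)"
  have I': "step_integral w R (path_product w Q) = path_product w Q n - id_blinfun"
    unfolding R_def by (rule step_integral_path_product[OF n])
  have IA: "I \<in> A"
  proof -
    have "I = b t - id_blinfun" using I(2) by simp
    then show ?thesis using b_mem[OF t] by (simp add: A.diff_mem)
  qed
  have est: "pnorm 0 (b t - path_product w Q n) \<le> C * norm (I - ?J k) +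
      sqrt (8 * (2 * C\<^sup>2 * ?\<delta> k + ?H))" for k
  proof -
    let ?u = "step_process (P k) (c k)"
    have JA: "?J k \<in> A" using Pk c by (intro step_integral_mem) auto
    have JI: "?J k - step_integral w R (path_product w Q) \<in> A"
      using JA ppA[of n] by (simp add: I' A.diff_mem)
    note cmp = step_integral_diff_bound[OF Pk R(1) Rne R(2,3) c d, of k, folded v_def]
    have "integral {0..t} (\<lambda>s. (pnorm 0 (?u s - v s))\<^sup>2) \<le> integral {0..t} (\<lambda>s. 2 * C\<^sup>2 * (norm (?u s - b s))\<^sup>2 + G s)"
    proof (rule integral_le)
      show "(\<lambda>s. (pnorm 0 (?u s - v s))\<^sup>2) integrable_on {0..t}" by (rule cmp(1))
      show "(\<lambda>s. 2 * C\<^sup>2 * (norm (?u s - b s))\<^sup>2 + G s) integrable_on {0..t}"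
        using int[of k] intG by (intro integrable_add integrable_on_mult_right) auto
      fix s assume s: "s \<in> {0..t}"
      have uA: "?u s \<in> A" and vA: "v s \<in> A"
        using c d by (auto simp: v_def intro!: filtration_subset[OF step_process_mem_filtration])
      have bA: "b s \<in> A" using s by (intro b_mem) simp
      show "(pnorm 0 (?u s - v s))\<^sup>2 \<le> 2 * C\<^sup>2 * (norm (?u s - b s))\<^sup>2 + G s"
      proof (cases "s = t")
        \<comment> \<open>All cells are half-open, so at the right end \<open>t\<close> both step
          processes take the default value 0.\<close>
        case True
        have "s \<notin> {P k ! j..<P k ! Suc j}" if "Suc j < length (P k)" for j
          using sorted_subset_hd_last[OF Pk(1)[of k]] Pk(4)[of k] nth_mem[OF that] True by auto
        then have "?u s = 0" by (intro step_process_outside) blast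
        moreover have "s \<notin> {R ! j..<R ! Suc j}" if "Suc j < length R" for j
          using sorted_subset_hd_last[OF R(1)] R(3) nth_mem[OF that] True by auto
        then have "v s = 0" unfolding v_def by (intro step_process_outside) blast
        moreover have "0 \<le> G s" unfolding G_def step_function_def using g by (intro sum_nonneg) auto
        ultimately show ?thesis by simp
      next
        case False
        then have "Q ! 0 \<le> s" "s < Q ! n" using s Q0 by (auto simp: t_def)
        then obtain j where j: "j < n" "s \<in> {Q ! j..<Q ! Suc j}" using exists_grid_interval by blast
        let ?D = "b (Q ! j) - path_product w Q j"
        have bj: "b (Q ! j) \<in> A" using j range[of j] by (intro b_mem) simp
        have vs: "v s = path_product w Q j" by (rule G_eq(2)[OF j])
        have "?u s - v s = (?u s - b s) + (b s - b (Q ! j)) + (b (Q ! j) - path_product w Q j)"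
          by (simp add: vs)
        then have "pnorm 0 (?u s - v s) \<le> pnorm 0 (?u s - b s) + pnorm 0 (b s - b (Q ! j)) + pnorm 0 ?D"
          using pnorm_triangle[of "?u s - b s" "b s - b (Q ! j)" 0]
            pnorm_triangle[of "(?u s - b s) + (b s - b (Q ! j))" ?D 0]
            uA bA bj ppA[of j] j(1) by (simp add: A.diff_mem A.add_mem del: diff_add_cancel add_diff_cancel)
        also have "\<dots> \<le> C * norm (?u s - b s) + C * \<omega> + pnorm 0 ?D"
        proof (intro add_mono order_refl)
          show "pnorm 0 (?u s - b s) \<le> C * norm (?u s - b s)" using uA bA by (intro C A.diff_mem)
          have "pnorm 0 (b s - b (Q ! j)) \<le> C * norm (b s - b (Q ! j))" using bA bj by (intro C A.diff_mem)
          also have "\<dots> \<le> C * \<omega>" using \<omega>(2)[of j s] j n C by (intro mult_left_mono) auto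
          finally show "pnorm 0 (b s - b (Q ! j)) \<le> C * \<omega>" .
        qed
        finally have "(pnorm 0 (?u s - v s))\<^sup>2 \<le> (C * norm (?u s - b s) + (C * \<omega> + pnorm 0 ?D))\<^sup>2"
          using uA vA by (intro power_mono) (auto simp: A.diff_mem add.assoc)
        also have "\<dots> \<le> 2 * (C * norm (?u s - b s))\<^sup>2 + 2 * (C * \<omega> + pnorm 0 ?D)\<^sup>2"
          using norm_add_square_le[of "C * norm (?u s - b s)" "C * \<omega> + pnorm 0 ?D"] by simp
        also have "\<dots> \<le> 2 * (C * norm (?u s - b s))\<^sup>2 + 2 * (2 * (C * \<omega>)\<^sup>2 + 2 * e j)"
          using norm_add_square_le[of "C * \<omega>" "pnorm 0 ?D"] by (simp add: e_def)
        also have "\<dots> = 2 * C\<^sup>2 * (norm (?u s - b s))\<^sup>2 + G s"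
          by (simp add: G_eq(1)[OF j] g_def power_mult_distrib)
        finally show ?thesis .
      qed
    qed
    also have "\<dots> = 2 * C\<^sup>2 * ?\<delta> k + ?H"
      using int[of k] intG by (subst integral_add) (auto simp: integral_unique intro: integrable_on_mult_right)
    finally have "(pnorm 0 (?J k - step_integral w R (path_product w Q)))\<^sup>2 \<le> 8 * (2 * C\<^sup>2 * ?\<delta> k + ?H)"
      using cmp(2) by simp
    then have 1: "pnorm 0 (?J k - step_integral w R (path_product w Q)) \<le> sqrt (8 * (2 * C\<^sup>2 * ?\<delta> k + ?H))"
      by (rule real_le_rsqrt)
    have "b t - path_product w Q n = (I - ?J k) + (?J k - step_integral w R (path_product w Q))"
      by (simp add: I(2) I')
    then have "pnorm 0 (b t - path_product w Q n) \<le> pnorm 0 (I - ?J k) + pnorm 0 (?J k - step_integral w R (path_product w Q))"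
      using pnorm_triangle[OF _ JI, of "I - ?J k" 0] IA JA by (simp only: A.diff_mem)
    also have "\<dots> \<le> C * norm (I - ?J k) + sqrt (8 * (2 * C\<^sup>2 * ?\<delta> k + ?H))"
      using IA JA by (intro add_mono C 1 A.diff_mem)
    finally show ?thesis .
  qed
  \<comment> \<open>Letting \<open>k\<close> grow removes the grids supplied by the integral and
    leaves only \<open>Q\<close>.\<close>
  have "(\<lambda>k. C * norm (I - ?J k) + sqrt (8 * (2 * C\<^sup>2 * ?\<delta> k + ?H)))
      \<longlonglongrightarrow> C * norm (I - I) + sqrt (8 * (2 * C\<^sup>2 * 0 + ?H))"
    by (intro tendsto_intros lim)
  then have "pnorm 0 (b t - path_product w Q n) \<le> C * norm (I - I) + sqrt (8 * (2 * C\<^sup>2 * 0 + ?H))"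
    by (rule LIMSEQ_le_const) (use est in blast)
  then have le: "pnorm 0 (b t - path_product w Q n) \<le> sqrt (8 * ?H)" by simp
  have nn: "0 \<le> ?H"
  proof (intro sum_nonneg mult_nonneg_nonneg g)
    fix j assume "j \<in> {..<n}"
    then show "0 \<le> Q ! Suc j - Q ! j" using Q(1) n by (simp add: sorted_iff_nth_mono)
  qed
  have "e n \<le> (sqrt (8 * ?H))\<^sup>2"
    unfolding e_def t_def[symmetric] using le b_mem[OF t] ppA[of n] by (intro power_mono) (auto simp: A.diff_mem)
  also have "\<dots> = 8 * ?H" using nn by simp
  also have "\<dots> = 32 * C\<^sup>2 * \<omega>\<^sup>2 * (\<Sum>j<n. Q ! Suc j - Q ! j) + 32 * (\<Sum>j<n. (Q ! Suc j - Q ! j) * e j)"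
    by (simp add: g_def sum.distrib sum_distrib_left distrib_left mult_ac)
  also have "(\<Sum>j<n. Q ! Suc j - Q ! j) = Q ! n" using sum_lessThan_telescope[of "\<lambda>j. Q ! j" n] Q0 by simp
  finally show ?thesis .
qed

end

context free_multiplicative_bm
begin

lemma path_product_error:
  assumes Q: "sorted Q" "Q \<noteq> []" "hd Q = 0" and n: "n < length Q"
    and C: "0 < C" "\<And>X. X \<in> A \<Longrightarrow> pnorm 0 X \<le> C * norm X"
    and \<omega>: "0 \<le> \<omega>" "\<And>j s. Suc j < length Q \<Longrightarrow> s \<in> {Q ! j..<Q ! Suc j} \<Longrightarrow> norm (b s - b (Q ! j)) \<le> \<omega>"
    and T: "set Q \<subseteq> {0..T}"
  shows "(pnorm 0 (b (Q ! n) - path_product w Q n))\<^sup>2 \<le> 32 * C\<^sup>2 * \<omega>\<^sup>2 * T * exp (32 * T)"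
proof -
  define e where "e j = (pnorm 0 (b (Q ! j) - path_product w Q j))\<^sup>2" for j
  have Q0: "Q ! 0 = 0" using Q by (simp add: hd_conv_nth)
  have range: "0 \<le> Q ! j" "Q ! j \<le> T" if "j < length Q" for j using T nth_mem[OF that] by auto
  have T0: "0 \<le> T" using range[OF n] by simp
  have "e n \<le> (32 * C\<^sup>2 * \<omega>\<^sup>2 * T) * exp (32 * (\<Sum>j<n. Q ! Suc j - Q ! j))"
  proof (rule discrete_gronwall[where N = n])
    show "0 \<le> Q ! Suc j - Q ! j" if "j < n" for j
      using that Q(1) n by (simp add: sorted_iff_nth_mono)
    fix k assume k: "k \<le> n"
    then have kl: "k < length Q" using n by simp
    have "e k \<le> 32 * C\<^sup>2 * \<omega>\<^sup>2 * Q ! k + 32 * (\<Sum>j<k. (Q ! Suc j - Q ! j) * e j)"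
      unfolding e_def by (rule path_product_error_step[OF Q kl C \<omega>])
    also have "32 * C\<^sup>2 * \<omega>\<^sup>2 * Q ! k \<le> 32 * C\<^sup>2 * \<omega>\<^sup>2 * T" using range[OF kl] by (intro mult_left_mono) auto
    finally show "e k \<le> 32 * C\<^sup>2 * \<omega>\<^sup>2 * T + 32 * (\<Sum>j<k. (Q ! Suc j - Q ! j) * e j)" by simp
  qed (use T0 in auto)
  also have "(\<Sum>j<n. Q ! Suc j - Q ! j) = Q ! n" using sum_lessThan_telescope[of "\<lambda>j. Q ! j" n] Q0 by simp
  also have "32 * C\<^sup>2 * \<omega>\<^sup>2 * T * exp (32 * Q ! n) \<le> 32 * C\<^sup>2 * \<omega>\<^sup>2 * T * exp (32 * T)"
    using range[OF n] T0 by (intro mult_left_mono) auto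
  finally show ?thesis by (simp add: e_def)
qed

end

section \<open>Partitions cut off at a time\<close>

lemma sorted_map_min: "sorted P \<Longrightarrow> sorted (map (\<lambda>p. min p (t::real)) P)"
  by (induction P) (auto simp: min_le_iff_disj min_def)

text \<open>Points of \<open>P\<close> beyond \<open>t\<close> all become \<open>t\<close>, and the
  factors of the collapsed cells become the identity; so \<open>t\<close> need not be inserted into
  the partition.\<close>

lemma b_partition_eq_path_product:
  "b_partition w P t = path_product w (map (\<lambda>p. min p t) P) (length P - 1)"
  unfolding b_partition_def path_product_def
  by (intro arg_cong[where f = op_prod] map_cong) (auto simp: add_diff_eq)

lemma mesh_ge: "Suc j < length P \<Longrightarrow> P ! Suc j - P ! j \<le> mesh P"
proof -
  assume j: "Suc j < length P"
  have "{P ! Suc j - P ! j |j. Suc j < length P} = (\<lambda>j. P ! Suc j - P ! j) ` {j. Suc j < length P}" by blast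
  moreover have "finite {j. Suc j < length P}" by (rule finite_subset[of _ "{..<length P}"]) auto
  ultimately have "finite {P ! Suc j - P ! j |j. Suc j < length P}" by simp
  then show ?thesis unfolding mesh_def by (rule Max_ge) (use j in blast)
qed

lemma truncated_partition:
  assumes P: "partition_of T P" and t: "t \<in> {0..T}"
  defines "Q \<equiv> map (\<lambda>p. min p t) P"
  shows "sorted Q" "Q \<noteq> []" "hd Q = 0" "set Q \<subseteq> {0..T}" "length P - 1 < length Q" "Q ! (length P - 1) = t"
    and "\<And>j. Suc j < length Q \<Longrightarrow> Q ! Suc j - Q ! j \<le> mesh P"
proof -
  have sP: "sorted P" and P': "P \<noteq> []" "hd P = 0" "last P = T"
    using P by (auto simp: partition_of_def strict_sorted_imp_sorted)
  show "sorted Q" unfolding Q_def by (rule sorted_map_min[OF sP])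
  show ne: "Q \<noteq> []" using P' by (simp add: Q_def)
  show "hd Q = 0" using P' t by (simp add: Q_def hd_map)
  show "set Q \<subseteq> {0..T}" using sorted_subset_hd_last[OF sP] P' t by (auto simp: Q_def)
  show "length P - 1 < length Q" using P' by (simp add: Q_def)
  show "Q ! (length P - 1) = t" using P' t last_conv_nth[OF P'(1)] by (simp add: Q_def)
  show "Q ! Suc j - Q ! j \<le> mesh P" if j: "Suc j < length Q" for j
  proof -
    have "P ! j \<le> P ! Suc j" using sP j by (intro sorted_nth_mono) (auto simp: Q_def)
    then have "Q ! Suc j - Q ! j \<le> P ! Suc j - P ! j" using j by (auto simp: Q_def min_def)
    also have "\<dots> \<le> mesh P" using j by (intro mesh_ge) (simp add: Q_def)
    finally show ?thesis .
  qed
qed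

context circular_bm
begin

lemma b_partition_mem:
  assumes "partition_of T P" "t \<in> {0..T}"
  shows "b_partition w P t \<in> A"
  unfolding b_partition_eq_path_product using truncated_partition[OF assms]
  by (intro filtration_subset[OF path_product_mem_filtration]) auto

lemma b_partition_moment_bound:
  "\<exists>M. \<forall>P t. partition_of T P \<longrightarrow> t \<in> {0..T} \<longrightarrow> pnorm m (b_partition w P t) \<le> M"
proof -
  obtain M where M: "\<forall>Q j. sorted Q \<longrightarrow> set Q \<subseteq> {0..T} \<longrightarrow> j < length Q \<longrightarrow> pnorm m (path_product w Q j) \<le> M"
    using path_product_moment_bound by blast
  have "pnorm m (b_partition w P t) \<le> M" if "partition_of T P" "t \<in> {0..T}" for P t
    unfolding b_partition_eq_path_product using M truncated_partition(1,4,5)[OF that] by blast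
  then show ?thesis by blast
qed

end

text \<open>Uniform continuity of \<open>b\<close> on the compact interval makes its oscillation on
  every cell small once the mesh is small, and \<open>path_product_error\<close> is proportional to
  the square of that oscillation with a factor independent of the partition.\<close>

lemma (in free_multiplicative_bm) b_partition_tendsto:
  assumes P: "\<And>k. partition_of T (P k)" and mesh: "(\<lambda>k. mesh (P k)) \<longlonglongrightarrow> 0" and t: "t \<in> {0..T}"
  shows "(\<lambda>k. pnorm 0 (b_partition w (P k) t - b t)) \<longlonglongrightarrow> 0"
proof -
  obtain C where C: "0 < C" "\<And>X. X \<in> A \<Longrightarrow> pnorm 0 X \<le> C * norm X" using pnorm_0_le_norm by blast
  have T: "0 \<le> T" using t by simp
  define K where "K = 32 * C\<^sup>2 * T * exp (32 * T) + 1"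
  have K: "0 < K" using T by (simp add: K_def add_nonneg_pos)
  have uc: "uniformly_continuous_on {0..T} b"
  proof (rule compact_uniformly_continuous[OF _ compact_Icc])
    have "continuous_on {0..} b" using fmbm by (simp add: free_multiplicative_brownian_motion_def)
    then show "continuous_on {0..T} b" by (rule continuous_on_subset) auto
  qed
  show ?thesis
  proof (rule LIMSEQ_I)
    fix r :: real assume r: "0 < r"
    \<comment> \<open>Chosen so that \<open>\<omega>\<^sup>2 * K\<close> equals
      \<open>r\<^sup>2 / 4\<close>; the 1 in \<open>K\<close> keeps it positive.\<close>
    define \<omega> where "\<omega> = r / (2 * sqrt K)"
    have \<omega>: "0 < \<omega>" "\<omega>\<^sup>2 * K < r\<^sup>2" using r K by (auto simp: \<omega>_def power_divide power_mult_distrib)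
    obtain \<delta> where \<delta>: "0 < \<delta>" "\<And>s s'. s \<in> {0..T} \<Longrightarrow> s' \<in> {0..T} \<Longrightarrow> dist s' s < \<delta> \<Longrightarrow> dist (b s') (b s) < \<omega>"
      using uc \<omega>(1) unfolding uniformly_continuous_on_def by blast
    have "eventually (\<lambda>k. mesh (P k) < \<delta>) sequentially" using mesh \<delta>(1) by (rule order_tendstoD)
    then obtain N where N: "\<And>k. k \<ge> N \<Longrightarrow> mesh (P k) < \<delta>" by (auto simp: eventually_sequentially)
    have "norm (pnorm 0 (b_partition w (P k) t - b t) - 0) < r" if k: "k \<ge> N" for k
    proof -
      let ?Q = "map (\<lambda>p. min p t) (P k)"
      note Q = truncated_partition[OF P[of k] t]
      have BA: "b_partition w (P k) t \<in> A" by (rule b_partition_mem[OF P t])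
      have bA: "b t \<in> A" using t by (intro b_mem) simp
      have "(pnorm 0 (b (?Q ! (length (P k) - 1)) - path_product w ?Q (length (P k) - 1)))\<^sup>2
          \<le> 32 * C\<^sup>2 * \<omega>\<^sup>2 * T * exp (32 * T)"
      proof (rule path_product_error[OF Q(1,2,3,5) C _ _ Q(4)])
        show "0 \<le> \<omega>" using \<omega> by simp
        fix j s assume j: "Suc j < length ?Q" and s: "s \<in> {?Q ! j..<?Q ! Suc j}"
        have "?Q ! j \<in> {0..T}" "?Q ! Suc j \<in> {0..T}"
          using Q(4) nth_mem[of j ?Q] nth_mem[OF j] j by (auto simp del: nth_map)
        moreover then have "s \<in> {0..T}" using s by auto
        moreover have "dist s (?Q ! j) < \<delta>" using s Q(7)[OF j] N[OF k] by (simp add: dist_real_def del: nth_map)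
        ultimately have "dist (b s) (b (?Q ! j)) < \<omega>" by (intro \<delta>(2))
        then show "norm (b s - b (?Q ! j)) \<le> \<omega>" by (simp add: dist_norm del: nth_map)
      qed
      also have "\<dots> \<le> \<omega>\<^sup>2 * K" using T by (simp add: K_def algebra_simps)
      also have "\<dots> < r\<^sup>2" by (rule \<omega>(2))
      finally have "(pnorm 0 (b t - b_partition w (P k) t))\<^sup>2 < r\<^sup>2"
        unfolding b_partition_eq_path_product Q(6) .
      then have "pnorm 0 (b t - b_partition w (P k) t) < r" using r by (simp add: power2_less_imp_less)
      moreover have "pnorm 0 (b_partition w (P k) t - b t) = pnorm 0 (b t - b_partition w (P k) t)"
        using pnorm_uminus[of "b t - b_partition w (P k) t" 0] BA bA by (simp add: A.diff_mem)
      ultimately show ?thesis using BA bA by (simp add: A.diff_mem)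
    qed
    then show "\<exists>no. \<forall>k\<ge>no. norm (pnorm 0 (b_partition w (P k) t - b t) - 0) < r" by blast
  qed
qed

section \<open>Convergence of joint moments\<close>

context wstar_probability_space
begin

text \<open>Letters are replaced from the right, and \<open>vs\<close> collects those already
  replaced. By traciality one replacement costs at most the \<open>L^2\<close> distance of the
  letters times the \<open>L^2\<close> norm of the remaining product; Hoelder bounds the latter by
  norms that \<open>bdd\<close> keeps bounded in \<open>k\<close>.\<close>

lemma phi_op_prod_tendsto:
  fixes f :: "nat \<Rightarrow> 'i \<Rightarrow> ('h \<Rightarrow>\<^sub>L 'h)"
  assumes f: "\<And>k x. x \<in> I \<Longrightarrow> f k x \<in> A" and g: "\<And>x. x \<in> I \<Longrightarrow> g x \<in> A"
    and lim: "\<And>x. x \<in> I \<Longrightarrow> (\<lambda>k. pnorm 0 (f k x - g x)) \<longlonglongrightarrow> 0"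
    and bdd: "\<And>x m. x \<in> I \<Longrightarrow> \<exists>M. \<forall>k. pnorm m (f k x) \<le> M"
  shows "set us \<subseteq> I \<Longrightarrow> set vs \<subseteq> I \<Longrightarrow>
    (\<lambda>k. \<phi> (op_prod (map (f k) us @ map g vs))) \<longlonglongrightarrow> \<phi> (op_prod (map g us @ map g vs))"
proof (induction us arbitrary: vs rule: rev_induct)
  case (snoc u us)
  then have u: "u \<in> I" and us: "set us \<subseteq> I" by auto
  define V where "V = op_prod (map g vs)"
  define U where "U k = op_prod (map (f k) us)" for k
  \<comment> \<open>\<open>pnorm_op_prod\<close> costs one level per letter, starting from the level
    1 at which \<open>U k\<close> is estimated.\<close>
  define n where "n = Suc 0 + length us"
  have VA: "V \<in> A" unfolding V_def using snoc.prems g by (intro A.op_prod_mem) auto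
  have UA: "U k \<in> A" for k unfolding U_def using us f by (intro A.op_prod_mem) auto
  obtain M where M: "\<And>x k. x \<in> I \<Longrightarrow> pnorm n (f k x) \<le> M x" using bdd[of _ n] by metis
  have prod: "prod_list (map (pnorm n) (map (f k) xs)) \<le> prod_list (map M xs)
      \<and> 0 \<le> prod_list (map (pnorm n) (map (f k) xs))" if "set xs \<subseteq> I" for k xs
    using that
  proof (induction xs)
    case (Cons x xs)
    have "0 \<le> pnorm n (f k x)" "pnorm n (f k x) \<le> M x" using Cons.prems f M by auto
    then show ?case using Cons by (auto intro!: mult_mono)
  qed simp
  have Ubound: "pnorm 1 (U k) \<le> prod_list (map M us)" for k
  proof -
    have "pnorm 1 (U k) \<le> prod_list (map (pnorm n) (map (f k) us))"
      unfolding U_def using us f by (intro pnorm_op_prod) (auto simp: n_def)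
    also have "\<dots> \<le> prod_list (map M us)" using prod[OF us] by blast
    finally show ?thesis .
  qed
  have split: "\<phi> (op_prod (map (f k) (us @ [u]) @ map g vs)) =
      \<phi> (op_prod (map (f k) us @ map g (u # vs))) + \<phi> (U k o\<^sub>L ((f k u - g u) o\<^sub>L V))" for k
  proof -
    have "op_prod (map (f k) (us @ [u]) @ map g vs) =
        op_prod (map (f k) us @ map g (u # vs)) + (U k o\<^sub>L ((f k u - g u) o\<^sub>L V))"
      by (simp add: U_def V_def op_prod_append compose_diff_left compose_diff_right compose_assoc)
    moreover have "op_prod (map (f k) us @ map g (u # vs)) \<in> A"
      using us u snoc.prems f g by (intro A.op_prod_mem) auto
    moreover have "U k o\<^sub>L ((f k u - g u) o\<^sub>L V) \<in> A"
      using UA VA u f g by (intro A.compose_mem A.diff_mem)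
    ultimately show ?thesis by (simp add: phi_add)
  qed
  have "(\<lambda>k. \<phi> (U k o\<^sub>L ((f k u - g u) o\<^sub>L V))) \<longlonglongrightarrow> 0"
  proof (rule Lim_null_comparison[OF always_eventually])
    show "(\<lambda>k. pnorm 0 (f k u - g u) * (pnorm 1 V * prod_list (map M us))) \<longlonglongrightarrow> 0"
      by (rule tendsto_mult_left_zero[OF lim[OF u]])
    show "\<forall>k. cmod (\<phi> (U k o\<^sub>L ((f k u - g u) o\<^sub>L V))) \<le> pnorm 0 (f k u - g u) * (pnorm 1 V * prod_list (map M us))"
    proof
      fix k
      have D: "f k u - g u \<in> A" using u f g by (intro A.diff_mem)
      have "\<phi> (U k o\<^sub>L ((f k u - g u) o\<^sub>L V)) = \<phi> ((f k u - g u) o\<^sub>L (V o\<^sub>L U k))"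
        using tracial[OF UA[of k] A.compose_mem[OF D VA]] by (simp add: compose_assoc)
      also have "cmod \<dots> \<le> pnorm 0 (f k u - g u) * pnorm 0 (V o\<^sub>L U k)"
        using D VA UA by (intro phi_compose_le A.compose_mem)
      also have "\<dots> \<le> pnorm 0 (f k u - g u) * (pnorm 1 V * prod_list (map M us))"
      proof (rule mult_left_mono)
        have "pnorm 0 (V o\<^sub>L U k) \<le> pnorm 1 V * pnorm 1 (U k)" using pnorm_compose[OF VA UA, of 0 k] by simp
        also have "\<dots> \<le> pnorm 1 V * prod_list (map M us)" using VA Ubound by (intro mult_left_mono) auto
        finally show "pnorm 0 (V o\<^sub>L U k) \<le> pnorm 1 V * prod_list (map M us)" .
      qed (use D in simp)
      finally show "cmod (\<phi> (U k o\<^sub>L ((f k u - g u) o\<^sub>L V))) \<le> pnorm 0 (f k u - g u) * (pnorm 1 V * prod_list (map M us))" .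
    qed
  qed
  moreover have "(\<lambda>k. \<phi> (op_prod (map (f k) us @ map g (u # vs)))) \<longlonglongrightarrow> \<phi> (op_prod (map g us @ map g (u # vs)))"
    using snoc.prems us by (intro snoc.IH) auto
  ultimately have "(\<lambda>k. \<phi> (op_prod (map (f k) (us @ [u]) @ map g vs))) \<longlonglongrightarrow> \<phi> (op_prod (map g us @ map g (u # vs))) + 0"
    unfolding split by (rule tendsto_add[rotated])
  then show ?case by simp
qed simp

end

theorem corollary1p16:
  fixes A :: "('h::complex_hilbert_space \<Rightarrow>\<^sub>L 'h) set"
    and \<phi> :: "('h \<Rightarrow>\<^sub>L 'h) \<Rightarrow> complex"
    and w b :: "real \<Rightarrow> ('h \<Rightarrow>\<^sub>L 'h)"
    and T :: real
    and P :: "nat \<Rightarrow> real list"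
  assumes "wstar_probability_space A \<phi>"
    and "circular_brownian_motion A \<phi> w"
    and "free_multiplicative_brownian_motion w b"
    and "0 < T"
    and "\<And>k. partition_of T (P k)"
    and "(\<lambda>k. mesh (P k)) \<longlonglongrightarrow> 0"
  shows "converges_fd_star \<phi> T (\<lambda>k. b_partition w (P k)) b"
proof -
  interpret free_multiplicative_bm A \<phi> w b
    using assms(1-3)
    by (intro free_multiplicative_bm.intro circular_bm.intro free_multiplicative_bm_axioms.intro
        circular_bm_axioms.intro)
  show ?thesis
    unfolding converges_fd_star_def
  proof (intro allI impI)
    fix ss :: "real list" and ws :: "(nat \<times> bool) list"
    assume ss: "set ss \<subseteq> {0..T}" and ws: "\<forall>(i, \<epsilon>) \<in> set ws. i < length ss"
    define letter where "letter a = (\<lambda>(i, \<epsilon>). if \<epsilon> then adj (a (ss ! i)) else a (ss ! i))"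
      for a :: "real \<Rightarrow> ('h \<Rightarrow>\<^sub>L 'h)"
    have time: "ss ! i \<in> {0..T}" if "(i, \<epsilon>) \<in> set ws" for i \<epsilon>
      using ss ws nth_mem[of i ss] that by blast
    have mem: "b_partition w (P k) (ss ! i) \<in> A" "b (ss ! i) \<in> A" if "(i, \<epsilon>) \<in> set ws" for k i \<epsilon>
      using time[OF that] by (auto intro: b_partition_mem[OF assms(5)] b_mem)
    have "(\<lambda>k. \<phi> (op_prod (map (letter (b_partition w (P k))) ws @ map (letter b) [])))
        \<longlonglongrightarrow> \<phi> (op_prod (map (letter b) ws @ map (letter b) []))"
    proof (rule phi_op_prod_tendsto[where I = "set ws"])
      fix x m assume "x \<in> set ws"
      moreover obtain i \<epsilon> where x: "x = (i, \<epsilon>)" by (cases x)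
      ultimately have i: "(i, \<epsilon>) \<in> set ws" by simp
      note lin = A.lin[OF mem(1)[OF i]] A.lin[OF mem(2)[OF i]]
      show "letter (b_partition w (P k)) x \<in> A" for k using mem[OF i] by (auto simp: letter_def x A.adj_mem)
      show "letter b x \<in> A" using mem[OF i] by (auto simp: letter_def x A.adj_mem)
      obtain M where "\<forall>P t. partition_of T P \<longrightarrow> t \<in> {0..T} \<longrightarrow> pnorm m (b_partition w P t) \<le> M"
        using b_partition_moment_bound by blast
      then have "pnorm m (letter (b_partition w (P k)) x) \<le> M" for k
        using time[OF i] assms(5) mem[OF i] by (auto simp: letter_def x pnorm_adj)
      then show "\<exists>M. \<forall>k. pnorm m (letter (b_partition w (P k)) x) \<le> M" by blast
      have "pnorm 0 (letter (b_partition w (P k)) x - letter b x)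
          = pnorm 0 (b_partition w (P k) (ss ! i) - b (ss ! i))" for k
      proof (cases \<epsilon>)
        case True
        \<comment> \<open>The difference is written with \<open>scale_op (-1)\<close> so that
          \<open>adj_add\<close> and \<open>adj_scale\<close> apply; \<open>pnorm_adj\<close> then
          reduces starred letters to unstarred ones.\<close>
        have "adj (b_partition w (P k) (ss ! i) + scale_op (-1) (b (ss ! i)))
            = adj (b_partition w (P k) (ss ! i)) + scale_op (-1) (adj (b (ss ! i)))"
          using lin by (simp add: adj_add adj_scale)
        then have "adj (b_partition w (P k) (ss ! i) - b (ss ! i)) = letter (b_partition w (P k)) x - letter b x"
          by (simp add: scale_op_minus1 letter_def x True)
        then show ?thesis using pnorm_adj[of "b_partition w (P k) (ss ! i) - b (ss ! i)" 0] mem[OF i]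
          by (simp add: A.diff_mem)
      qed (simp add: letter_def x)
      then show "(\<lambda>k. pnorm 0 (letter (b_partition w (P k)) x - letter b x)) \<longlonglongrightarrow> 0"
        using b_partition_tendsto[OF assms(5,6) time[OF i]] by simp
    qed auto
    then show "(\<lambda>k. \<phi> (star_word (b_partition w (P k)) ss ws)) \<longlonglongrightarrow> \<phi> (star_word b ss ws)"
      by (simp add: star_word_def letter_def)
  qed
qed

end
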